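(* Let $S$ be a commutative superring, let $(I,\le)$ be a directed set, and let $(L_i,f_{ji})$ be a directed system of Lie superalgebras over $S$ indexed by $I$, with direct limit $\varinjlim L_i$ and canonical maps $\varphi_i:L_i\to\varinjlim L_i$. Assume that all Lie superalgebras $L_i$ are perfect. Let $\widetilde\varphi_i:\mathfrak{uce}(L_i)\to\varinjlim\mathfrak{uce}(L_i)$ be the canonical maps into the direct limit of the directed system $(\mathfrak{uce}(L_i),\mathfrak{uce}(f_{ji}))$, and let $$\varphi:\varinjlim\mathfrak{uce}(L_i)\to\mathfrak{uce}(\varinjlim L_i)$$ be the unique Lie superalgebra morphism with $\varphi\circ\widetilde\varphi_i=\mathfrak{uce}(\varphi_i)$ for all $i\in I$. Then $\varphi$ is an isomorphism of Lie superalgebras, and hence, with $\mathfrak u_i:\mathfrak{uce}(L_i)\to L_i$, $\langle x,y\rangle\mapsto[x,y]$, the induced morphism $\varinjlim\mathfrak u_i:\varinjlim\mathfrak{uce}(L_i)\to\varinjlim L_i$ is a universal central extension. In particular, $\varinjlim\mathfrak u_i$ induces an isomorphism $$\varinjlim \mathrm H_2(L_i)\cong\mathrm H_2(\varinjlim L_i).$$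
   Context: A commutative superring $S$ is an associative unital $\mathbb Z/2\mathbb Z$-graded ring with $s_1s_2=(-1)^{|s_1||s_2|}s_2s_1$ for homogeneous $s_1,s_2$, where $|\cdot|$ denotes the degree; formulas involving degrees are understood for homogeneous elements. A Lie superalgebra over $S$ is an $S$-supermodule $L=L_{\bar 0}\oplus L_{\bar 1}$ with an $S$-bilinear product $[\cdot,\cdot]$ of degree $0$ such that $[x,y]+(-1)^{|x||y|}[y,x]=0$, $[x_{\bar 0},x_{\bar 0}]=0$ for $x_{\bar 0}\in L_{\bar 0}$, and $(-1)^{|x||z|}[x,[y,z]]+(-1)^{|y||x|}[y,[z,x]]+(-1)^{|z||y|}[z,[x,y]]=0$. Morphisms are $S$-linear maps of degree $0$ preserving products. $L$ is perfect if $L=[L,L]$. The centre is $\mathfrak z(L)=\{x\in L:[x,L]=0\}$. A central extension of $L$ is an epimorphism (surjective morphism) $f:K\to L$ of Lie superalgebras with $\operatorname{Ker} f\subset\mathfrak z(K)$. It is universal if for every central extension $f':K'\to L$ there is a unique Lie superalgebra morphism $g:K\to K'$ with $f=f'\circ g$. For any Lie superalgebra $L$ over $S$, let $\mathcal B_L$ be the $S$-submodule of $L\otimes_S L$ spanned by all elements $x\otimes y+(-1)^{|x||y|}y\otimes x$; $x_{\bar 0}\otimes x_{\bar 0}$ for $x_{\bar 0}\in L_{\bar 0}$; and $(-1)^{|x||z|}x\otimes[y,z]+(-1)^{|y||x|}y\otimes[z,x]+(-1)^{|z||y|}z\otimes[x,y]$. Put $\mathfrak{uce}(L)=(L\otimes_S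 L)/\mathcal B_L$ and $\langle x,y\rangle=x\otimes y+\mathcal B_L$. It is a Lie superalgebra with product $[\langle l_1,l_2\rangle,\langle l_3,l_4\rangle]=\langle[l_1,l_2],[l_3,l_4]\rangle$. The map $\mathfrak u_L:\mathfrak{uce}(L)\to L$, $\langle x,y\rangle\mapsto[x,y]$, is a morphism with central kernel; it is known that it is a universal central extension if $L$ is perfect. For a morphism $f:L\to M$ define $\mathfrak{uce}(f):\mathfrak{uce}(L)\to\mathfrak{uce}(M)$, $\langle l_1,l_2\rangle\mapsto\langle f(l_1),f(l_2)\rangle$; this makes $\mathfrak{uce}$ a covariant endofunctor. For a perfect Lie superalgebra $L$ define $\mathrm H_2(L)=\operatorname{Ker}(\mathfrak u_L:\mathfrak{uce}(L)\to L)$. A directed system consists of Lie superalgebras $L_i$ ($i\in I$) and morphisms $f_{ji}:L_i\to L_j$ for $i\le j$ with $f_{ii}=\mathrm{Id}$ and $f_{ki}=f_{kj}\circ f_{ji}$ for $i\le j\le k$; direct limits are taken in the category of Lie superalgebras over $S$. A direct limit of perfect Lie superalgebras is perfect. Since $\mathfrak u_j\circ\mathfrak{uce}(f_{ji})=f_{ji}\circ\mathfrak u_i$ for $i\le j$, the family $(\mathfrak u_i)$ induces $\varinjlim\mathfrak u_i$, and the modules $\mathrm H_2(L_i)=\operatorname{Ker}\mathfrak u_i$ form a directed system with transition maps the restrictions of $\mathfrak{uce}(f_{ji})$. *)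

theory Defs
  imports
    "HOL-Algebra.Module" "HOL-Algebra.AbelCoset" "HOL-Algebra.Generated_Groups"
    "HOL-Algebra.Free_Abelian_Groups" "HOL-Library.Z2"
begin

section \<open>Commutative superrings and supermodules\<close>

text \<open>
  Degrees are elements of the two-element field \<^typ>\<open>bit\<close>, so that the degree of a product is
  \<open>p + q\<close> and the exponent in the sign rule is \<open>p * q\<close>.  A formula involving degrees is imposed on
  all homogeneous elements \<open>x \<in> part M p\<close>, with \<open>p\<close> in the role of the degree of \<open>x\<close>.
\<close>

definition Z2_grading :: "('a, 'm) ring_scheme \<Rightarrow> (bit \<Rightarrow> 'a set) \<Rightarrow> bool" where
  "Z2_grading G D \<longleftrightarrow>
     (\<forall>p. additive_subgroup (D p) G) \<and>
     D 0 \<inter> D 1 = {\<zero>\<^bsub>G\<^esub>} \<and> carrier G = D 0 <+>\<^bsub>G\<^esub> D 1"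

text \<open>\<open>sgn_pow G k x\<close> is \<open>(-1)\<^sup>k x\<close>.\<close>

definition sgn_pow :: "('a, 'm) ring_scheme \<Rightarrow> bit \<Rightarrow> 'a \<Rightarrow> 'a" where
  "sgn_pow G k x = (if k = 1 then \<ominus>\<^bsub>G\<^esub> x else x)"

record 's superring = "'s ring" +
  spart :: "bit \<Rightarrow> 's set"

locale comm_superring = ring S for S :: "'s superring" (structure) +
  assumes grading: "Z2_grading S (spart S)"
    and mult_degree: "\<lbrakk>s \<in> spart S p; t \<in> spart S q\<rbrakk> \<Longrightarrow> s \<otimes> t \<in> spart S (p + q)"
    and supercomm: "\<lbrakk>s \<in> spart S p; t \<in> spart S q\<rbrakk> \<Longrightarrow> s \<otimes> t = sgn_pow S (p * q) (t \<otimes> s)"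

text \<open>
  As for modules in the library, the \<open>mult\<close> and \<open>one\<close> fields inherited from the \<open>ring\<close> record are
  irrelevant.  The locale \<open>module\<close> is not used since it requires a commutative ring of scalars.
\<close>

record ('s, 'a) supermodule = "('s, 'a) module" +
  part :: "bit \<Rightarrow> 'a set"

locale supermodule = S?: comm_superring S + M?: abelian_group M
  for S :: "'s superring" (structure) and M :: "('s, 'a, 'm) supermodule_scheme" (structure) +
  assumes smult_closed:
      "\<lbrakk>s \<in> carrier S; x \<in> carrier M\<rbrakk> \<Longrightarrow> s \<odot>\<^bsub>M\<^esub> x \<in> carrier M"
    and smult_l_distr:
      "\<lbrakk>s \<in> carrier S; t \<in> carrier S; x \<in> carrier M\<rbrakk> \<Longrightarrow>
         (s \<oplus> t) \<odot>\<^bsub>M\<^esub> x = s \<odot>\<^bsub>M\<^esub> x \<oplus>\<^bsub>M\<^esub> t \<odot>\<^bsub>M\<^esub> x"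
    and smult_r_distr:
      "\<lbrakk>s \<in> carrier S; x \<in> carrier M; y \<in> carrier M\<rbrakk> \<Longrightarrow>
         s \<odot>\<^bsub>M\<^esub> (x \<oplus>\<^bsub>M\<^esub> y) = s \<odot>\<^bsub>M\<^esub> x \<oplus>\<^bsub>M\<^esub> s \<odot>\<^bsub>M\<^esub> y"
    and smult_assoc:
      "\<lbrakk>s \<in> carrier S; t \<in> carrier S; x \<in> carrier M\<rbrakk> \<Longrightarrow>
         (s \<otimes> t) \<odot>\<^bsub>M\<^esub> x = s \<odot>\<^bsub>M\<^esub> (t \<odot>\<^bsub>M\<^esub> x)"
    and smult_one: "x \<in> carrier M \<Longrightarrow> \<one> \<odot>\<^bsub>M\<^esub> x = x"
    and part_grading: "Z2_grading M (part M)"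
    and smult_degree: "\<lbrakk>s \<in> spart S p; x \<in> part M q\<rbrakk> \<Longrightarrow> s \<odot>\<^bsub>M\<^esub> x \<in> part M (p + q)"

definition smod_hom ::
  "'s superring \<Rightarrow> ('s, 'a, 'm) supermodule_scheme \<Rightarrow> ('s, 'b, 'n) supermodule_scheme \<Rightarrow> ('a \<Rightarrow> 'b) set"
where
  "smod_hom S M N = {h \<in> carrier M \<rightarrow> carrier N.
     (\<forall>x\<in>carrier M. \<forall>y\<in>carrier M. h (x \<oplus>\<^bsub>M\<^esub> y) = h x \<oplus>\<^bsub>N\<^esub> h y) \<and>
     (\<forall>s\<in>carrier S. \<forall>x\<in>carrier M. h (s \<odot>\<^bsub>M\<^esub> x) = s \<odot>\<^bsub>N\<^esub> h x) \<and>
     (\<forall>p. h ` part M p \<subseteq> part N p)}"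

definition smod_iso ::
  "'s superring \<Rightarrow> ('s, 'a, 'm) supermodule_scheme \<Rightarrow> ('s, 'b, 'n) supermodule_scheme \<Rightarrow> ('a \<Rightarrow> 'b) set"
where
  "smod_iso S M N = {h \<in> smod_hom S M N. bij_betw h (carrier M) (carrier N)}"

definition smod_span :: "'s superring \<Rightarrow> ('s, 'a, 'm) supermodule_scheme \<Rightarrow> 'a set \<Rightarrow> 'a set" where
  "smod_span S M A = \<Inter>{N. submodule N S M \<and> A \<subseteq> N}"

definition smod_restrict ::
  "('s, 'a, 'm) supermodule_scheme \<Rightarrow> 'a set \<Rightarrow> ('s, 'a, 'm) supermodule_scheme" where
  "smod_restrict M N = M\<lparr>carrier := N, part := (\<lambda>p. part M p \<inter> N)\<rparr>"

definition smod_quotient ::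
  "('s, 'a, 'm) supermodule_scheme \<Rightarrow> 'a set \<Rightarrow> ('s, 'a set) supermodule" where
  "smod_quotient M N =
    \<lparr>carrier = a_rcosets\<^bsub>M\<^esub> N, monoid.mult = undefined, one = undefined,
     ring.zero = N, ring.add = (\<lambda>A B. A <+>\<^bsub>M\<^esub> B),
     smult = (\<lambda>s A. \<Union>x\<in>A. N +>\<^bsub>M\<^esub> (s \<odot>\<^bsub>M\<^esub> x)),
     part = (\<lambda>p. (\<lambda>x. N +>\<^bsub>M\<^esub> x) ` part M p)\<rparr>"

text \<open>
  A left supermodule carries the right action \<open>x s = (-1)\<^bsup>pq\<^esup> s x\<close> for \<open>s\<close> of degree \<open>p\<close> and \<open>x\<close> of
  degree \<open>q\<close>.  Bilinearity over \<open>S\<close> means \<open>b (s x) y = s (b x y)\<close> and \<open>b (x s) y = b x (s y)\<close>.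
\<close>

definition smod_bilinear ::
  "'s superring \<Rightarrow> ('s, 'a, 'm) supermodule_scheme \<Rightarrow> ('s, 'b, 'n) supermodule_scheme \<Rightarrow>
   ('s, 'c, 'k) supermodule_scheme \<Rightarrow> ('a \<Rightarrow> 'b \<Rightarrow> 'c) \<Rightarrow> bool"
where
  "smod_bilinear S M N P b \<longleftrightarrow>
     (\<forall>x\<in>carrier M. \<forall>y\<in>carrier N. b x y \<in> carrier P) \<and>
     (\<forall>x\<in>carrier M. \<forall>x'\<in>carrier M. \<forall>y\<in>carrier N. b (x \<oplus>\<^bsub>M\<^esub> x') y = b x y \<oplus>\<^bsub>P\<^esub> b x' y) \<and>
     (\<forall>x\<in>carrier M. \<forall>y\<in>carrier N. \<forall>y'\<in>carrier N. b x (y \<oplus>\<^bsub>N\<^esub> y') = b x y \<oplus>\<^bsub>P\<^esub> b x y') \<and>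
     (\<forall>s\<in>carrier S. \<forall>x\<in>carrier M. \<forall>y\<in>carrier N. b (s \<odot>\<^bsub>M\<^esub> x) y = s \<odot>\<^bsub>P\<^esub> b x y) \<and>
     (\<forall>p q. \<forall>s\<in>spart S p. \<forall>x\<in>part M q. \<forall>y\<in>carrier N.
        b (sgn_pow M (p * q) (s \<odot>\<^bsub>M\<^esub> x)) y = b x (s \<odot>\<^bsub>N\<^esub> y))"


section \<open>Tensor products\<close>

text \<open>
  The tensor product over \<open>S\<close> is the free abelian group on pairs modulo biadditivity and the
  relations \<open>x s \<otimes> y = x \<otimes> s y\<close> (for homogeneous \<open>s\<close> and \<open>x\<close>, which by biadditivity gives the
  relation for all \<open>s\<close> and \<open>x\<close>).  Its elements are the cosets of \<open>tensor_rel\<close>; the scalars act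
  by \<open>s (x \<otimes> y) = s x \<otimes> y\<close>.
\<close>

definition tensor_rel ::
  "'s superring \<Rightarrow> ('s, 'a, 'm) supermodule_scheme \<Rightarrow> ('s, 'b, 'n) supermodule_scheme \<Rightarrow>
   ('a \<times> 'b \<Rightarrow>\<^sub>0 int) set"
where
  "tensor_rel S M N = generate (free_Abelian_group (carrier M \<times> carrier N))
    ({frag_of (x \<oplus>\<^bsub>M\<^esub> x', y) - frag_of (x, y) - frag_of (x', y) | x x' y.
        x \<in> carrier M \<and> x' \<in> carrier M \<and> y \<in> carrier N} \<union>
     {frag_of (x, y \<oplus>\<^bsub>N\<^esub> y') - frag_of (x, y) - frag_of (x, y') | x y y'.
        x \<in> carrier M \<and> y \<in> carrier N \<and> y' \<in> carrier N} \<union>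
     {frag_of (sgn_pow M (p * q) (s \<odot>\<^bsub>M\<^esub> x), y) - frag_of (x, s \<odot>\<^bsub>N\<^esub> y) | p q s x y.
        s \<in> spart S p \<and> x \<in> part M q \<and> y \<in> carrier N})"

definition tensor_group ::
  "'s superring \<Rightarrow> ('s, 'a, 'm) supermodule_scheme \<Rightarrow> ('s, 'b, 'n) supermodule_scheme \<Rightarrow>
   ('a \<times> 'b \<Rightarrow>\<^sub>0 int) set monoid"
where
  "tensor_group S M N = free_Abelian_group (carrier M \<times> carrier N) Mod tensor_rel S M N"

definition tensor_class ::
  "'s superring \<Rightarrow> ('s, 'a, 'm) supermodule_scheme \<Rightarrow> ('s, 'b, 'n) supermodule_scheme \<Rightarrow>
   ('a \<times> 'b \<Rightarrow>\<^sub>0 int) \<Rightarrow> ('a \<times> 'b \<Rightarrow>\<^sub>0 int) set"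
where
  "tensor_class S M N c = tensor_rel S M N #>\<^bsub>free_Abelian_group (carrier M \<times> carrier N)\<^esub> c"

definition tensor_elem ::
  "'s superring \<Rightarrow> ('s, 'a, 'm) supermodule_scheme \<Rightarrow> ('s, 'b, 'n) supermodule_scheme \<Rightarrow>
   'a \<Rightarrow> 'b \<Rightarrow> ('a \<times> 'b \<Rightarrow>\<^sub>0 int) set"
where
  "tensor_elem S M N x y = tensor_class S M N (frag_of (x, y))"

definition tensor ::
  "'s superring \<Rightarrow> ('s, 'a, 'm) supermodule_scheme \<Rightarrow> ('s, 'b, 'n) supermodule_scheme \<Rightarrow>
   ('s, ('a \<times> 'b \<Rightarrow>\<^sub>0 int) set) supermodule"
where
  "tensor S M N =
    \<lparr>carrier = carrier (tensor_group S M N), monoid.mult = undefined, one = undefined,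
     ring.zero = \<one>\<^bsub>tensor_group S M N\<^esub>, ring.add = (\<lambda>A B. A \<otimes>\<^bsub>tensor_group S M N\<^esub> B),
     smult = (\<lambda>s A. \<Union>c\<in>A. tensor_class S M N
                (frag_extend (\<lambda>(x, y). frag_of (s \<odot>\<^bsub>M\<^esub> x, y)) c)),
     part = (\<lambda>p. generate (tensor_group S M N)
                {tensor_elem S M N x y | x y q r. q + r = p \<and> x \<in> part M q \<and> y \<in> part N r})\<rparr>"


section \<open>Lie superalgebras\<close>

record ('s, 'a) lie_superalgebra = "('s, 'a) supermodule" +
  bracket :: "'a \<Rightarrow> 'a \<Rightarrow> 'a"

locale lie_superalgebra = supermodule S L
  for S :: "'s superring" (structure) and L :: "('s, 'a) lie_superalgebra" (structure) +
  assumes bracket_bilinear: "smod_bilinear S L L L (bracket L)"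
    and bracket_degree: "\<lbrakk>x \<in> part L p; y \<in> part L q\<rbrakk> \<Longrightarrow> bracket L x y \<in> part L (p + q)"
    and bracket_antisym: "\<lbrakk>x \<in> part L p; y \<in> part L q\<rbrakk> \<Longrightarrow>
      bracket L x y \<oplus>\<^bsub>L\<^esub> sgn_pow L (p * q) (bracket L y x) = \<zero>\<^bsub>L\<^esub>"
    and bracket_even_self: "x \<in> part L 0 \<Longrightarrow> bracket L x x = \<zero>\<^bsub>L\<^esub>"
    and bracket_jacobi: "\<lbrakk>x \<in> part L p; y \<in> part L q; z \<in> part L r\<rbrakk> \<Longrightarrow>
      sgn_pow L (p * r) (bracket L x (bracket L y z)) \<oplus>\<^bsub>L\<^esub>
      sgn_pow L (q * p) (bracket L y (bracket L z x)) \<oplus>\<^bsub>L\<^esub>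
      sgn_pow L (r * q) (bracket L z (bracket L x y)) = \<zero>\<^bsub>L\<^esub>"

definition lie_hom ::
  "'s superring \<Rightarrow> ('s, 'a) lie_superalgebra \<Rightarrow> ('s, 'b) lie_superalgebra \<Rightarrow> ('a \<Rightarrow> 'b) set" where
  "lie_hom S K L = {h \<in> smod_hom S K L.
     \<forall>x\<in>carrier K. \<forall>y\<in>carrier K. h (bracket K x y) = bracket L (h x) (h y)}"

definition lie_iso ::
  "'s superring \<Rightarrow> ('s, 'a) lie_superalgebra \<Rightarrow> ('s, 'b) lie_superalgebra \<Rightarrow> ('a \<Rightarrow> 'b) set" where
  "lie_iso S K L = {h \<in> lie_hom S K L. bij_betw h (carrier K) (carrier L)}"

definition perfect :: "'s superring \<Rightarrow> ('s, 'a) lie_superalgebra \<Rightarrow> bool" where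
  "perfect S L \<longleftrightarrow>
     carrier L = smod_span S L {bracket L x y | x y. x \<in> carrier L \<and> y \<in> carrier L}"

definition lie_centre :: "('s, 'a) lie_superalgebra \<Rightarrow> 'a set" where
  "lie_centre L = {x \<in> carrier L. \<forall>y\<in>carrier L. bracket L x y = \<zero>\<^bsub>L\<^esub>}"

definition central_extension ::
  "'s superring \<Rightarrow> ('s, 'a) lie_superalgebra \<Rightarrow> ('s, 'b) lie_superalgebra \<Rightarrow> ('a \<Rightarrow> 'b) \<Rightarrow> bool" where
  "central_extension S K L f \<longleftrightarrow>
     lie_superalgebra S K \<and> lie_superalgebra S L \<and> f \<in> lie_hom S K L \<and>
     f ` carrier K = carrier L \<and> a_kernel K L f \<subseteq> lie_centre K"

text \<open>
  HOL cannot quantify over types inside a formula, so the carrier type \<open>'k\<close> of the competing central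
  extensions is a parameter; a theorem about \<open>TYPE('k)\<close> with \<open>'k\<close> a type variable covers all of them.
  Uniqueness of maps is uniqueness on the carrier, hence the restriction to \<open>extensional\<close> maps.
\<close>

definition universal_central_extension ::
  "'k itself \<Rightarrow> 's superring \<Rightarrow> ('s, 'a) lie_superalgebra \<Rightarrow> ('s, 'b) lie_superalgebra \<Rightarrow>
   ('a \<Rightarrow> 'b) \<Rightarrow> bool"
where
  "universal_central_extension _ S K L f \<longleftrightarrow>
     central_extension S K L f \<and>
     (\<forall>(K' :: ('s, 'k) lie_superalgebra) f'. central_extension S K' L f' \<longrightarrow>
        (\<exists>!g. g \<in> lie_hom S K K' \<inter> extensional (carrier K) \<and>
              (\<forall>x\<in>carrier K. f x = f' (g x))))"


section \<open>The endofunctor \<open>uce\<close>\<close>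

type_synonym 'a uce = "('a \<times> 'a \<Rightarrow>\<^sub>0 int) set set"

definition uce_rel ::
  "'s superring \<Rightarrow> ('s, 'a) lie_superalgebra \<Rightarrow> ('a \<times> 'a \<Rightarrow>\<^sub>0 int) set set" where
  "uce_rel S L = (let T = tensor S L L; t = tensor_elem S L L in smod_span S T
    ({t x y \<oplus>\<^bsub>T\<^esub> sgn_pow T (p * q) (t y x) | x y p q. x \<in> part L p \<and> y \<in> part L q} \<union>
     {t x x | x. x \<in> part L 0} \<union>
     {sgn_pow T (p * r) (t x (bracket L y z)) \<oplus>\<^bsub>T\<^esub>
      sgn_pow T (q * p) (t y (bracket L z x)) \<oplus>\<^bsub>T\<^esub>
      sgn_pow T (r * q) (t z (bracket L x y)) | x y z p q r.
        x \<in> part L p \<and> y \<in> part L q \<and> z \<in> part L r}))"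

definition uce_module ::
  "'s superring \<Rightarrow> ('s, 'a) lie_superalgebra \<Rightarrow> ('s, 'a uce) supermodule" where
  "uce_module S L = smod_quotient (tensor S L L) (uce_rel S L)"

definition uce_elem ::
  "'s superring \<Rightarrow> ('s, 'a) lie_superalgebra \<Rightarrow> 'a \<Rightarrow> 'a \<Rightarrow> 'a uce" where
  "uce_elem S L x y = uce_rel S L +>\<^bsub>tensor S L L\<^esub> tensor_elem S L L x y"

text \<open>
  The product of \<open>uce L\<close>, the map to \<open>L\<close> and the functoriality are given by their values on the
  generators \<open>\<langle>x, y\<rangle>\<close>, which span \<open>uce L\<close>; so they are the unique (bi)linear maps with these values.
\<close>

definition uce_bracket ::
  "'s superring \<Rightarrow> ('s, 'a) lie_superalgebra \<Rightarrow> 'a uce \<Rightarrow> 'a uce \<Rightarrow> 'a uce" where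
  "uce_bracket S L =
    (THE b. b \<in> carrier (uce_module S L) \<rightarrow>\<^sub>E (carrier (uce_module S L) \<rightarrow>\<^sub>E carrier (uce_module S L)) \<and>
       smod_bilinear S (uce_module S L) (uce_module S L) (uce_module S L) b \<and>
       (\<forall>x\<in>carrier L. \<forall>y\<in>carrier L. \<forall>z\<in>carrier L. \<forall>w\<in>carrier L.
          b (uce_elem S L x y) (uce_elem S L z w) = uce_elem S L (bracket L x y) (bracket L z w)))"

definition uce ::
  "'s superring \<Rightarrow> ('s, 'a) lie_superalgebra \<Rightarrow> ('s, 'a uce) lie_superalgebra" where
  "uce S L = supermodule.extend (uce_module S L) (lie_superalgebra.fields (uce_bracket S L))"

definition uce_proj ::
  "'s superring \<Rightarrow> ('s, 'a) lie_superalgebra \<Rightarrow> 'a uce \<Rightarrow> 'a" where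
  "uce_proj S L =
    (THE u. u \<in> smod_hom S (uce S L) L \<inter> extensional (carrier (uce S L)) \<and>
       (\<forall>x\<in>carrier L. \<forall>y\<in>carrier L. u (uce_elem S L x y) = bracket L x y))"

definition uce_map ::
  "'s superring \<Rightarrow> ('s, 'a) lie_superalgebra \<Rightarrow> ('s, 'b) lie_superalgebra \<Rightarrow> ('a \<Rightarrow> 'b) \<Rightarrow>
   'a uce \<Rightarrow> 'b uce"
where
  "uce_map S L M f =
    (THE h. h \<in> smod_hom S (uce S L) (uce S M) \<inter> extensional (carrier (uce S L)) \<and>
       (\<forall>x\<in>carrier L. \<forall>y\<in>carrier L. h (uce_elem S L x y) = uce_elem S M (f x) (f y)))"

text \<open>A supermodule; the \<open>bracket\<close> field of the record is carried along but irrelevant.\<close>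

definition H2 ::
  "'s superring \<Rightarrow> ('s, 'a) lie_superalgebra \<Rightarrow> ('s, 'a uce) lie_superalgebra" where
  "H2 S L = smod_restrict (uce S L) (a_kernel (uce S L) L (uce_proj S L))"


section \<open>Directed systems and direct limits\<close>

definition directed_index :: "'i set \<Rightarrow> ('i \<Rightarrow> 'i \<Rightarrow> bool) \<Rightarrow> bool" where
  "directed_index I leq \<longleftrightarrow> I \<noteq> {} \<and> (\<forall>i\<in>I. leq i i) \<and>
     (\<forall>i\<in>I. \<forall>j\<in>I. \<forall>k\<in>I. leq i j \<longrightarrow> leq j k \<longrightarrow> leq i k) \<and>
     (\<forall>i\<in>I. \<forall>j\<in>I. \<exists>k\<in>I. leq i k \<and> leq j k)"

text \<open>\<open>f j i\<close> is the transition map from \<open>L i\<close> to \<open>L j\<close>.\<close>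

definition lie_directed_system ::
  "'s superring \<Rightarrow> 'i set \<Rightarrow> ('i \<Rightarrow> 'i \<Rightarrow> bool) \<Rightarrow> ('i \<Rightarrow> ('s, 'a) lie_superalgebra) \<Rightarrow>
   ('i \<Rightarrow> 'i \<Rightarrow> 'a \<Rightarrow> 'a) \<Rightarrow> bool"
where
  "lie_directed_system S I leq L f \<longleftrightarrow>
     (\<forall>i\<in>I. lie_superalgebra S (L i)) \<and>
     (\<forall>i\<in>I. \<forall>j\<in>I. leq i j \<longrightarrow> f j i \<in> lie_hom S (L i) (L j)) \<and>
     (\<forall>i\<in>I. \<forall>x\<in>carrier (L i). f i i x = x) \<and>
     (\<forall>i\<in>I. \<forall>j\<in>I. \<forall>k\<in>I. leq i j \<longrightarrow> leq j k \<longrightarrow>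
        (\<forall>x\<in>carrier (L i). f k i x = f k j (f j i x)))"

definition lie_cocone ::
  "'s superring \<Rightarrow> 'i set \<Rightarrow> ('i \<Rightarrow> 'i \<Rightarrow> bool) \<Rightarrow> ('i \<Rightarrow> ('s, 'a) lie_superalgebra) \<Rightarrow>
   ('i \<Rightarrow> 'i \<Rightarrow> 'a \<Rightarrow> 'a) \<Rightarrow> ('s, 'b) lie_superalgebra \<Rightarrow> ('i \<Rightarrow> 'a \<Rightarrow> 'b) \<Rightarrow> bool"
where
  "lie_cocone S I leq L f N g \<longleftrightarrow>
     lie_superalgebra S N \<and> (\<forall>i\<in>I. g i \<in> lie_hom S (L i) N) \<and>
     (\<forall>i\<in>I. \<forall>j\<in>I. leq i j \<longrightarrow> (\<forall>x\<in>carrier (L i). g j (f j i x) = g i x))"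

definition lie_induced ::
  "'s superring \<Rightarrow> 'i set \<Rightarrow> ('i \<Rightarrow> ('s, 'a) lie_superalgebra) \<Rightarrow>
   ('s, 'b) lie_superalgebra \<Rightarrow> ('i \<Rightarrow> 'a \<Rightarrow> 'b) \<Rightarrow>
   ('s, 'c) lie_superalgebra \<Rightarrow> ('i \<Rightarrow> 'a \<Rightarrow> 'c) \<Rightarrow> ('b \<Rightarrow> 'c) \<Rightarrow> bool"
where
  "lie_induced S I L M \<phi> N g h \<longleftrightarrow>
     h \<in> lie_hom S M N \<inter> extensional (carrier M) \<and>
     (\<forall>i\<in>I. \<forall>x\<in>carrier (L i). h (\<phi> i x) = g i x)"

definition lie_universal_cocone ::
  "'t itself \<Rightarrow> 's superring \<Rightarrow> 'i set \<Rightarrow> ('i \<Rightarrow> 'i \<Rightarrow> bool) \<Rightarrow> ('i \<Rightarrow> ('s, 'a) lie_superalgebra) \<Rightarrow>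
   ('i \<Rightarrow> 'i \<Rightarrow> 'a \<Rightarrow> 'a) \<Rightarrow> ('s, 'b) lie_superalgebra \<Rightarrow> ('i \<Rightarrow> 'a \<Rightarrow> 'b) \<Rightarrow> bool"
where
  "lie_universal_cocone _ S I leq L f M \<phi> \<longleftrightarrow>
     lie_cocone S I leq L f M \<phi> \<and>
     (\<forall>(N :: ('s, 't) lie_superalgebra) g. lie_cocone S I leq L f N g \<longrightarrow>
        (\<exists>!h. lie_induced S I L M \<phi> N g h))"

text \<open>
  The universal property cannot quantify over the carrier types of all cocones.  It suffices to
  require it for two types: the one where the standard construction, a quotient of the disjoint union
  of the \<open>L i\<close>, lives, and the carrier type \<open>'b\<close> of \<open>M\<close> itself.  The former yields a map from \<open>M\<close> to the
  standard construction, and the latter that this map is an isomorphism; hence \<open>M\<close> has the universal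
  property for cocones of any type.
\<close>

definition lie_direct_limit ::
  "'s superring \<Rightarrow> 'i set \<Rightarrow> ('i \<Rightarrow> 'i \<Rightarrow> bool) \<Rightarrow> ('i \<Rightarrow> ('s, 'a) lie_superalgebra) \<Rightarrow>
   ('i \<Rightarrow> 'i \<Rightarrow> 'a \<Rightarrow> 'a) \<Rightarrow> ('s, 'b) lie_superalgebra \<Rightarrow> ('i \<Rightarrow> 'a \<Rightarrow> 'b) \<Rightarrow> bool"
where
  "lie_direct_limit S I leq L f (M :: ('s, 'b) lie_superalgebra) (\<phi> :: 'i \<Rightarrow> 'a \<Rightarrow> 'b) \<longleftrightarrow>
     lie_universal_cocone TYPE(('i \<times> 'a) set) S I leq L f M \<phi> \<and>
     lie_universal_cocone TYPE('b) S I leq L f M \<phi>"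

text \<open>The same notions for supermodules.\<close>

definition smod_cocone ::
  "'s superring \<Rightarrow> 'i set \<Rightarrow> ('i \<Rightarrow> 'i \<Rightarrow> bool) \<Rightarrow> ('i \<Rightarrow> ('s, 'a, 'm) supermodule_scheme) \<Rightarrow>
   ('i \<Rightarrow> 'i \<Rightarrow> 'a \<Rightarrow> 'a) \<Rightarrow> ('s, 'b, 'n) supermodule_scheme \<Rightarrow> ('i \<Rightarrow> 'a \<Rightarrow> 'b) \<Rightarrow> bool"
where
  "smod_cocone S I leq L f N g \<longleftrightarrow>
     supermodule S N \<and> (\<forall>i\<in>I. g i \<in> smod_hom S (L i) N) \<and>
     (\<forall>i\<in>I. \<forall>j\<in>I. leq i j \<longrightarrow> (\<forall>x\<in>carrier (L i). g j (f j i x) = g i x))"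

definition smod_induced ::
  "'s superring \<Rightarrow> 'i set \<Rightarrow> ('i \<Rightarrow> ('s, 'a, 'm) supermodule_scheme) \<Rightarrow>
   ('s, 'b, 'n) supermodule_scheme \<Rightarrow> ('i \<Rightarrow> 'a \<Rightarrow> 'b) \<Rightarrow>
   ('s, 'c, 'k) supermodule_scheme \<Rightarrow> ('i \<Rightarrow> 'a \<Rightarrow> 'c) \<Rightarrow> ('b \<Rightarrow> 'c) \<Rightarrow> bool"
where
  "smod_induced S I L M \<phi> N g h \<longleftrightarrow>
     h \<in> smod_hom S M N \<inter> extensional (carrier M) \<and>
     (\<forall>i\<in>I. \<forall>x\<in>carrier (L i). h (\<phi> i x) = g i x)"

definition smod_universal_cocone ::
  "'t itself \<Rightarrow> 's superring \<Rightarrow> 'i set \<Rightarrow> ('i \<Rightarrow> 'i \<Rightarrow> bool) \<Rightarrow>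
   ('i \<Rightarrow> ('s, 'a, 'm) supermodule_scheme) \<Rightarrow>
   ('i \<Rightarrow> 'i \<Rightarrow> 'a \<Rightarrow> 'a) \<Rightarrow> ('s, 'b, 'n) supermodule_scheme \<Rightarrow> ('i \<Rightarrow> 'a \<Rightarrow> 'b) \<Rightarrow> bool"
where
  "smod_universal_cocone _ S I leq L f M \<phi> \<longleftrightarrow>
     smod_cocone S I leq L f M \<phi> \<and>
     (\<forall>(N :: ('s, 't) supermodule) g. smod_cocone S I leq L f N g \<longrightarrow>
        (\<exists>!h. smod_induced S I L M \<phi> N g h))"

definition smod_direct_limit ::
  "'s superring \<Rightarrow> 'i set \<Rightarrow> ('i \<Rightarrow> 'i \<Rightarrow> bool) \<Rightarrow> ('i \<Rightarrow> ('s, 'a, 'm) supermodule_scheme) \<Rightarrow>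
   ('i \<Rightarrow> 'i \<Rightarrow> 'a \<Rightarrow> 'a) \<Rightarrow> ('s, 'b, 'n) supermodule_scheme \<Rightarrow> ('i \<Rightarrow> 'a \<Rightarrow> 'b) \<Rightarrow> bool"
where
  "smod_direct_limit S I leq L f (M :: ('s, 'b, 'n) supermodule_scheme) (\<phi> :: 'i \<Rightarrow> 'a \<Rightarrow> 'b) \<longleftrightarrow>
     smod_universal_cocone TYPE(('i \<times> 'a) set) S I leq L f M \<phi> \<and>
     smod_universal_cocone TYPE('b) S I leq L f M \<phi>"

end

theory Submission
  imports Defs
begin

text \<open>
  Call a bilinear map of degree \<open>0\<close> on \<open>L \<times> L\<close> a pairing if it satisfies the three families of
  relations that define \<open>uce L\<close>.  Then \<open>uce L\<close> is the target of the universal pairing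
  \<open>(x, y) \<mapsto> \<langle>x, y\<rangle>\<close> (\<open>uce_module_lift\<close>), and this property carries the whole proof.

  The inverse of \<open>\<phi>: lim uce (L i) \<rightarrow> uce (lim L i)\<close> is written down directly.  On the limit of
  the \<open>L i\<close> put \<open>b (\<phi>L x) (\<phi>L y) = \<phi>U \<langle>x, y\<rangle>\<close>.  This is well defined because elements of \<open>L i\<close> with the
  same image in the limit already agree at a later index, and it is a pairing because each relation
  involves at most three elements, which all come from one \<open>L i\<close> (\<open>limit_pairing\<close>,
  \<open>lie_pairing_cover\<close>).  The induced map \<open>uce (lim L i) \<rightarrow> lim uce (L i)\<close> is inverse to \<open>\<phi>\<close>, as one
  sees on generators \<open>\<langle>x, y\<rangle>\<close> (\<open>uce_limit_iso\<close>).

  On the limit \<open>u = \<pi> \<circ> \<phi>\<close> (\<open>induced_proj_eq\<close>), where \<open>\<pi>: uce (lim L i) \<rightarrow> lim L i\<close>.  The limit is perfect, and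
  for perfect \<open>L\<close> the map \<open>\<pi>: uce L \<rightarrow> L\<close> is a universal central extension: given a central extension
  \<open>f: K \<rightarrow> L\<close>, the bracket of \<open>K\<close> only depends on images in \<open>L\<close>, hence is a pairing on \<open>L\<close>, and it induces
  the map \<open>uce L \<rightarrow> K\<close> (\<open>uce_universal_central_extension\<close>).  So \<open>u\<close> is one as well.  The statement about
  \<open>H2\<close> says that taking kernels commutes with direct limits (\<open>H2_limit_iso\<close>), combined with the fact
  that \<open>\<phi>\<close> maps the kernel of \<open>u\<close> onto that of \<open>\<pi>\<close>.

  Direct limits are given by a universal property, but the arguments above use two elementary
  facts: the limit is the union of the images of the \<open>L i\<close>, and what vanishes in the limit vanishes
  at a later index.  Both are evident for the quotient of the disjoint union of the \<open>L i\<close>, and a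
  comparison transfers them to any direct limit (\<open>smod_limitI\<close>).  Conversely, these facts give the
  universal property for targets of all types.

  The foundations are the graded structures on \<open>L \<otimes> L\<close> and \<open>uce L\<close>.  What has to be shown is that the
  sum of the even and the odd part is direct: on the tensor product there are projections
  to the two parts (\<open>T_projection\<close>), and the relations of \<open>uce L\<close> are homogeneous.
\<close>

section \<open>Graded groups and supermodules\<close>

text \<open>Degrees are to stay symbolic: without these rules a sum \<open>p + 1\<close> is not turned into a case
  distinction.\<close>

declare add_bit_eq_xor [simp del] mult_bit_eq_and [simp del]

lemma bit_cases: "(p::bit) = 0 \<or> p = 1"
  by (cases p) auto

lemma bit_add_self [simp]: "(p::bit) + p = 0" "p + q + q = (p::bit)" "q + (q + p) = (p::bit)"
  using bit_cases[of p] bit_cases[of q] by auto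

lemma sgn_pow_0 [simp]: "sgn_pow G 0 x = x"
  and sgn_pow_1 [simp]: "sgn_pow G 1 x = \<ominus>\<^bsub>G\<^esub> x"
  by (simp_all add: sgn_pow_def)

locale graded_group = abelian_group G for G (structure) +
  fixes D :: "bit \<Rightarrow> 'a set"
  assumes graded: "Z2_grading G D"
begin

lemma deg_subgroup: "additive_subgroup (D p) G"
  using graded by (simp add: Z2_grading_def)

lemma deg_carrier: "x \<in> D p \<Longrightarrow> x \<in> carrier G"
  using additive_subgroup.a_subset[OF deg_subgroup] by blast

lemma deg_zero: "\<zero> \<in> D p"
  using additive_subgroup.zero_closed[OF deg_subgroup] .

lemma deg_add: "x \<in> D p \<Longrightarrow> y \<in> D p \<Longrightarrow> x \<oplus> y \<in> D p"
  using additive_subgroup.a_closed[OF deg_subgroup] .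

lemma deg_neg: "x \<in> D p \<Longrightarrow> \<ominus> x \<in> D p"
  using additive_subgroup.a_subgroup[OF deg_subgroup, of p] subgroup.m_inv_closed[of "D p" "add_monoid G" x]
  by (simp add: a_inv_def)

lemma deg_sgn: "x \<in> D p \<Longrightarrow> sgn_pow G k x \<in> D p"
  by (simp add: sgn_pow_def deg_neg)

lemma sgn_closed: "x \<in> carrier G \<Longrightarrow> sgn_pow G k x \<in> carrier G"
  by (simp add: sgn_pow_def)

lemma deg_disjoint: "x \<in> D p \<Longrightarrow> x \<in> D (p + 1) \<Longrightarrow> x = \<zero>"
  using graded bit_cases[of p] by (auto simp: Z2_grading_def)

lemma decompose:
  assumes "x \<in> carrier G"
  shows "\<exists>a\<in>D p. \<exists>b\<in>D (p + 1). x = a \<oplus> b"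
proof -
  have "x \<in> D 0 <+> D 1"
    using assms graded by (simp add: Z2_grading_def)
  then obtain a b where ab: "a \<in> D 0" "b \<in> D 1" "x = a \<oplus> b"
    by (auto simp: set_add_def')
  then have "x = b \<oplus> a"
    by (simp add: a_comm deg_carrier)
  show ?thesis
    using bit_cases[of p]
  proof
    assume "p = 0"
    with ab show ?thesis by auto
  next
    assume "p = 1"
    then show ?thesis
      using ab(1,2) \<open>x = b \<oplus> a\<close> by (intro bexI[of _ b] bexI[of _ a]) auto
  qed
qed

lemma decompose_unique:
  assumes a: "a \<in> D p" "a' \<in> D p" and b: "b \<in> D (p + 1)" "b' \<in> D (p + 1)"
    and eq: "a \<oplus> b = a' \<oplus> b'"
  shows "a = a'"
proof -
  have c: "a \<in> carrier G" "a' \<in> carrier G" "b \<in> carrier G" "b' \<in> carrier G"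
    using a b deg_carrier by auto
  have "a \<oplus> (\<ominus> a') = b' \<oplus> (\<ominus> b)"
  proof -
    have "a \<oplus> (\<ominus> a') = (a \<oplus> b) \<oplus> (\<ominus> b) \<oplus> (\<ominus> a')"
      using c by (simp add: a_assoc r_neg)
    also have "\<dots> = b' \<oplus> (\<ominus> b)"
      unfolding eq using c by (metis (no_types, lifting) a_assoc a_comm a_inv_closed add.m_closed r_neg1)
    finally show ?thesis .
  qed
  moreover have "a \<oplus> (\<ominus> a') \<in> D p"
    by (intro deg_add deg_neg a)
  moreover have "b' \<oplus> (\<ominus> b) \<in> D (p + 1)"
    by (intro deg_add deg_neg b)
  ultimately have "a \<oplus> (\<ominus> a') = \<zero>"
    using deg_disjoint by simp
  then show ?thesis
    using c by (metis a_inv_closed minus_equality minus_minus)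
qed

definition comp :: "bit \<Rightarrow> 'a \<Rightarrow> 'a" where
  "comp p x = (THE a. a \<in> D p \<and> (\<exists>b\<in>D (p + 1). x = a \<oplus> b))"

lemma comp_eq: "a \<in> D p \<Longrightarrow> b \<in> D (p + 1) \<Longrightarrow> comp p (a \<oplus> b) = a"
  unfolding comp_def by (rule the_equality) (auto intro: decompose_unique[symmetric])

lemma comp_deg: "x \<in> carrier G \<Longrightarrow> comp p x \<in> D p"
  using decompose[of x p] comp_eq by auto

lemma comp_closed: "x \<in> carrier G \<Longrightarrow> comp p x \<in> carrier G"
  using comp_deg deg_carrier by blast

lemma comp_same: "a \<in> D p \<Longrightarrow> comp p a = a"
  using comp_eq[of a p \<zero>] by (simp add: deg_zero deg_carrier)

lemma comp_other: "a \<in> D p \<Longrightarrow> comp (p + 1) a = \<zero>"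
  using comp_eq[of \<zero> "p + 1" a] by (simp add: deg_zero deg_carrier add.assoc)

lemma comp_sum: assumes "x \<in> carrier G" shows "comp p x \<oplus> comp (p + 1) x = x"
proof -
  obtain a b where ab: "a \<in> D p" "b \<in> D (p + 1)" "x = a \<oplus> b"
    using decompose[OF assms] by blast
  have "comp (p + 1) (b \<oplus> a) = b"
    using ab by (intro comp_eq) (auto simp: add.assoc)
  with ab show ?thesis
    by (simp add: comp_eq a_comm deg_carrier)
qed

lemma comp_add:
  assumes "x \<in> carrier G" "y \<in> carrier G"
  shows "comp p (x \<oplus> y) = comp p x \<oplus> comp p y"
proof -
  have c: "comp p x \<in> carrier G" "comp p y \<in> carrier G" "comp (p+1) x \<in> carrier G" "comp (p+1) y \<in> carrier G"
    using assms comp_closed by auto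
  have "x \<oplus> y = (comp p x \<oplus> comp (p+1) x) \<oplus> (comp p y \<oplus> comp (p+1) y)"
    by (simp add: assms comp_sum)
  also have "\<dots> = (comp p x \<oplus> comp p y) \<oplus> (comp (p+1) x \<oplus> comp (p+1) y)"
    using c by (simp add: a_ac)
  finally show ?thesis
    by (simp add: comp_eq deg_add comp_deg assms)
qed

lemma homogeneous_induct:
  assumes "x \<in> carrier G"
    and "\<And>p a. a \<in> D p \<Longrightarrow> P a"
    and "\<And>a b. a \<in> carrier G \<Longrightarrow> b \<in> carrier G \<Longrightarrow> P a \<Longrightarrow> P b \<Longrightarrow> P (a \<oplus> b)"
  shows "P x"
  using decompose[OF assms(1), of 0] assms(2,3) deg_carrier by metis

end

lemma Z2_gradingI:
  assumes "abelian_group G"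
    and "\<And>p. additive_subgroup (D p) G"
    and "\<And>x. x \<in> D 0 \<Longrightarrow> x \<in> D 1 \<Longrightarrow> x = \<zero>\<^bsub>G\<^esub>"
    and "\<And>x. x \<in> carrier G \<Longrightarrow> \<exists>a\<in>D 0. \<exists>b\<in>D 1. x = a \<oplus>\<^bsub>G\<^esub> b"
  shows "Z2_grading G D"
proof -
  interpret abelian_group G by fact
  have "D 0 \<subseteq> carrier G" "D 1 \<subseteq> carrier G"
    using additive_subgroup.a_subset[OF assms(2)] by auto
  moreover have "\<zero>\<^bsub>G\<^esub> \<in> D p" for p
    using additive_subgroup.zero_closed[OF assms(2)] .
  ultimately have "D 0 \<inter> D 1 = {\<zero>\<^bsub>G\<^esub>}" "carrier G = D 0 <+>\<^bsub>G\<^esub> D 1"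
    using assms(3,4) by (auto simp: set_add_def')
  then show ?thesis
    unfolding Z2_grading_def using assms(2) by blast
qed

sublocale comm_superring \<subseteq> Sg: graded_group S "spart S"
  by unfold_locales (rule grading)

sublocale supermodule \<subseteq> Mg: graded_group M "part M"
  by unfold_locales (rule part_grading)

context supermodule
begin

lemma superring: "comm_superring S" ..

lemma supermodule: "supermodule S M" ..

lemma smult_zero_left: assumes "x \<in> carrier M" shows "\<zero> \<odot>\<^bsub>M\<^esub> x = \<zero>\<^bsub>M\<^esub>"
proof -
  have "\<zero> \<odot>\<^bsub>M\<^esub> x \<oplus>\<^bsub>M\<^esub> \<zero> \<odot>\<^bsub>M\<^esub> x = \<zero> \<odot>\<^bsub>M\<^esub> x"
    using smult_l_distr[of \<zero> \<zero> x] assms by simp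
  then show ?thesis
    using assms smult_closed[of \<zero> x] by (metis M.add.r_cancel_one' S.zero_closed)
qed

lemma smult_zero_right: assumes "s \<in> carrier S" shows "s \<odot>\<^bsub>M\<^esub> \<zero>\<^bsub>M\<^esub> = \<zero>\<^bsub>M\<^esub>"
proof -
  have "s \<odot>\<^bsub>M\<^esub> \<zero>\<^bsub>M\<^esub> \<oplus>\<^bsub>M\<^esub> s \<odot>\<^bsub>M\<^esub> \<zero>\<^bsub>M\<^esub> = s \<odot>\<^bsub>M\<^esub> \<zero>\<^bsub>M\<^esub>"
    using smult_r_distr[of s "\<zero>\<^bsub>M\<^esub>" "\<zero>\<^bsub>M\<^esub>"] assms by simp
  then show ?thesis
    using assms smult_closed[of s "\<zero>\<^bsub>M\<^esub>"] by (metis M.add.r_cancel_one' M.zero_closed)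
qed

lemma smult_minus:
  assumes "s \<in> carrier S" "x \<in> carrier M"
  shows "s \<odot>\<^bsub>M\<^esub> (\<ominus>\<^bsub>M\<^esub> x) = \<ominus>\<^bsub>M\<^esub> (s \<odot>\<^bsub>M\<^esub> x)"
proof -
  have "s \<odot>\<^bsub>M\<^esub> (\<ominus>\<^bsub>M\<^esub> x) \<oplus>\<^bsub>M\<^esub> s \<odot>\<^bsub>M\<^esub> x = \<zero>\<^bsub>M\<^esub>"
    using smult_r_distr[of s "\<ominus>\<^bsub>M\<^esub> x" x] assms by (simp add: M.l_neg smult_zero_right)
  then show ?thesis
    using assms smult_closed by (metis M.minus_equality M.a_inv_closed)
qed

lemma smult_sgn:
  "s \<in> carrier S \<Longrightarrow> x \<in> carrier M \<Longrightarrow> s \<odot>\<^bsub>M\<^esub> sgn_pow M k x = sgn_pow M k (s \<odot>\<^bsub>M\<^esub> x)"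
  by (simp add: sgn_pow_def smult_minus)

lemma minus_smult_one:
  assumes "x \<in> carrier M" shows "(\<ominus> \<one>) \<odot>\<^bsub>M\<^esub> x = \<ominus>\<^bsub>M\<^esub> x"
proof -
  have "(\<ominus> \<one>) \<odot>\<^bsub>M\<^esub> x \<oplus>\<^bsub>M\<^esub> x = \<zero>\<^bsub>M\<^esub>"
    using smult_l_distr[of "\<ominus> \<one>" \<one> x] assms by (simp add: S.l_neg smult_one smult_zero_left)
  then show ?thesis
    using assms smult_closed[of "\<ominus> \<one>" x] by (metis M.minus_equality S.a_inv_closed S.one_closed)
qed

lemma submoduleI:
  assumes "N \<subseteq> carrier M" "\<zero>\<^bsub>M\<^esub> \<in> N"
    and "\<And>a b. a \<in> N \<Longrightarrow> b \<in> N \<Longrightarrow> a \<oplus>\<^bsub>M\<^esub> b \<in> N"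
    and "\<And>s x. s \<in> carrier S \<Longrightarrow> x \<in> N \<Longrightarrow> s \<odot>\<^bsub>M\<^esub> x \<in> N"
  shows "submodule N S M"
proof -
  have "\<ominus>\<^bsub>M\<^esub> x \<in> N" if "x \<in> N" for x
    using minus_smult_one[of x] assms(1) assms(4)[of "\<ominus> \<one>" x] that by auto
  then have "subgroup N (add_monoid M)"
    using assms by (intro subgroup.intro) (auto simp: a_inv_def)
  then show ?thesis
    using assms(4) by (intro submodule.intro submodule_axioms.intro)
qed

lemma submoduleD:
  assumes "submodule N S M"
  shows "x \<in> N \<Longrightarrow> x \<in> carrier M" "\<zero>\<^bsub>M\<^esub> \<in> N" "x \<in> N \<Longrightarrow> y \<in> N \<Longrightarrow> x \<oplus>\<^bsub>M\<^esub> y \<in> N"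
    "s \<in> carrier S \<Longrightarrow> x \<in> N \<Longrightarrow> s \<odot>\<^bsub>M\<^esub> x \<in> N" "x \<in> N \<Longrightarrow> \<ominus>\<^bsub>M\<^esub> x \<in> N"
    "additive_subgroup N M"
proof -
  have sg: "subgroup N (add_monoid M)"
    using assms by (rule submodule.axioms)
  show "x \<in> N \<Longrightarrow> x \<in> carrier M" "\<zero>\<^bsub>M\<^esub> \<in> N" "x \<in> N \<Longrightarrow> y \<in> N \<Longrightarrow> x \<oplus>\<^bsub>M\<^esub> y \<in> N"
    "x \<in> N \<Longrightarrow> \<ominus>\<^bsub>M\<^esub> x \<in> N" "additive_subgroup N M"
    using subgroup.subset[OF sg] subgroup.one_closed[OF sg] subgroup.m_closed[OF sg]
      subgroup.m_inv_closed[OF sg, of x] sg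
    by (auto simp: a_inv_def additive_subgroup_def)
  show "s \<in> carrier S \<Longrightarrow> x \<in> N \<Longrightarrow> s \<odot>\<^bsub>M\<^esub> x \<in> N"
    using submodule.smult_closed[OF assms] .
qed

lemma smod_span_least: "submodule N S M \<Longrightarrow> A \<subseteq> N \<Longrightarrow> smod_span S M A \<subseteq> N"
  by (auto simp: smod_span_def)

lemma smod_span_incl: "A \<subseteq> smod_span S M A"
  by (auto simp: smod_span_def)

lemma submodule_carrier: "submodule (carrier M) S M"
  by (rule submoduleI) (auto simp: smult_closed)

lemma smod_span_submodule:
  assumes "A \<subseteq> carrier M" shows "submodule (smod_span S M A) S M"
proof (rule submoduleI)
  show "smod_span S M A \<subseteq> carrier M"
    using assms submodule_carrier by (rule smod_span_least[rotated])
qed (auto simp: smod_span_def intro: submoduleD)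

lemma comp_smult:
  assumes s: "s \<in> spart S q" and x: "x \<in> carrier M"
  shows "Mg.comp (q + p) (s \<odot>\<^bsub>M\<^esub> x) = s \<odot>\<^bsub>M\<^esub> Mg.comp p x"
proof -
  have sS: "s \<in> carrier S"
    using s by (rule Sg.deg_carrier)
  have "s \<odot>\<^bsub>M\<^esub> x = s \<odot>\<^bsub>M\<^esub> Mg.comp p x \<oplus>\<^bsub>M\<^esub> s \<odot>\<^bsub>M\<^esub> Mg.comp (p + 1) x"
    using Mg.comp_sum[OF x, of p] smult_r_distr[OF sS Mg.comp_closed[OF x] Mg.comp_closed[OF x]]
    by metis
  then show ?thesis
    by (simp add: Mg.comp_eq smult_degree s Mg.comp_deg x add.assoc)
qed

end

subsection \<open>Homomorphisms\<close>

lemma smod_homD: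
  assumes "h \<in> smod_hom S M N"
  shows "x \<in> carrier M \<Longrightarrow> h x \<in> carrier N"
    "x \<in> carrier M \<Longrightarrow> y \<in> carrier M \<Longrightarrow> h (x \<oplus>\<^bsub>M\<^esub> y) = h x \<oplus>\<^bsub>N\<^esub> h y"
    "s \<in> carrier S \<Longrightarrow> x \<in> carrier M \<Longrightarrow> h (s \<odot>\<^bsub>M\<^esub> x) = s \<odot>\<^bsub>N\<^esub> h x"
    "x \<in> part M p \<Longrightarrow> h x \<in> part N p"
  using assms by (auto simp: smod_hom_def image_subset_iff)

lemma smod_homI:
  assumes "\<And>x. x \<in> carrier M \<Longrightarrow> h x \<in> carrier N"
    "\<And>x y. x \<in> carrier M \<Longrightarrow> y \<in> carrier M \<Longrightarrow> h (x \<oplus>\<^bsub>M\<^esub> y) = h x \<oplus>\<^bsub>N\<^esub> h y"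
    "\<And>s x. s \<in> carrier S \<Longrightarrow> x \<in> carrier M \<Longrightarrow> h (s \<odot>\<^bsub>M\<^esub> x) = s \<odot>\<^bsub>N\<^esub> h x"
    "\<And>x p. x \<in> part M p \<Longrightarrow> h x \<in> part N p"
  shows "h \<in> smod_hom S M N"
  using assms by (auto simp: smod_hom_def)

lemma smod_hom_comp:
  "h \<in> smod_hom S M N \<Longrightarrow> g \<in> smod_hom S N P \<Longrightarrow> (\<lambda>x. g (h x)) \<in> smod_hom S M P"
  by (rule smod_homI) (simp_all add: smod_homD)

lemma smod_hom_cong:
  assumes "h \<in> smod_hom S M N" "supermodule S M" "\<And>x. x \<in> carrier M \<Longrightarrow> g x = h x"
  shows "g \<in> smod_hom S M N"
proof -
  interpret supermodule S M by fact
  show ?thesis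
    by (rule smod_homI) (simp_all add: assms(3) smod_homD[OF assms(1)] smult_closed Mg.deg_carrier)
qed

lemma smod_hom_restrict:
  "h \<in> smod_hom S M N \<Longrightarrow> supermodule S M \<Longrightarrow> restrict h (carrier M) \<in> smod_hom S M N"
  by (erule smod_hom_cong) auto

locale smod_morphism = M: supermodule S M + N: supermodule S N
  for S :: "'s superring" and M :: "('s, 'a, 'm) supermodule_scheme"
    and N :: "('s, 'b, 'n) supermodule_scheme" +
  fixes h assumes hom: "h \<in> smod_hom S M N"
begin

lemmas hom_closed = smod_homD(1)[OF hom]
lemmas hom_add = smod_homD(2)[OF hom]
lemmas hom_smult = smod_homD(3)[OF hom]
lemmas hom_part = smod_homD(4)[OF hom]

lemma hom_zero: "h \<zero>\<^bsub>M\<^esub> = \<zero>\<^bsub>N\<^esub>"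
  using hom_smult[of "\<zero>\<^bsub>S\<^esub>" "\<zero>\<^bsub>M\<^esub>"] by (simp add: M.smult_zero_left N.smult_zero_left hom_closed)

lemma hom_neg: "x \<in> carrier M \<Longrightarrow> h (\<ominus>\<^bsub>M\<^esub> x) = \<ominus>\<^bsub>N\<^esub> h x"
  using hom_smult[of "\<ominus>\<^bsub>S\<^esub> \<one>\<^bsub>S\<^esub>" x] by (simp add: M.minus_smult_one N.minus_smult_one hom_closed)

lemma hom_sgn: "x \<in> carrier M \<Longrightarrow> h (sgn_pow M k x) = sgn_pow N k (h x)"
  by (simp add: sgn_pow_def hom_neg)

lemma hom_comp: "x \<in> carrier M \<Longrightarrow> h (M.Mg.comp p x) = N.Mg.comp p (h x)"
  using N.Mg.comp_eq[of "h (M.Mg.comp p x)" p "h (M.Mg.comp (p + 1) x)"]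
    hom_add[of "M.Mg.comp p x" "M.Mg.comp (p + 1) x"]
  by (simp add: M.Mg.comp_sum M.Mg.comp_closed hom_part M.Mg.comp_deg)

lemma kernel_eq: "a_kernel M N h = {x \<in> carrier M. h x = \<zero>\<^bsub>N\<^esub>}"
  by (simp add: a_kernel_def kernel_def)

lemma kernel_submodule: "submodule (a_kernel M N h) S M"
  unfolding kernel_eq
  by (rule M.submoduleI) (auto simp: hom_zero hom_add hom_smult M.smult_closed N.smult_zero_right)

lemma kernel_comp: "x \<in> a_kernel M N h \<Longrightarrow> M.Mg.comp p x \<in> a_kernel M N h"
  using N.Mg.comp_same[OF N.Mg.deg_zero] by (simp add: kernel_eq M.Mg.comp_closed hom_comp)

lemma injI:
  assumes "\<And>x. x \<in> carrier M \<Longrightarrow> h x = \<zero>\<^bsub>N\<^esub> \<Longrightarrow> x = \<zero>\<^bsub>M\<^esub>"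
  shows "inj_on h (carrier M)"
proof (rule inj_onI)
  fix x y assume xy: "x \<in> carrier M" "y \<in> carrier M" "h x = h y"
  then have "h (x \<oplus>\<^bsub>M\<^esub> \<ominus>\<^bsub>M\<^esub> y) = \<zero>\<^bsub>N\<^esub>"
    by (simp add: hom_add hom_neg hom_closed N.M.r_neg)
  then have "x \<oplus>\<^bsub>M\<^esub> \<ominus>\<^bsub>M\<^esub> y = \<zero>\<^bsub>M\<^esub>"
    using assms xy by simp
  then show "x = y"
    using xy by (metis M.M.a_inv_closed M.M.minus_equality M.M.minus_minus)
qed

end

text \<open>Maps compatible with all operations, whose images cover \<open>Q\<close> in a directed way, carry the
  module axioms along; only the directness of the grading needs something more, namely that an
  even and an odd element get the same image only if it is zero.\<close>

lemma supermodule_cover: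
  fixes I :: "'i set" and q :: "'i \<Rightarrow> 'a \<Rightarrow> 'b"
  assumes S: "comm_superring S" and I: "I \<noteq> {}"
    and M: "\<And>i. i \<in> I \<Longrightarrow> supermodule S (M i)"
    and carr: "carrier Q = (\<Union>i\<in>I. q i ` carrier (M i))"
    and part: "\<And>p. part Q p = (\<Union>i\<in>I. q i ` part (M i) p)"
    and dir: "\<And>i j. i \<in> I \<Longrightarrow> j \<in> I \<Longrightarrow> \<exists>k\<in>I. \<forall>l\<in>{i, j}. q l ` carrier (M l) \<subseteq> q k ` carrier (M k) \<and>
      (\<forall>p. q l ` part (M l) p \<subseteq> q k ` part (M k) p)"
    and zero: "\<And>i. i \<in> I \<Longrightarrow> \<zero>\<^bsub>Q\<^esub> = q i \<zero>\<^bsub>M i\<^esub>"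
    and add: "\<And>i x y. i \<in> I \<Longrightarrow> x \<in> carrier (M i) \<Longrightarrow> y \<in> carrier (M i) \<Longrightarrow>
      q i x \<oplus>\<^bsub>Q\<^esub> q i y = q i (x \<oplus>\<^bsub>M i\<^esub> y)"
    and smult: "\<And>i s x. i \<in> I \<Longrightarrow> s \<in> carrier S \<Longrightarrow> x \<in> carrier (M i) \<Longrightarrow>
      s \<odot>\<^bsub>Q\<^esub> q i x = q i (s \<odot>\<^bsub>M i\<^esub> x)"
    and ker: "\<And>i x y. i \<in> I \<Longrightarrow> x \<in> part (M i) 0 \<Longrightarrow> y \<in> part (M i) 1 \<Longrightarrow> q i x = q i y \<Longrightarrow> q i x = \<zero>\<^bsub>Q\<^esub>"
  shows "supermodule S Q"
proof -
  interpret S: comm_superring S by fact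
  have lift: "\<exists>i\<in>I. \<exists>a\<in>carrier (M i). x = q i a" if "x \<in> carrier Q" for x
    using that by (auto simp: carr)
  have plift: "\<exists>i\<in>I. \<exists>a\<in>part (M i) p. x = q i a" if "x \<in> part Q p" for x p
    using that by (auto simp: part)
  have lift3: "\<exists>i\<in>I. \<exists>a\<in>carrier (M i). \<exists>b\<in>carrier (M i). \<exists>c\<in>carrier (M i). x = q i a \<and> y = q i b \<and> z = q i c"
    if "x \<in> carrier Q" "y \<in> carrier Q" "z \<in> carrier Q" for x y z
  proof -
    obtain i j k where ijk: "i \<in> I" "j \<in> I" "k \<in> I" "x \<in> q i ` carrier (M i)" "y \<in> q j ` carrier (M j)"
      "z \<in> q k ` carrier (M k)"
      using \<open>x \<in> _\<close> \<open>y \<in> _\<close> \<open>z \<in> _\<close> by (auto simp: carr)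
    obtain l where l: "l \<in> I" "q i ` carrier (M i) \<subseteq> q l ` carrier (M l)" "q j ` carrier (M j) \<subseteq> q l ` carrier (M l)"
      using dir[OF ijk(1,2)] by auto
    obtain m where m: "m \<in> I" "q l ` carrier (M l) \<subseteq> q m ` carrier (M m)" "q k ` carrier (M k) \<subseteq> q m ` carrier (M m)"
      using dir[OF l(1) ijk(3)] by auto
    have "x \<in> q m ` carrier (M m)" "y \<in> q m ` carrier (M m)" "z \<in> q m ` carrier (M m)"
      using ijk(4-6) m(3) subset_trans[OF l(2) m(2)] subset_trans[OF l(3) m(2)] by (meson subsetD)+
    then show ?thesis
      using m(1) by blast
  qed
  have plift2: "\<exists>i\<in>I. \<exists>a\<in>part (M i) p. \<exists>b\<in>part (M i) r. x = q i a \<and> y = q i b"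
    if "x \<in> part Q p" "y \<in> part Q r" for x y p r
  proof -
    obtain i j where ij: "i \<in> I" "j \<in> I" "x \<in> q i ` part (M i) p" "y \<in> q j ` part (M j) r"
      using \<open>x \<in> _\<close> \<open>y \<in> _\<close> by (auto simp: part)
    obtain k where k: "k \<in> I" "q i ` part (M i) p \<subseteq> q k ` part (M k) p" "q j ` part (M j) r \<subseteq> q k ` part (M k) r"
      using dir[OF ij(1,2)] by auto
    have "x \<in> q k ` part (M k) p" "y \<in> q k ` part (M k) r"
      using k(2,3) ij(3,4) by (meson subsetD)+
    then show ?thesis
      using k(1) by blast
  qed
  have neg: "q i (\<ominus>\<^bsub>M i\<^esub> a) \<oplus>\<^bsub>Q\<^esub> q i a = \<zero>\<^bsub>Q\<^esub> \<and> q i (\<ominus>\<^bsub>M i\<^esub> a) \<in> carrier Q"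
    if i: "i \<in> I" and a: "a \<in> carrier (M i)" for i a
  proof -
    interpret supermodule S "M i" using i by (rule M)
    show ?thesis
      using i a by (auto simp: add zero[OF i] carr M.l_neg)
  qed
  have ag: "abelian_group Q"
  proof (rule abelian_groupI)
    fix x y z assume "x \<in> carrier Q" "y \<in> carrier Q" "z \<in> carrier Q"
    from lift3[OF this] obtain i a b c where i: "i \<in> I"
      and abc: "a \<in> carrier (M i)" "b \<in> carrier (M i)" "c \<in> carrier (M i)"
      and eq: "x = q i a" "y = q i b" "z = q i c"
      by blast
    interpret supermodule S "M i" using i by (rule M)
    show "x \<oplus>\<^bsub>Q\<^esub> y \<in> carrier Q"
      using i abc M.a_closed by (simp only: eq add carr) blast
    show "x \<oplus>\<^bsub>Q\<^esub> y \<oplus>\<^bsub>Q\<^esub> z = x \<oplus>\<^bsub>Q\<^esub> (y \<oplus>\<^bsub>Q\<^esub> z)" "x \<oplus>\<^bsub>Q\<^esub> y = y \<oplus>\<^bsub>Q\<^esub> x" "\<zero>\<^bsub>Q\<^esub> \<oplus>\<^bsub>Q\<^esub> x = x"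
      using i abc by (simp_all add: eq add zero[OF i] M.a_ac)
    show "\<exists>y\<in>carrier Q. y \<oplus>\<^bsub>Q\<^esub> x = \<zero>\<^bsub>Q\<^esub>"
      using neg[OF i abc(1)] eq(1) by blast
  next
    obtain i where i: "i \<in> I" using I by blast
    then interpret supermodule S "M i" by (rule M)
    show "\<zero>\<^bsub>Q\<^esub> \<in> carrier Q"
      unfolding zero[OF i] carr using i by blast
  qed
  interpret Q: abelian_group Q by fact
  have minus: "\<ominus>\<^bsub>Q\<^esub> q i a = q i (\<ominus>\<^bsub>M i\<^esub> a)" if "i \<in> I" "a \<in> carrier (M i)" for i a
    by (rule Q.minus_equality) (use neg that in \<open>auto simp: carr\<close>)
  have part_sub: "part Q p \<subseteq> carrier Q" for p
  proof
    fix x assume "x \<in> part Q p"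
    then obtain i a where i: "i \<in> I" and a: "a \<in> part (M i) p" "x = q i a" using plift by blast
    interpret supermodule S "M i" using i by (rule M)
    show "x \<in> carrier Q"
      using i a Mg.deg_carrier by (auto simp: carr)
  qed
  show ?thesis
  proof (intro supermodule.intro supermodule_axioms.intro S ag)
    fix s r x assume sr: "s \<in> carrier S" "r \<in> carrier S" and x: "x \<in> carrier Q"
    obtain i a where i: "i \<in> I" and a: "a \<in> carrier (M i)" "x = q i a" using lift[OF x] by blast
    interpret supermodule S "M i" using i by (rule M)
    show "(s \<oplus>\<^bsub>S\<^esub> r) \<odot>\<^bsub>Q\<^esub> x = s \<odot>\<^bsub>Q\<^esub> x \<oplus>\<^bsub>Q\<^esub> r \<odot>\<^bsub>Q\<^esub> x" "(s \<otimes>\<^bsub>S\<^esub> r) \<odot>\<^bsub>Q\<^esub> x = s \<odot>\<^bsub>Q\<^esub> (r \<odot>\<^bsub>Q\<^esub> x)"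
      using sr i a by (simp_all add: smult add smult_closed smult_l_distr smult_assoc)
  next
    fix s x y assume s: "s \<in> carrier S" and xy: "x \<in> carrier Q" "y \<in> carrier Q"
    obtain i a b where i: "i \<in> I" and ab: "a \<in> carrier (M i)" "b \<in> carrier (M i)" "x = q i a" "y = q i b"
      using lift3[OF xy xy(2)] by blast
    interpret supermodule S "M i" using i by (rule M)
    show "s \<odot>\<^bsub>Q\<^esub> (x \<oplus>\<^bsub>Q\<^esub> y) = s \<odot>\<^bsub>Q\<^esub> x \<oplus>\<^bsub>Q\<^esub> s \<odot>\<^bsub>Q\<^esub> y"
      using s i ab by (simp add: smult add smult_closed smult_r_distr)
  next
    fix s x assume s: "s \<in> carrier S" and x: "x \<in> carrier Q"
    obtain i a where i: "i \<in> I" and a: "a \<in> carrier (M i)" "x = q i a" using lift[OF x] by blast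
    interpret supermodule S "M i" using i by (rule M)
    show "s \<odot>\<^bsub>Q\<^esub> x \<in> carrier Q"
      using smult_closed[OF s a(1)] i by (simp only: a(2) smult[OF i s a(1)] carr) blast
  next
    fix x assume x: "x \<in> carrier Q"
    obtain i a where i: "i \<in> I" and a: "a \<in> carrier (M i)" "x = q i a" using lift[OF x] by blast
    interpret supermodule S "M i" using i by (rule M)
    show "\<one>\<^bsub>S\<^esub> \<odot>\<^bsub>Q\<^esub> x = x"
      using i a by (simp add: smult smult_one)
  next
    fix s p x r assume s: "s \<in> spart S p" and x: "x \<in> part Q r"
    obtain i a where i: "i \<in> I" and a: "a \<in> part (M i) r" "x = q i a" using plift[OF x] by blast
    interpret supermodule S "M i" using i by (rule M)
    show "s \<odot>\<^bsub>Q\<^esub> x \<in> part Q (p + r)"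
      using smult_degree[OF s a(1)] i
      by (simp only: a(2) smult[OF i S.Sg.deg_carrier[OF s] Mg.deg_carrier[OF a(1)]] part) blast
  next
    show "Z2_grading Q (part Q)"
    proof (rule Z2_gradingI[OF ag])
      fix p show "additive_subgroup (part Q p) Q"
      proof (intro additive_subgroupI subgroup.intro)
        show "part Q p \<subseteq> carrier (add_monoid Q)"
          using part_sub by simp
      next
        fix x y assume "x \<in> part Q p" "y \<in> part Q p"
        from plift2[OF this] obtain i a b where i: "i \<in> I"
          and ab: "a \<in> part (M i) p" "b \<in> part (M i) p" "x = q i a" "y = q i b"
          by blast
        interpret supermodule S "M i" using i by (rule M)
        show "x \<otimes>\<^bsub>add_monoid Q\<^esub> y \<in> part Q p"
          using i ab Mg.deg_add[OF ab(1,2)] by (auto simp: add Mg.deg_carrier part)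
      next
        obtain i where i: "i \<in> I" using I by blast
        then interpret supermodule S "M i" by (rule M)
        show "\<one>\<^bsub>add_monoid Q\<^esub> \<in> part Q p"
          using i Mg.deg_zero by (auto simp: zero[OF i] part)
      next
        fix x assume "x \<in> part Q p"
        then obtain i a where i: "i \<in> I" and a: "a \<in> part (M i) p" "x = q i a" using plift by blast
        interpret supermodule S "M i" using i by (rule M)
        show "inv\<^bsub>add_monoid Q\<^esub> x \<in> part Q p"
          using i a minus[OF i Mg.deg_carrier[OF a(1)]] Mg.deg_neg[OF a(1)]
          by (auto simp: part simp flip: a_inv_def)
      qed
    next
      fix x assume "x \<in> part Q 0" "x \<in> part Q 1"
      then show "x = \<zero>\<^bsub>Q\<^esub>"
        using plift2 ker by metis
    next
      fix x assume x: "x \<in> carrier Q"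
      obtain i a where i: "i \<in> I" and a: "a \<in> carrier (M i)" "x = q i a" using lift[OF x] by blast
      interpret supermodule S "M i" using i by (rule M)
      obtain b c where bc: "b \<in> part (M i) 0" "c \<in> part (M i) 1" "a = b \<oplus>\<^bsub>M i\<^esub> c"
        using Mg.decompose[OF a(1), of 0] by auto
      then have "x = q i b \<oplus>\<^bsub>Q\<^esub> q i c"
        using i a by (simp add: add Mg.deg_carrier)
      moreover have "q i b \<in> part Q 0" "q i c \<in> part Q 1"
        using i bc by (auto simp: part)
      ultimately show "\<exists>a\<in>part Q 0. \<exists>b\<in>part Q 1. x = a \<oplus>\<^bsub>Q\<^esub> b"
        by blast
    qed
  qed
qed

text \<open>The case of a single map covers quotients and records that differ only in further fields.\<close>

lemma supermodule_image:
  assumes M: "supermodule S M"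
    and "carrier Q = q ` carrier M" "\<And>p. part Q p = q ` part M p" "\<zero>\<^bsub>Q\<^esub> = q \<zero>\<^bsub>M\<^esub>"
    and "\<And>x y. x \<in> carrier M \<Longrightarrow> y \<in> carrier M \<Longrightarrow> q x \<oplus>\<^bsub>Q\<^esub> q y = q (x \<oplus>\<^bsub>M\<^esub> y)"
    and "\<And>s x. s \<in> carrier S \<Longrightarrow> x \<in> carrier M \<Longrightarrow> s \<odot>\<^bsub>Q\<^esub> q x = q (s \<odot>\<^bsub>M\<^esub> x)"
    and "\<And>x y. x \<in> part M 0 \<Longrightarrow> y \<in> part M 1 \<Longrightarrow> q x = q y \<Longrightarrow> q x = \<zero>\<^bsub>Q\<^esub>"
  shows "supermodule S Q"
  by (rule supermodule_cover[of S "{()}" "\<lambda>_. M" Q "\<lambda>_. q"])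
    (use assms in \<open>auto intro: supermodule.superring\<close>)

lemma supermodule_cong:
  assumes "supermodule S M" "carrier Q = carrier M" "part Q = part M" "\<zero>\<^bsub>Q\<^esub> = \<zero>\<^bsub>M\<^esub>"
    "add Q = add M" "smult Q = smult M"
  shows "supermodule S Q"
proof -
  interpret supermodule S M by fact
  show ?thesis
    by (rule supermodule_image[of S M _ "\<lambda>x. x"])
      (use assms Mg.deg_disjoint[of _ 0] in auto)
qed

subsection \<open>Restriction to and quotient by a graded submodule\<close>

locale graded_submodule = supermodule +
  fixes N assumes submod: "submodule N S M"
    and comp_in: "\<And>x p. x \<in> N \<Longrightarrow> Mg.comp p x \<in> N"
begin

lemmas N_carrier = submoduleD(1)[OF submod]

lemma supermodule_restrict: "supermodule S (smod_restrict M N)" (is "supermodule S ?R")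
proof -
  have ops: "carrier ?R = N" "add ?R = add M" "\<zero>\<^bsub>?R\<^esub> = \<zero>\<^bsub>M\<^esub>" "smult ?R = smult M"
    "part ?R = (\<lambda>p. part M p \<inter> N)"
    by (auto simp: smod_restrict_def)
  note D = submoduleD(2-5)[OF submod]
  have ag: "abelian_group ?R"
  proof (rule abelian_groupI)
    fix x assume "x \<in> carrier ?R"
    then show "\<exists>y\<in>carrier ?R. y \<oplus>\<^bsub>?R\<^esub> x = \<zero>\<^bsub>?R\<^esub>"
      by (auto simp: ops D N_carrier M.l_neg intro!: bexI[of _ "\<ominus>\<^bsub>M\<^esub> x"])
  qed (auto simp: ops D N_carrier M.a_ac)
  interpret R: abelian_group ?R by fact
  have neg: "\<ominus>\<^bsub>?R\<^esub> x = \<ominus>\<^bsub>M\<^esub> x" if "x \<in> N" for x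
    by (rule R.minus_equality) (use that in \<open>auto simp: ops D N_carrier M.l_neg\<close>)
  show ?thesis
  proof (intro supermodule.intro supermodule_axioms.intro)
    show "Z2_grading ?R (part ?R)"
    proof (rule Z2_gradingI)
      fix p show "additive_subgroup (part ?R p) ?R"
      proof (intro additive_subgroupI subgroup.intro)
        fix x assume x: "x \<in> part ?R p"
        then have "inv\<^bsub>add_monoid ?R\<^esub> x = \<ominus>\<^bsub>M\<^esub> x"
          using neg[of x] by (simp only: a_inv_def ops Int_iff)
        then show "inv\<^bsub>add_monoid ?R\<^esub> x \<in> part ?R p"
          using x D by (simp add: ops Mg.deg_neg)
      qed (auto simp: ops D Mg.deg_add Mg.deg_zero)
    next
      fix x assume "x \<in> carrier ?R"
      then have "x \<in> N" by (simp add: ops)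
      then show "\<exists>a\<in>part ?R 0. \<exists>b\<in>part ?R 1. x = a \<oplus>\<^bsub>?R\<^esub> b"
        using Mg.comp_sum[of x 0] comp_in Mg.comp_deg N_carrier
        by (intro rev_bexI[where x = "Mg.comp 0 x" and A = "part ?R 0"]
            rev_bexI[where x = "Mg.comp 1 x" and A = "part ?R 1"]) (auto simp: ops)
    qed (use ag Mg.deg_disjoint[of _ 0] in \<open>auto simp: ops\<close>)
  qed (use ag superring in \<open>auto simp: ops D N_carrier Sg.deg_carrier smult_l_distr smult_r_distr
         smult_assoc smult_one smult_degree\<close>)
qed

sublocale NN: abelian_subgroup N M
  using submoduleD(6)[OF submod] M.abelian_group_axioms by (rule abelian_subgroupI3)

abbreviation "Q \<equiv> smod_quotient M N"
abbreviation "q x \<equiv> N +>\<^bsub>M\<^esub> x"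

lemma class_eq_iff:
  assumes "x \<in> carrier M" "y \<in> carrier M"
  shows "q x = q y \<longleftrightarrow> x \<oplus>\<^bsub>M\<^esub> \<ominus>\<^bsub>M\<^esub> y \<in> N"
proof
  assume "q x = q y"
  then have "q (x \<oplus>\<^bsub>M\<^esub> \<ominus>\<^bsub>M\<^esub> y) = N"
    using assms NN.a_subset by (intro M.a_coset_add_inv2)
  then show "x \<oplus>\<^bsub>M\<^esub> \<ominus>\<^bsub>M\<^esub> y \<in> N"
    using assms by (intro M.a_coset_join1[OF _ _ NN.a_subgroup]) auto
next
  assume "x \<oplus>\<^bsub>M\<^esub> \<ominus>\<^bsub>M\<^esub> y \<in> N"
  then have "q (x \<oplus>\<^bsub>M\<^esub> \<ominus>\<^bsub>M\<^esub> y) = N"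
    using assms by (intro M.a_coset_join2 NN.a_subgroup) auto
  then show "q x = q y"
    using assms NN.a_subset by (intro M.a_coset_add_inv1)
qed

lemma class_zero: "x \<in> carrier M \<Longrightarrow> q x = N \<longleftrightarrow> x \<in> N"
  using class_eq_iff[of x "\<zero>\<^bsub>M\<^esub>"] NN.a_subset M.minus_equality[of "\<zero>\<^bsub>M\<^esub>" "\<zero>\<^bsub>M\<^esub>"] by simp

lemma quotient_carrier: "carrier Q = (\<lambda>x. q x) ` carrier M"
  by (auto simp: smod_quotient_def A_RCOSETS_def')

lemma quotient_zero: "\<zero>\<^bsub>Q\<^esub> = N"
  by (simp add: smod_quotient_def)

lemma quotient_add: "x \<in> carrier M \<Longrightarrow> y \<in> carrier M \<Longrightarrow> q x \<oplus>\<^bsub>Q\<^esub> q y = q (x \<oplus>\<^bsub>M\<^esub> y)"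
  by (simp add: smod_quotient_def NN.a_rcos_sum)

lemma quotient_part: "part Q p = (\<lambda>x. q x) ` part M p"
  by (simp add: smod_quotient_def)

text \<open>The union that defines the action on cosets has only one member because \<open>N\<close> is stable under \<open>S\<close>.\<close>

lemma quotient_smult:
  assumes s: "s \<in> carrier S" and x: "x \<in> carrier M"
  shows "s \<odot>\<^bsub>Q\<^esub> q x = q (s \<odot>\<^bsub>M\<^esub> x)"
proof -
  have "q (s \<odot>\<^bsub>M\<^esub> y) = q (s \<odot>\<^bsub>M\<^esub> x)" if "y \<in> q x" for y
  proof -
    have y: "y \<in> carrier M"
      using that x M.a_r_coset_subset_G NN.a_subset by blast
    have "q y = q x"
      using M.a_repr_independence[OF that x NN.a_subgroup] by simp
    then have "y \<oplus>\<^bsub>M\<^esub> \<ominus>\<^bsub>M\<^esub> x \<in> N"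
      using class_eq_iff x y by simp
    then have "s \<odot>\<^bsub>M\<^esub> (y \<oplus>\<^bsub>M\<^esub> \<ominus>\<^bsub>M\<^esub> x) \<in> N"
      using submoduleD(4)[OF submod] s by simp
    then show ?thesis
      using s x y by (simp add: class_eq_iff smult_closed smult_r_distr smult_minus)
  qed
  then have "(\<Union>y\<in>q x. q (s \<odot>\<^bsub>M\<^esub> y)) = (\<Union>y\<in>q x. q (s \<odot>\<^bsub>M\<^esub> x))"
    by (rule SUP_cong[OF refl])
  moreover have "q x \<noteq> {}"
    using NN.a_rcos_self[OF x] by blast
  ultimately show ?thesis
    by (simp add: smod_quotient_def)
qed

text \<open>The grading of the quotient is direct: if \<open>x - y \<in> N\<close> with \<open>x\<close> even and \<open>y\<close> odd, then \<open>x\<close> is the even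
  component of an element of \<open>N\<close>.\<close>

lemma supermodule_quotient: "supermodule S Q"
proof (rule supermodule_image[of S M Q "\<lambda>x. q x"])
  fix x y assume xy: "x \<in> part M 0" "y \<in> part M 1" "q x = q y"
  then have xyM: "x \<in> carrier M" "y \<in> carrier M" by (auto simp: Mg.deg_carrier)
  with xy have "x \<oplus>\<^bsub>M\<^esub> \<ominus>\<^bsub>M\<^esub> y \<in> N"
    by (simp add: class_eq_iff)
  then have "Mg.comp 0 (x \<oplus>\<^bsub>M\<^esub> \<ominus>\<^bsub>M\<^esub> y) \<in> N"
    by (rule comp_in)
  then have "x \<in> N"
    using xy by (simp add: Mg.comp_eq Mg.deg_neg)
  then show "q x = \<zero>\<^bsub>Q\<^esub>"
    using class_zero xyM by (simp add: quotient_zero)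
next
  show "\<zero>\<^bsub>Q\<^esub> = q \<zero>\<^bsub>M\<^esub>"
    using class_zero[of "\<zero>\<^bsub>M\<^esub>"] submoduleD(2)[OF submod] by (simp add: quotient_zero)
qed (simp_all add: supermodule quotient_carrier quotient_part quotient_add quotient_smult)

lemma quotient_factor:
  assumes P: "supermodule S P" and h: "h \<in> smod_hom S M P" and N0: "\<And>x. x \<in> N \<Longrightarrow> h x = \<zero>\<^bsub>P\<^esub>"
  shows "\<exists>g\<in>smod_hom S Q P. \<forall>x\<in>carrier M. g (q x) = h x"
proof -
  interpret h: smod_morphism S M P h
    using P h supermodule by (simp add: smod_morphism_def smod_morphism_axioms_def)
  have "h x = h y" if "x \<in> carrier M" "y \<in> carrier M" "q x = q y" for x y
  proof -
    have "h x \<oplus>\<^bsub>P\<^esub> \<ominus>\<^bsub>P\<^esub> h y = \<zero>\<^bsub>P\<^esub>"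
      using N0[of "x \<oplus>\<^bsub>M\<^esub> \<ominus>\<^bsub>M\<^esub> y"] that class_eq_iff[of x y] by (simp add: h.hom_add h.hom_neg)
    then show ?thesis
      using that by (metis h.N.M.a_inv_closed h.N.M.minus_equality h.N.M.minus_minus h.hom_closed)
  qed
  then obtain g where g: "\<And>x. x \<in> carrier M \<Longrightarrow> h x = g (q x)"
    using function_factors_left_gen[of "\<lambda>x. x \<in> carrier M" "\<lambda>x. q x" h] by blast
  have "g \<in> smod_hom S Q P"
    by (rule smod_homI)
      (auto simp: quotient_carrier quotient_add quotient_smult quotient_part h.hom_closed h.hom_add
        h.hom_smult h.hom_part smult_closed Mg.deg_carrier simp flip: g)
  with g show ?thesis by auto
qed

end

lemma (in smod_morphism) kernel_graded: "graded_submodule S M (a_kernel M N h)"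
  by (intro graded_submodule.intro graded_submodule_axioms.intro M.supermodule kernel_submodule kernel_comp)

section \<open>The tensor product\<close>

locale tensor_pair = M: supermodule S M + N: supermodule S N
  for S :: "'s superring" and M :: "('s, 'a, 'm) supermodule_scheme"
    and N :: "('s, 'b, 'n) supermodule_scheme"
begin

abbreviation "F \<equiv> free_Abelian_group (carrier M \<times> carrier N)"
abbreviation "R \<equiv> tensor_rel S M N"
abbreviation "T \<equiv> tensor S M N"
abbreviation "cls \<equiv> tensor_class S M N"
abbreviation "t \<equiv> tensor_elem S M N"

definition tensor_gens :: "('a \<times> 'b \<Rightarrow>\<^sub>0 int) set" where
  "tensor_gens =
    {frag_of (x \<oplus>\<^bsub>M\<^esub> x', y) - frag_of (x, y) - frag_of (x', y) | x x' y.
        x \<in> carrier M \<and> x' \<in> carrier M \<and> y \<in> carrier N} \<union>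
     {frag_of (x, y \<oplus>\<^bsub>N\<^esub> y') - frag_of (x, y) - frag_of (x, y') | x y y'.
        x \<in> carrier M \<and> y \<in> carrier N \<and> y' \<in> carrier N} \<union>
     {frag_of (sgn_pow M (p * q) (s \<odot>\<^bsub>M\<^esub> x), y) - frag_of (x, s \<odot>\<^bsub>N\<^esub> y) | p q s x y.
        s \<in> spart S p \<and> x \<in> part M q \<and> y \<in> carrier N}"

lemma tensor_rel_eq: "R = generate F tensor_gens"
  by (simp add: tensor_rel_def tensor_gens_def)

sublocale F: comm_group F
  by (rule abelian_free_Abelian_group)

lemma sgn_smult_closed:
  "s \<in> spart S p \<Longrightarrow> x \<in> part M q \<Longrightarrow> sgn_pow M k (s \<odot>\<^bsub>M\<^esub> x) \<in> carrier M"
  "s \<in> spart S p \<Longrightarrow> y \<in> carrier N \<Longrightarrow> s \<odot>\<^bsub>N\<^esub> y \<in> carrier N"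
  by (simp_all add: M.Mg.sgn_closed M.smult_closed N.smult_closed M.Sg.deg_carrier M.Mg.deg_carrier)

lemma F_diff: "u \<in> carrier F \<Longrightarrow> v \<in> carrier F \<Longrightarrow> u - v \<in> carrier F"
  using keys_diff[of u v] by auto

lemma F_of: "x \<in> carrier M \<Longrightarrow> y \<in> carrier N \<Longrightarrow> frag_of (x, y) \<in> carrier F"
  by simp

lemma tensor_gens_closed: "tensor_gens \<subseteq> carrier F"
  unfolding tensor_gens_def
  by (auto simp del: carrier_free_Abelian_group_iff
      intro!: F_diff F_of M.M.a_closed N.M.a_closed intro: sgn_smult_closed M.Mg.deg_carrier)

lemma rel_subgroup: "subgroup R F"
  unfolding tensor_rel_eq by (rule F.generate_is_subgroup[OF tensor_gens_closed])

lemma rel_normal: "R \<lhd> F"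
  using rel_subgroup by (simp add: F.normal_iff_subgroup)

lemma cls_def': "cls c = R #>\<^bsub>F\<^esub> c"
  by (simp add: tensor_class_def)

lemma cls_eq:
  assumes "u \<in> carrier F" "v \<in> carrier F" "u - v \<in> R"
  shows "cls u = cls v"
proof -
  have "u = (u - v) \<otimes>\<^bsub>F\<^esub> v" by simp
  then have "u \<in> cls v"
    unfolding cls_def' r_coset_def using assms(3) by blast
  then show ?thesis
    using F.repr_independence[OF _ assms(2) rel_subgroup] by (simp add: cls_def')
qed

lemma T_simps: "carrier T = carrier (F Mod R)" "add T = mult (F Mod R)" "\<zero>\<^bsub>T\<^esub> = R"
  by (simp_all add: tensor_def tensor_group_def fun_eq_iff)

lemma T_carrier: "carrier T = cls ` carrier F"
  by (simp add: T_simps carrier_FactGroup cls_def' image_def)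

sublocale T: abelian_group T
proof -
  interpret Q: comm_group "F Mod R"
    by (rule F.abelian_FactGroup[OF rel_subgroup])
  show "abelian_group T"
    by (rule abelian_groupI)
      (use Q.m_closed Q.one_closed Q.m_assoc Q.m_comm Q.l_one Q.l_inv_ex in
        \<open>simp_all add: T_simps del: mult_FactGroup\<close>)
qed

lemma T_minus: "inv\<^bsub>F Mod R\<^esub> A = \<ominus>\<^bsub>T\<^esub> A"
  by (simp add: a_inv_def m_inv_def T_simps)

lemma cls_closed: "u \<in> carrier F \<Longrightarrow> cls u \<in> carrier T"
  by (auto simp: T_carrier)

lemma cls_add: "u \<in> carrier F \<Longrightarrow> v \<in> carrier F \<Longrightarrow> cls (u + v) = cls u \<oplus>\<^bsub>T\<^esub> cls v"
  using normal.rcos_sum[OF rel_normal, of u v] by (simp add: T_simps cls_def' del: carrier_free_Abelian_group_iff)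

lemma t_def': "t x y = cls (frag_of (x, y))"
  by (simp add: tensor_elem_def)

lemma t_closed: "x \<in> carrier M \<Longrightarrow> y \<in> carrier N \<Longrightarrow> t x y \<in> carrier T"
  unfolding t_def' by (intro cls_closed F_of)

lemma gens_rel: "u \<in> tensor_gens \<Longrightarrow> u \<in> R"
  unfolding tensor_rel_eq by (rule generate.incl)

lemma t_add_left:
  assumes "x \<in> carrier M" "x' \<in> carrier M" "y \<in> carrier N"
  shows "t (x \<oplus>\<^bsub>M\<^esub> x') y = t x y \<oplus>\<^bsub>T\<^esub> t x' y"
proof -
  have "frag_of (x \<oplus>\<^bsub>M\<^esub> x', y) - (frag_of (x, y) + frag_of (x', y)) \<in> R"
    using assms unfolding diff_add_eq_diff_diff_swap[of _ "frag_of (x', y)"] add.commute[of "frag_of (x, y)"]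
    by (intro gens_rel) (auto simp: tensor_gens_def)
  then have "cls (frag_of (x \<oplus>\<^bsub>M\<^esub> x', y)) = cls (frag_of (x, y) + frag_of (x', y))"
    using assms keys_add[of "frag_of (x, y)" "frag_of (x', y)"] by (intro cls_eq) auto
  then show ?thesis
    using assms by (simp add: t_def' cls_add)
qed

lemma t_add_right:
  assumes "x \<in> carrier M" "y \<in> carrier N" "y' \<in> carrier N"
  shows "t x (y \<oplus>\<^bsub>N\<^esub> y') = t x y \<oplus>\<^bsub>T\<^esub> t x y'"
proof -
  have "frag_of (x, y \<oplus>\<^bsub>N\<^esub> y') - (frag_of (x, y) + frag_of (x, y')) \<in> R"
    using assms unfolding diff_add_eq_diff_diff_swap[of _ "frag_of (x, y')"] add.commute[of "frag_of (x, y)"]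
    by (intro gens_rel) (auto simp: tensor_gens_def)
  then have "cls (frag_of (x, y \<oplus>\<^bsub>N\<^esub> y')) = cls (frag_of (x, y) + frag_of (x, y'))"
    using assms keys_add[of "frag_of (x, y)" "frag_of (x, y')"] by (intro cls_eq) auto
  then show ?thesis
    using assms by (simp add: t_def' cls_add)
qed

lemma t_balanced:
  assumes "s \<in> spart S p" "x \<in> part M q" "y \<in> carrier N"
  shows "t (sgn_pow M (p * q) (s \<odot>\<^bsub>M\<^esub> x)) y = t x (s \<odot>\<^bsub>N\<^esub> y)"
  unfolding t_def'
proof (rule cls_eq)
  show "frag_of (sgn_pow M (p * q) (s \<odot>\<^bsub>M\<^esub> x), y) - frag_of (x, s \<odot>\<^bsub>N\<^esub> y) \<in> R"
    using assms by (intro gens_rel) (auto simp: tensor_gens_def)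
qed (use assms sgn_smult_closed M.Mg.deg_carrier in auto)

lemma t_zero_left: assumes "y \<in> carrier N" shows "t \<zero>\<^bsub>M\<^esub> y = \<zero>\<^bsub>T\<^esub>"
  using t_add_left[of "\<zero>\<^bsub>M\<^esub>" "\<zero>\<^bsub>M\<^esub>" y] assms t_closed[of "\<zero>\<^bsub>M\<^esub>" y]
  by (metis M.M.l_zero M.M.zero_closed T.add.r_cancel_one')

lemma t_zero_right: assumes "x \<in> carrier M" shows "t x \<zero>\<^bsub>N\<^esub> = \<zero>\<^bsub>T\<^esub>"
  using t_add_right[of x "\<zero>\<^bsub>N\<^esub>" "\<zero>\<^bsub>N\<^esub>"] assms t_closed[of x "\<zero>\<^bsub>N\<^esub>"]
  by (metis N.M.l_zero N.M.zero_closed T.add.r_cancel_one')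

lemma t_neg_left:
  assumes "x \<in> carrier M" "y \<in> carrier N" shows "t (\<ominus>\<^bsub>M\<^esub> x) y = \<ominus>\<^bsub>T\<^esub> t x y"
proof -
  have "t (\<ominus>\<^bsub>M\<^esub> x) y \<oplus>\<^bsub>T\<^esub> t x y = \<zero>\<^bsub>T\<^esub>"
    using t_add_left[of "\<ominus>\<^bsub>M\<^esub> x" x y] assms by (simp add: M.M.l_neg t_zero_left)
  then show ?thesis
    using assms by (metis M.M.a_inv_closed T.minus_equality t_closed)
qed

lemma cls_zero: "cls 0 = \<zero>\<^bsub>T\<^esub>"
  using F.coset_mult_one[of R] subgroup.subset[OF rel_subgroup] by (simp add: T_simps cls_def')

lemma cls_neg_of:
  assumes "x \<in> carrier M" "y \<in> carrier N"
  shows "cls (- frag_of (x, y)) = t (\<ominus>\<^bsub>M\<^esub> x) y"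
proof -
  have "cls (- frag_of (x, y)) \<oplus>\<^bsub>T\<^esub> t x y = cls 0"
    using assms cls_add[of "- frag_of (x, y)" "frag_of (x, y)"] by (simp add: t_def')
  then show ?thesis
    using assms cls_zero cls_closed[of "- frag_of (x, y)"]
    by (metis F_of T.minus_equality carrier_free_Abelian_group_iff keys_minus t_closed t_neg_left)
qed

text \<open>Every tensor is a sum of pure tensors: the sign of \<open>- (x \<otimes> y)\<close> can be moved into \<open>x\<close>.\<close>

lemma tensor_induct:
  assumes "A \<in> carrier T"
    and pure: "\<And>x y. x \<in> carrier M \<Longrightarrow> y \<in> carrier N \<Longrightarrow> P (t x y)"
    and sum: "\<And>A B. A \<in> carrier T \<Longrightarrow> B \<in> carrier T \<Longrightarrow> P A \<Longrightarrow> P B \<Longrightarrow> P (A \<oplus>\<^bsub>T\<^esub> B)"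
  shows "P A"
proof -
  obtain c where c: "c \<in> carrier F" "A = cls c"
    using assms(1) T_carrier by auto
  have "P (cls c) \<and> P (cls (- c))"
  proof (rule free_Abelian_group_induct[of c "carrier M \<times> carrier N"])
    show "Poly_Mapping.keys c \<subseteq> carrier M \<times> carrier N"
      using c by simp
    have "cls 0 = t \<zero>\<^bsub>M\<^esub> \<zero>\<^bsub>N\<^esub>"
      by (simp add: cls_zero t_zero_left)
    then show "P (cls 0) \<and> P (cls (- 0))"
      using pure by simp
  next
    fix x y :: "'a \<times> 'b \<Rightarrow>\<^sub>0 int"
    assume k: "Poly_Mapping.keys x \<subseteq> carrier M \<times> carrier N" "Poly_Mapping.keys y \<subseteq> carrier M \<times> carrier N"
      and P: "P (cls x) \<and> P (cls (- x))" "P (cls y) \<and> P (cls (- y))"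
    show "P (cls (x - y)) \<and> P (cls (- (x - y)))"
      using sum[of "cls x" "cls (- y)"] sum[of "cls (- x)" "cls y"] P k
        cls_add[of x "- y"] cls_add[of "- x" "y"]
      by (simp add: cls_closed)
  next
    fix a assume "a \<in> carrier M \<times> carrier N"
    then show "P (cls (frag_of a)) \<and> P (cls (- frag_of a))"
      using pure by (auto simp: cls_neg_of simp flip: t_def')
  qed
  then show ?thesis
    using c by simp
qed

text \<open>The target is only an abelian group, so that this also applies to maps that are not linear of
  degree \<open>0\<close>: the action of a scalar and the projections to the two degrees.\<close>

lemma additive_lift:
  assumes P: "abelian_group P"
    and closed: "\<And>x y. x \<in> carrier M \<Longrightarrow> y \<in> carrier N \<Longrightarrow> b x y \<in> carrier P"
    and left: "\<And>x x' y. x \<in> carrier M \<Longrightarrow> x' \<in> carrier M \<Longrightarrow> y \<in> carrier N \<Longrightarrow>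
      b (x \<oplus>\<^bsub>M\<^esub> x') y = b x y \<oplus>\<^bsub>P\<^esub> b x' y"
    and right: "\<And>x y y'. x \<in> carrier M \<Longrightarrow> y \<in> carrier N \<Longrightarrow> y' \<in> carrier N \<Longrightarrow>
      b x (y \<oplus>\<^bsub>N\<^esub> y') = b x y \<oplus>\<^bsub>P\<^esub> b x y'"
    and balanced: "\<And>s p x q y. s \<in> spart S p \<Longrightarrow> x \<in> part M q \<Longrightarrow> y \<in> carrier N \<Longrightarrow>
      b (sgn_pow M (p * q) (s \<odot>\<^bsub>M\<^esub> x)) y = b x (s \<odot>\<^bsub>N\<^esub> y)"
  obtains h where "h \<in> carrier T \<rightarrow> carrier P"
    "\<And>A B. A \<in> carrier T \<Longrightarrow> B \<in> carrier T \<Longrightarrow> h (A \<oplus>\<^bsub>T\<^esub> B) = h A \<oplus>\<^bsub>P\<^esub> h B"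
    "\<And>x y. x \<in> carrier M \<Longrightarrow> y \<in> carrier N \<Longrightarrow> h (t x y) = b x y"
proof -
  interpret P: abelian_group P by fact
  have "(\<lambda>(x, y). b x y) ` (carrier M \<times> carrier N) \<subseteq> carrier (add_monoid P)"
    using closed by auto
  then obtain h0 where h0: "h0 \<in> hom F (add_monoid P)"
      "\<And>z. z \<in> carrier M \<times> carrier N \<Longrightarrow> h0 (frag_of z) = (\<lambda>(x, y). b x y) z"
    using comm_group.free_Abelian_group_universal[OF P.a_comm_group] by blast
  have h0b: "h0 (frag_of (x, y)) = b x y" if "x \<in> carrier M" "y \<in> carrier N" for x y
    using h0(2) that by simp
  interpret h0: group_hom F "add_monoid P" h0
    by unfold_locales (rule h0(1))
  have h0_add: "h0 (u + v) = h0 u \<oplus>\<^bsub>P\<^esub> h0 v" if "u \<in> carrier F" "v \<in> carrier F" for u v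
    using h0.hom_mult[OF that] by simp
  have h0_cl: "h0 u \<in> carrier P" if "u \<in> carrier F" for u
    using h0.hom_closed[OF that] by simp
  have diff: "h0 (u - v) = h0 u \<ominus>\<^bsub>P\<^esub> h0 v" if "u \<in> carrier F" "v \<in> carrier F" for u v
  proof -
    have "h0 u = h0 (u - v) \<oplus>\<^bsub>P\<^esub> h0 v"
      using h0_add[of "u - v" v] F_diff[OF that] that(2) by (simp only: diff_add_cancel)
    then show ?thesis
      using h0_cl that h0_cl[OF F_diff[OF that]] by (simp add: P.minus_eq P.a_assoc P.r_neg del: carrier_free_Abelian_group_iff)
  qed
  have "tensor_gens \<subseteq> kernel F (add_monoid P) h0"
  proof
    fix u assume u: "u \<in> tensor_gens"
    have "h0 u = \<zero>\<^bsub>P\<^esub>"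
      using u unfolding tensor_gens_def
    proof (elim UnE CollectE exE conjE)
      fix x x' y assume a: "u = frag_of (x \<oplus>\<^bsub>M\<^esub> x', y) - frag_of (x, y) - frag_of (x', y)"
        "x \<in> carrier M" "x' \<in> carrier M" "y \<in> carrier N"
      then show ?thesis
        by (simp add: diff F_diff h0b left closed P.minus_eq P.a_ac P.r_neg P.r_neg1 P.r_neg2 del: carrier_free_Abelian_group_iff)
    next
      fix x y y' assume a: "u = frag_of (x, y \<oplus>\<^bsub>N\<^esub> y') - frag_of (x, y) - frag_of (x, y')"
        "x \<in> carrier M" "y \<in> carrier N" "y' \<in> carrier N"
      then show ?thesis
        by (simp add: diff F_diff h0b right closed P.minus_eq P.a_ac P.r_neg P.r_neg1 P.r_neg2 del: carrier_free_Abelian_group_iff)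
    next
      fix p q s x y
      assume a: "u = frag_of (sgn_pow M (p * q) (s \<odot>\<^bsub>M\<^esub> x), y) - frag_of (x, s \<odot>\<^bsub>N\<^esub> y)"
        "s \<in> spart S p" "x \<in> part M q" "y \<in> carrier N"
      then show ?thesis
        by (simp add: diff h0b balanced closed P.minus_eq P.r_neg sgn_smult_closed M.Mg.deg_carrier
            del: carrier_free_Abelian_group_iff)
    qed
    then show "u \<in> kernel F (add_monoid P) h0"
      using u tensor_gens_closed by (auto simp: kernel_def simp del: carrier_free_Abelian_group_iff)
  qed
  then have "R \<subseteq> kernel F (add_monoid P) h0"
    unfolding tensor_rel_eq by (rule F.generate_subgroup_incl[OF _ h0.subgroup_kernel])
  then obtain h where h: "h \<in> hom (F Mod R) (add_monoid P)" "\<And>c. c \<in> carrier F \<Longrightarrow> h (R #>\<^bsub>F\<^esub> c) = h0 c"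
    using h0.FactGroup_universal_kernel[OF rel_normal] by blast
  show thesis
  proof (rule that[of h])
    show "h \<in> carrier T \<rightarrow> carrier P"
      "\<And>A B. A \<in> carrier T \<Longrightarrow> B \<in> carrier T \<Longrightarrow> h (A \<oplus>\<^bsub>T\<^esub> B) = h A \<oplus>\<^bsub>P\<^esub> h B"
      using h(1) by (auto simp: hom_def T_simps)
    show "\<And>x y. x \<in> carrier M \<Longrightarrow> y \<in> carrier N \<Longrightarrow> h (t x y) = b x y"
      using h(2) h0b by (simp add: t_def' cls_def')
  qed
qed

subsection \<open>The scalar action\<close>

text \<open>Left multiplication by \<open>r\<close> commutes with the right action of \<open>s\<close>, so that \<open>r\<close> acts on the first
  factor of the tensor product.  For homogeneous \<open>r\<close> the sign from exchanging \<open>r\<close> and \<open>s\<close> turns the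
  exponent \<open>p q\<close> into the one for \<open>r x\<close>; the general case follows by additivity in \<open>r\<close>.\<close>

lemma t_smult_balanced:
  assumes r: "r \<in> carrier S" and s: "s \<in> spart S p" and x: "x \<in> part M q" and y: "y \<in> carrier N"
  shows "t (r \<odot>\<^bsub>M\<^esub> sgn_pow M (p * q) (s \<odot>\<^bsub>M\<^esub> x)) y = t (r \<odot>\<^bsub>M\<^esub> x) (s \<odot>\<^bsub>N\<^esub> y)"
  using r
proof (rule M.Sg.homogeneous_induct)
  have sc: "s \<in> carrier S" and xc: "x \<in> carrier M"
    using s x M.Sg.deg_carrier M.Mg.deg_carrier by auto
  {
    fix k a assume a: "a \<in> spart S k"
    then have ac: "a \<in> carrier S" by (rule M.Sg.deg_carrier)
    have "a \<odot>\<^bsub>M\<^esub> (s \<odot>\<^bsub>M\<^esub> x) = (a \<otimes>\<^bsub>S\<^esub> s) \<odot>\<^bsub>M\<^esub> x"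
      by (simp add: M.smult_assoc ac sc xc)
    also have "\<dots> = sgn_pow M (k * p) (s \<odot>\<^bsub>M\<^esub> (a \<odot>\<^bsub>M\<^esub> x))"
    proof (cases "k * p = 1")
      case True
      have "(\<ominus>\<^bsub>S\<^esub> (s \<otimes>\<^bsub>S\<^esub> a)) \<odot>\<^bsub>M\<^esub> x = \<ominus>\<^bsub>M\<^esub> ((s \<otimes>\<^bsub>S\<^esub> a) \<odot>\<^bsub>M\<^esub> x)"
        using M.minus_smult_one[of "(s \<otimes>\<^bsub>S\<^esub> a) \<odot>\<^bsub>M\<^esub> x"] ac sc xc
          M.smult_assoc[of "\<ominus>\<^bsub>S\<^esub> \<one>\<^bsub>S\<^esub>" "s \<otimes>\<^bsub>S\<^esub> a" x, symmetric]
        by (simp add: M.smult_closed M.S.l_minus)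
      with True show ?thesis
        using M.supercomm[OF a s] by (simp add: M.smult_assoc ac sc xc)
    next
      case False
      then have kp: "k * p = 0"
        using bit_cases[of "k * p"] by blast
      show ?thesis
        using M.supercomm[OF a s] unfolding kp sgn_pow_0 by (simp add: M.smult_assoc ac sc xc)
    qed
    finally have eq: "a \<odot>\<^bsub>M\<^esub> (s \<odot>\<^bsub>M\<^esub> x) = sgn_pow M (k * p) (s \<odot>\<^bsub>M\<^esub> (a \<odot>\<^bsub>M\<^esub> x))" .
    have "a \<odot>\<^bsub>M\<^esub> sgn_pow M (p * q) (s \<odot>\<^bsub>M\<^esub> x) = sgn_pow M (p * q) (sgn_pow M (k * p) (s \<odot>\<^bsub>M\<^esub> (a \<odot>\<^bsub>M\<^esub> x)))"
      using ac sc xc by (simp add: M.smult_sgn M.smult_closed eq)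
    also have "\<dots> = sgn_pow M (p * (k + q)) (s \<odot>\<^bsub>M\<^esub> (a \<odot>\<^bsub>M\<^esub> x))"
      using ac sc xc bit_cases[of p] bit_cases[of q] bit_cases[of k] by (auto simp: M.smult_closed)
    finally show "t (a \<odot>\<^bsub>M\<^esub> sgn_pow M (p * q) (s \<odot>\<^bsub>M\<^esub> x)) y = t (a \<odot>\<^bsub>M\<^esub> x) (s \<odot>\<^bsub>N\<^esub> y)"
      using t_balanced[OF s M.smult_degree[OF a x] y] by simp
  }
  fix a b assume "a \<in> carrier S" "b \<in> carrier S"
    "t (a \<odot>\<^bsub>M\<^esub> sgn_pow M (p * q) (s \<odot>\<^bsub>M\<^esub> x)) y = t (a \<odot>\<^bsub>M\<^esub> x) (s \<odot>\<^bsub>N\<^esub> y)"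
    "t (b \<odot>\<^bsub>M\<^esub> sgn_pow M (p * q) (s \<odot>\<^bsub>M\<^esub> x)) y = t (b \<odot>\<^bsub>M\<^esub> x) (s \<odot>\<^bsub>N\<^esub> y)"
  then show "t ((a \<oplus>\<^bsub>S\<^esub> b) \<odot>\<^bsub>M\<^esub> sgn_pow M (p * q) (s \<odot>\<^bsub>M\<^esub> x)) y = t ((a \<oplus>\<^bsub>S\<^esub> b) \<odot>\<^bsub>M\<^esub> x) (s \<odot>\<^bsub>N\<^esub> y)"
    using sc xc y sgn_smult_closed(1)[OF s x]
    by (simp add: M.smult_l_distr t_add_left M.smult_closed N.smult_closed)
qed

text \<open>All members of the union that defines \<open>s A\<close> agree: they are the value at \<open>A\<close> of the endomorphism
  induced by \<open>x \<otimes> y \<mapsto> s x \<otimes> y\<close>.\<close>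

lemma smult_T:
  assumes s: "s \<in> carrier S"
  obtains h where "h \<in> carrier T \<rightarrow> carrier T"
    "\<And>A B. A \<in> carrier T \<Longrightarrow> B \<in> carrier T \<Longrightarrow> h (A \<oplus>\<^bsub>T\<^esub> B) = h A \<oplus>\<^bsub>T\<^esub> h B"
    "\<And>x y. x \<in> carrier M \<Longrightarrow> y \<in> carrier N \<Longrightarrow> h (t x y) = t (s \<odot>\<^bsub>M\<^esub> x) y"
    "\<And>A. A \<in> carrier T \<Longrightarrow> s \<odot>\<^bsub>T\<^esub> A = h A"
proof -
  let ?E = "frag_extend (\<lambda>(x, y). frag_of (s \<odot>\<^bsub>M\<^esub> x, y))"
  obtain h where h: "h \<in> carrier T \<rightarrow> carrier T"
    "\<And>A B. A \<in> carrier T \<Longrightarrow> B \<in> carrier T \<Longrightarrow> h (A \<oplus>\<^bsub>T\<^esub> B) = h A \<oplus>\<^bsub>T\<^esub> h B"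
    "\<And>x y. x \<in> carrier M \<Longrightarrow> y \<in> carrier N \<Longrightarrow> h (t x y) = t (s \<odot>\<^bsub>M\<^esub> x) y"
  proof (rule additive_lift[of T "\<lambda>x y. t (s \<odot>\<^bsub>M\<^esub> x) y"])
  qed (auto simp: T.abelian_group_axioms s M.smult_closed M.smult_r_distr N.smult_closed t_closed
      t_add_left t_add_right t_smult_balanced)
  have hc: "h A \<in> carrier T" if "A \<in> carrier T" for A
    using h(1) that by auto
  have h_zero: "h \<zero>\<^bsub>T\<^esub> = \<zero>\<^bsub>T\<^esub>"
    using h(2)[of "\<zero>\<^bsub>T\<^esub>" "\<zero>\<^bsub>T\<^esub>"] hc[of "\<zero>\<^bsub>T\<^esub>"] by (metis T.add.r_cancel_one' T.l_zero T.zero_closed)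
  have E: "?E c \<in> carrier F \<and> h (cls c) = cls (?E c)" if "c \<in> carrier F" for c
  proof (rule free_Abelian_group_induct[of c "carrier M \<times> carrier N"])
    show "?E 0 \<in> carrier F \<and> h (cls 0) = cls (?E 0)"
      by (simp add: cls_zero h_zero)
  next
    fix x y :: "'a \<times> 'b \<Rightarrow>\<^sub>0 int"
    assume "Poly_Mapping.keys x \<subseteq> carrier M \<times> carrier N" "Poly_Mapping.keys y \<subseteq> carrier M \<times> carrier N"
      and *: "?E x \<in> carrier F \<and> h (cls x) = cls (?E x)" "?E y \<in> carrier F \<and> h (cls y) = cls (?E y)"
    then have xy: "x \<in> carrier F" "y \<in> carrier F" by auto
    note d = F_diff[OF xy] F_diff[of "?E x" "?E y"]
    have "h (cls (x - y)) \<oplus>\<^bsub>T\<^esub> h (cls y) = h (cls x)"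
      using cls_add[OF d(1) xy(2)] h(2) cls_closed d(1) xy(2) by simp
    moreover have "cls (?E x - ?E y) \<oplus>\<^bsub>T\<^esub> cls (?E y) = cls (?E x)"
      using cls_add[of "?E x - ?E y" "?E y"] d * by (simp del: carrier_free_Abelian_group_iff)
    ultimately have "h (cls (x - y)) = cls (?E x - ?E y)"
      using * hc[OF cls_closed[OF d(1)]] cls_closed d(2) by (metis T.add.right_cancel)
    then show "?E (x - y) \<in> carrier F \<and> h (cls (x - y)) = cls (?E (x - y))"
      using * d by (simp add: frag_extend_diff del: carrier_free_Abelian_group_iff)
  next
    fix a assume "a \<in> carrier M \<times> carrier N"
    then show "?E (frag_of a) \<in> carrier F \<and> h (cls (frag_of a)) = cls (?E (frag_of a))"
      using h(3) s by (auto simp: M.smult_closed simp flip: t_def')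
  qed (use that in auto)
  have "s \<odot>\<^bsub>T\<^esub> A = h A" if A: "A \<in> carrier T" for A
  proof -
    obtain c where c: "c \<in> carrier F" "A = cls c"
      using A T_carrier by auto
    have "cls (?E d) = h A" if d: "d \<in> A" for d
    proof -
      have "d \<in> carrier F" "cls d = A"
        using d c F.r_coset_subset_G[of R c] subgroup.subset[OF rel_subgroup]
          F.repr_independence[OF _ c(1) rel_subgroup, of d]
        by (auto simp: cls_def' simp del: carrier_free_Abelian_group_iff)
      then show ?thesis
        using E by metis
    qed
    moreover have "c \<in> A"
      using c F.rcos_self[OF c(1) rel_subgroup] by (simp add: cls_def')
    ultimately have "(\<Union>d\<in>A. cls (?E d)) = h A"
      by blast
    then show ?thesis
      by (simp add: tensor_def)
  qed
  with h show thesis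
    by (rule that)
qed

lemma smult_T_closed: "s \<in> carrier S \<Longrightarrow> A \<in> carrier T \<Longrightarrow> s \<odot>\<^bsub>T\<^esub> A \<in> carrier T"
  by (rule smult_T[of s]) auto

lemma smult_T_add:
  assumes "s \<in> carrier S" "A \<in> carrier T" "B \<in> carrier T"
  shows "s \<odot>\<^bsub>T\<^esub> (A \<oplus>\<^bsub>T\<^esub> B) = s \<odot>\<^bsub>T\<^esub> A \<oplus>\<^bsub>T\<^esub> s \<odot>\<^bsub>T\<^esub> B"
  by (rule smult_T[OF assms(1)]) (use assms T.add.m_closed in auto)

lemma smult_t:
  assumes "s \<in> carrier S" "x \<in> carrier M" "y \<in> carrier N"
  shows "s \<odot>\<^bsub>T\<^esub> t x y = t (s \<odot>\<^bsub>M\<^esub> x) y"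
  by (rule smult_T[OF assms(1)]) (use assms t_closed in auto)

subsection \<open>The grading\<close>

lemma T_part: "part T p = generate (F Mod R)
    {t x y | x y q r. q + r = p \<and> x \<in> part M q \<and> y \<in> part N r}"
  by (simp add: tensor_def tensor_group_def)

lemma T_part_subgroup: "additive_subgroup (part T p) T"
proof -
  interpret Q: group "F Mod R"
    using F.abelian_FactGroup[OF rel_subgroup] by (rule comm_group.axioms)
  have sub: "subgroup (part T p) (F Mod R)"
    unfolding T_part
    by (rule Q.generate_is_subgroup)
      (auto simp flip: T_simps(1) intro!: t_closed M.Mg.deg_carrier N.Mg.deg_carrier)
  have inv: "inv\<^bsub>add_monoid T\<^esub> x = inv\<^bsub>F Mod R\<^esub> x" for x
    by (simp only: T_minus a_inv_def)
  show ?thesis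
    using subgroup.subset[OF sub] subgroup.m_closed[OF sub] subgroup.one_closed[OF sub]
      subgroup.m_inv_closed[OF sub] inv
    by (intro additive_subgroupI subgroup.intro)
      (simp_all add: T_simps(1-3) del: mult_FactGroup)
qed

lemma t_part: "x \<in> part M q \<Longrightarrow> y \<in> part N r \<Longrightarrow> t x y \<in> part T (q + r)"
  unfolding T_part by (rule generate.incl) auto

lemma T_part_add: "A \<in> part T p \<Longrightarrow> B \<in> part T p \<Longrightarrow> A \<oplus>\<^bsub>T\<^esub> B \<in> part T p"
  using additive_subgroup.a_closed[OF T_part_subgroup] .

lemma T_part_carrier: "A \<in> part T p \<Longrightarrow> A \<in> carrier T"
  using additive_subgroup.a_subset[OF T_part_subgroup] by blast

text \<open>As for \<open>tensor_induct\<close>, negatives are absorbed into the first factor.\<close>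

lemma T_part_induct:
  assumes "A \<in> part T p"
    and pure: "\<And>x y q r. q + r = p \<Longrightarrow> x \<in> part M q \<Longrightarrow> y \<in> part N r \<Longrightarrow> P (t x y)"
    and sum: "\<And>A B. A \<in> part T p \<Longrightarrow> B \<in> part T p \<Longrightarrow> P A \<Longrightarrow> P B \<Longrightarrow> P (A \<oplus>\<^bsub>T\<^esub> B)"
  shows "P A"
proof -
  let ?G = "{t x y | x y q r. q + r = p \<and> x \<in> part M q \<and> y \<in> part N r}"
  have "A \<in> generate (F Mod R) ?G"
    using assms(1) by (simp add: T_part)
  then have "A \<in> part T p \<and> P A"
  proof induction
    case one
    have "t \<zero>\<^bsub>M\<^esub> \<zero>\<^bsub>N\<^esub> = \<zero>\<^bsub>T\<^esub>"
      by (simp add: t_zero_left)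
    then show ?case
      using pure[of p 0 "\<zero>\<^bsub>M\<^esub>" "\<zero>\<^bsub>N\<^esub>"] t_part[of "\<zero>\<^bsub>M\<^esub>" p "\<zero>\<^bsub>N\<^esub>" 0]
      by (simp add: M.Mg.deg_zero N.Mg.deg_zero T_simps(3))
  next
    case (incl h)
    then show ?case
      using pure t_part by auto
  next
    case (inv h)
    then obtain x y q r where h: "h = t x y" "q + r = p" "x \<in> part M q" "y \<in> part N r" by auto
    then have "inv\<^bsub>F Mod R\<^esub> h = t (\<ominus>\<^bsub>M\<^esub> x) y"
      by (simp add: t_neg_left M.Mg.deg_carrier N.Mg.deg_carrier T_minus)
    then show ?case
      using pure[of q r "\<ominus>\<^bsub>M\<^esub> x" y] t_part[of "\<ominus>\<^bsub>M\<^esub> x" q y r] h by (simp add: M.Mg.deg_neg)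
  next
    case (eng h1 h2)
    then show ?case
      using sum[of h1 h2] T_part_add[of h1 p h2] by (simp add: T_simps(2))
  qed
  then show ?thesis ..
qed

lemma T_part_smult:
  assumes "s \<in> spart S p" "A \<in> part T q"
  shows "s \<odot>\<^bsub>T\<^esub> A \<in> part T (p + q)"
  using assms(2)
proof (rule T_part_induct)
  fix x y q' r assume "q' + r = q" "x \<in> part M q'" "y \<in> part N r"
  then show "s \<odot>\<^bsub>T\<^esub> t x y \<in> part T (p + q)"
    using t_part[of "s \<odot>\<^bsub>M\<^esub> x" "p + q'" y r] M.smult_degree[OF assms(1), of x q']
    by (auto simp: smult_t M.Sg.deg_carrier[OF assms(1)] M.Mg.deg_carrier N.Mg.deg_carrier add.assoc)
qed (use assms in \<open>simp add: smult_T_add M.Sg.deg_carrier T_part_carrier T_part_add\<close>)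

text \<open>That the sum of the two parts is direct follows from the existence of these projections, which
  are induced by \<open>x \<otimes> y \<mapsto> x\<^sub>0 \<otimes> y\<^sub>p + x\<^sub>1 \<otimes> y\<^bsub>p+1\<^esub>\<close>.\<close>

lemma T_projection:
  obtains h where "\<And>A. A \<in> part T p \<Longrightarrow> h A = A" "\<And>A. A \<in> part T (p + 1) \<Longrightarrow> h A = \<zero>\<^bsub>T\<^esub>"
proof -
  let ?b = "\<lambda>x y. t (M.Mg.comp 0 x) (N.Mg.comp p y) \<oplus>\<^bsub>T\<^esub> t (M.Mg.comp 1 x) (N.Mg.comp (p + 1) y)"
  note cl = M.Mg.comp_closed N.Mg.comp_closed t_closed
  \<comment> \<open>one of the two summands vanishes if \<open>x\<close> is homogeneous\<close>
  have b_hom: "?b x y = t x (N.Mg.comp (p + q) y)" if "x \<in> part M q" "y \<in> carrier N" for x y q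
    using bit_cases[of q]
  proof
    assume q: "q = 0"
    have "M.Mg.comp 0 x = x" "M.Mg.comp 1 x = \<zero>\<^bsub>M\<^esub>"
      using that M.Mg.comp_same[of x 0] M.Mg.comp_other[of x 0] q by auto
    then show ?thesis
      using that by (simp add: q cl M.Mg.deg_carrier t_zero_left)
  next
    assume q: "q = 1"
    have "M.Mg.comp 1 x = x" "M.Mg.comp 0 x = \<zero>\<^bsub>M\<^esub>"
      using that M.Mg.comp_same[of x 1] M.Mg.comp_other[of x 1] q by auto
    then show ?thesis
      using that by (simp add: q cl M.Mg.deg_carrier t_zero_left)
  qed
  obtain h where h: "h \<in> carrier T \<rightarrow> carrier T"
    "\<And>A B. A \<in> carrier T \<Longrightarrow> B \<in> carrier T \<Longrightarrow> h (A \<oplus>\<^bsub>T\<^esub> B) = h A \<oplus>\<^bsub>T\<^esub> h B"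
    "\<And>x y. x \<in> carrier M \<Longrightarrow> y \<in> carrier N \<Longrightarrow> h (t x y) = ?b x y"
  proof (rule additive_lift[of T ?b])
    fix s k x q y assume s: "s \<in> spart S k" and x: "x \<in> part M q" and y: "y \<in> carrier N"
    have "?b (sgn_pow M (k * q) (s \<odot>\<^bsub>M\<^esub> x)) y = t (sgn_pow M (k * q) (s \<odot>\<^bsub>M\<^esub> x)) (N.Mg.comp (p + (k + q)) y)"
      by (intro b_hom M.Mg.deg_sgn M.smult_degree s x y)
    also have "\<dots> = t x (s \<odot>\<^bsub>N\<^esub> N.Mg.comp (p + (k + q)) y)"
      by (intro t_balanced s x cl y)
    also have "\<dots> = t x (N.Mg.comp (k + (p + (k + q))) (s \<odot>\<^bsub>N\<^esub> y))"
      by (simp only: N.comp_smult[OF s y])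
    also have "k + (p + (k + q)) = p + q"
      using bit_cases[of k] by (auto simp: add_ac)
    also have "t x (N.Mg.comp (p + q) (s \<odot>\<^bsub>N\<^esub> y)) = ?b x (s \<odot>\<^bsub>N\<^esub> y)"
      using s x y by (simp add: b_hom sgn_smult_closed)
    finally show "?b (sgn_pow M (k * q) (s \<odot>\<^bsub>M\<^esub> x)) y = ?b x (s \<odot>\<^bsub>N\<^esub> y)" .
  qed (auto simp: T.abelian_group_axioms cl M.Mg.comp_add N.Mg.comp_add t_add_left t_add_right T.a_ac)
  have "h A = A" if "A \<in> part T p" for A
    using that
  proof (rule T_part_induct)
    fix x y q r assume xy: "q + r = p" "x \<in> part M q" "y \<in> part N r"
    then have "p + q = r"
      by (metis add.commute bit_add_self(2))
    with xy show "h (t x y) = t x y"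
      using h(3)[of x y] b_hom[of x q y] by (simp add: M.Mg.deg_carrier N.Mg.deg_carrier N.Mg.comp_same)
  qed (simp add: h(2) T_part_carrier)
  moreover have "h A = \<zero>\<^bsub>T\<^esub>" if "A \<in> part T (p + 1)" for A
    using that
  proof (rule T_part_induct)
    fix x y q r assume xy: "q + r = p + 1" "x \<in> part M q" "y \<in> part N r"
    then have "p + q = r + 1"
      by (metis add.commute add.left_commute bit_add_self(2))
    with xy show "h (t x y) = \<zero>\<^bsub>T\<^esub>"
      using h(3)[of x y] b_hom[of x q y]
      by (simp add: M.Mg.deg_carrier N.Mg.deg_carrier N.Mg.comp_other t_zero_right)
  qed (simp add: h(2) T_part_carrier)
  ultimately show thesis
    using that by blast
qed

lemma t_decompose:
  assumes "x \<in> carrier M" "y \<in> carrier N"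
  shows "t x y = (t (M.Mg.comp 0 x) (N.Mg.comp 0 y) \<oplus>\<^bsub>T\<^esub> t (M.Mg.comp 1 x) (N.Mg.comp 1 y)) \<oplus>\<^bsub>T\<^esub>
    (t (M.Mg.comp 0 x) (N.Mg.comp 1 y) \<oplus>\<^bsub>T\<^esub> t (M.Mg.comp 1 x) (N.Mg.comp 0 y))"
proof -
  have "t x y = t (M.Mg.comp 0 x \<oplus>\<^bsub>M\<^esub> M.Mg.comp 1 x) (N.Mg.comp 0 y \<oplus>\<^bsub>N\<^esub> N.Mg.comp 1 y)"
    using M.Mg.comp_sum[OF assms(1), of 0] N.Mg.comp_sum[OF assms(2), of 0] by simp
  also have "\<dots> = (t (M.Mg.comp 0 x) (N.Mg.comp 0 y) \<oplus>\<^bsub>T\<^esub> t (M.Mg.comp 1 x) (N.Mg.comp 1 y)) \<oplus>\<^bsub>T\<^esub>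
    (t (M.Mg.comp 0 x) (N.Mg.comp 1 y) \<oplus>\<^bsub>T\<^esub> t (M.Mg.comp 1 x) (N.Mg.comp 0 y))"
    using assms by (simp add: t_add_left t_add_right M.Mg.comp_closed N.Mg.comp_closed t_closed T.a_ac)
  finally show ?thesis .
qed

lemma supermodule_tensor: "supermodule S T"
proof (intro supermodule.intro supermodule_axioms.intro)
  show "Z2_grading T (part T)"
  proof (rule Z2_gradingI)
    fix A assume "A \<in> part T 0" "A \<in> part T 1"
    moreover obtain h where "\<And>A. A \<in> part T 0 \<Longrightarrow> h A = A" "\<And>A. A \<in> part T (0 + 1) \<Longrightarrow> h A = \<zero>\<^bsub>T\<^esub>"
      using T_projection[of 0] by blast
    ultimately show "A = \<zero>\<^bsub>T\<^esub>"
      by fastforce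
  next
    fix A assume "A \<in> carrier T"
    then show "\<exists>a\<in>part T 0. \<exists>b\<in>part T 1. A = a \<oplus>\<^bsub>T\<^esub> b"
    proof (rule tensor_induct)
      fix x y assume xy: "x \<in> carrier M" "y \<in> carrier N"
      note d = M.Mg.comp_deg[OF xy(1)] N.Mg.comp_deg[OF xy(2)]
      show "\<exists>a\<in>part T 0. \<exists>b\<in>part T 1. t x y = a \<oplus>\<^bsub>T\<^esub> b"
        using t_decompose[OF xy] t_part[OF d(1)[of 0] d(2)[of 0]] t_part[OF d(1)[of 1] d(2)[of 1]]
          t_part[OF d(1)[of 0] d(2)[of 1]] t_part[OF d(1)[of 1] d(2)[of 0]]
        by (intro rev_bexI[OF T_part_add] rev_bexI[OF T_part_add[of _ 1]]) auto
    next
      fix A B assume AB: "\<exists>a\<in>part T 0. \<exists>b\<in>part T 1. A = a \<oplus>\<^bsub>T\<^esub> b" "\<exists>a\<in>part T 0. \<exists>b\<in>part T 1. B = a \<oplus>\<^bsub>T\<^esub> b"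
      then obtain a b a' b' where ab: "a \<in> part T 0" "b \<in> part T 1" "A = a \<oplus>\<^bsub>T\<^esub> b"
        "a' \<in> part T 0" "b' \<in> part T 1" "B = a' \<oplus>\<^bsub>T\<^esub> b'" by blast
      then have "A \<oplus>\<^bsub>T\<^esub> B = (a \<oplus>\<^bsub>T\<^esub> a') \<oplus>\<^bsub>T\<^esub> (b \<oplus>\<^bsub>T\<^esub> b')"
        by (simp add: T_part_carrier T.a_ac)
      then show "\<exists>a\<in>part T 0. \<exists>b\<in>part T 1. A \<oplus>\<^bsub>T\<^esub> B = a \<oplus>\<^bsub>T\<^esub> b"
        using ab T_part_add by blast
    qed
  qed (simp_all add: T.abelian_group_axioms T_part_subgroup)
next
  fix s r A assume sr: "s \<in> carrier S" "r \<in> carrier S" and A: "A \<in> carrier T"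
  show "(s \<oplus>\<^bsub>S\<^esub> r) \<odot>\<^bsub>T\<^esub> A = s \<odot>\<^bsub>T\<^esub> A \<oplus>\<^bsub>T\<^esub> r \<odot>\<^bsub>T\<^esub> A"
    using A by (rule tensor_induct)
      (use sr in \<open>simp_all add: smult_t M.smult_l_distr M.smult_closed t_add_left smult_T_add smult_T_closed T.a_ac\<close>)
  show "(s \<otimes>\<^bsub>S\<^esub> r) \<odot>\<^bsub>T\<^esub> A = s \<odot>\<^bsub>T\<^esub> (r \<odot>\<^bsub>T\<^esub> A)"
    using A by (rule tensor_induct)
      (use sr in \<open>simp_all add: smult_t M.smult_assoc M.smult_closed smult_T_add smult_T_closed\<close>)
next
  fix A assume A: "A \<in> carrier T"
  show "\<one>\<^bsub>S\<^esub> \<odot>\<^bsub>T\<^esub> A = A"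
    using A by (rule tensor_induct) (simp_all add: smult_t M.smult_one smult_T_add)
qed (simp_all add: M.superring T.abelian_group_axioms smult_T_closed smult_T_add T_part_smult)

lemma tensor_lift:
  assumes P: "supermodule S P" and b: "smod_bilinear S M N P b"
    and deg: "\<And>x y p q. x \<in> part M p \<Longrightarrow> y \<in> part N q \<Longrightarrow> b x y \<in> part P (p + q)"
  shows "\<exists>h\<in>smod_hom S T P. \<forall>x\<in>carrier M. \<forall>y\<in>carrier N. h (t x y) = b x y"
proof -
  interpret P: supermodule S P by fact
  obtain h where h: "h \<in> carrier T \<rightarrow> carrier P"
    "\<And>A B. A \<in> carrier T \<Longrightarrow> B \<in> carrier T \<Longrightarrow> h (A \<oplus>\<^bsub>T\<^esub> B) = h A \<oplus>\<^bsub>P\<^esub> h B"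
    "\<And>x y. x \<in> carrier M \<Longrightarrow> y \<in> carrier N \<Longrightarrow> h (t x y) = b x y"
    by (rule additive_lift[of P b]) (use b P.M.abelian_group_axioms in \<open>auto simp: smod_bilinear_def\<close>)
  have "h \<in> smod_hom S T P"
  proof (rule smod_homI)
    fix s A assume s: "s \<in> carrier S" and "A \<in> carrier T"
    from this(2) show "h (s \<odot>\<^bsub>T\<^esub> A) = s \<odot>\<^bsub>P\<^esub> h A"
    proof (rule tensor_induct)
      fix x y assume "x \<in> carrier M" "y \<in> carrier N"
      then show "h (s \<odot>\<^bsub>T\<^esub> t x y) = s \<odot>\<^bsub>P\<^esub> h (t x y)"
        using b s by (simp add: smult_t h(3) M.smult_closed smod_bilinear_def)
    qed (use s h(1) in \<open>simp add: smult_T_add h(2) smult_T_closed P.smult_r_distr Pi_def\<close>)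
  next
    fix A p assume "A \<in> part T p"
    then show "h A \<in> part P p"
      by (rule T_part_induct)
        (auto simp: h(2,3) M.Mg.deg_carrier N.Mg.deg_carrier T_part_carrier deg P.Mg.deg_add)
  qed (use h in auto)
  with h(3) show ?thesis by blast
qed

lemma t_bilinear: "smod_bilinear S M N T t"
  by (simp add: smod_bilinear_def t_closed t_add_left t_add_right smult_t t_balanced)

end

section \<open>Lie pairings and the universal property of uce\<close>

lemma lie_homI:
  assumes "h \<in> smod_hom S K L"
    and "\<And>x y. x \<in> carrier K \<Longrightarrow> y \<in> carrier K \<Longrightarrow> h (bracket K x y) = bracket L (h x) (h y)"
  shows "h \<in> lie_hom S K L"
  using assms by (simp add: lie_hom_def)

lemma lie_homD:
  assumes "h \<in> lie_hom S K L"
  shows "h \<in> smod_hom S K L"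
    "x \<in> carrier K \<Longrightarrow> y \<in> carrier K \<Longrightarrow> h (bracket K x y) = bracket L (h x) (h y)"
  using assms by (simp_all add: lie_hom_def)

lemma lie_hom_comp:
  "h \<in> lie_hom S K L \<Longrightarrow> g \<in> lie_hom S L M \<Longrightarrow> (\<lambda>x. g (h x)) \<in> lie_hom S K M"
  by (rule lie_homI)
    (auto simp: lie_homD(2) smod_homD(1)[OF lie_homD(1)] intro: smod_hom_comp lie_homD(1))

lemma smod_bilinearD:
  assumes "smod_bilinear S M N P b"
  shows "x \<in> carrier M \<Longrightarrow> y \<in> carrier N \<Longrightarrow> b x y \<in> carrier P"
    "x \<in> carrier M \<Longrightarrow> x' \<in> carrier M \<Longrightarrow> y \<in> carrier N \<Longrightarrow> b (x \<oplus>\<^bsub>M\<^esub> x') y = b x y \<oplus>\<^bsub>P\<^esub> b x' y"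
    "x \<in> carrier M \<Longrightarrow> y \<in> carrier N \<Longrightarrow> y' \<in> carrier N \<Longrightarrow> b x (y \<oplus>\<^bsub>N\<^esub> y') = b x y \<oplus>\<^bsub>P\<^esub> b x y'"
    "s \<in> carrier S \<Longrightarrow> x \<in> carrier M \<Longrightarrow> y \<in> carrier N \<Longrightarrow> b (s \<odot>\<^bsub>M\<^esub> x) y = s \<odot>\<^bsub>P\<^esub> b x y"
    "s \<in> spart S p \<Longrightarrow> x \<in> part M q \<Longrightarrow> y \<in> carrier N \<Longrightarrow>
      b (sgn_pow M (p * q) (s \<odot>\<^bsub>M\<^esub> x)) y = b x (s \<odot>\<^bsub>N\<^esub> y)"
  using assms unfolding smod_bilinear_def by blast+

text \<open>The left-hand side of the Jacobi identity, with \<open>b\<close> in place of the outer brackets.\<close>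

abbreviation jacobiator where
  "jacobiator P L b p q r x y z \<equiv>
    sgn_pow P (p * r) (b x (bracket L y z)) \<oplus>\<^bsub>P\<^esub>
    sgn_pow P (q * p) (b y (bracket L z x)) \<oplus>\<^bsub>P\<^esub>
    sgn_pow P (r * q) (b z (bracket L x y))"

text \<open>Besides bilinearity and degree \<open>0\<close>, the conditions are the relations that define \<open>uce L\<close>.  The
  bracket of \<open>L\<close> is an instance, and so is \<open>(x, y) \<mapsto> \<langle>x, y\<rangle>\<close>.\<close>

definition lie_pairing ::
  "'s superring \<Rightarrow> ('s, 'a) lie_superalgebra \<Rightarrow> ('s, 'b, 'm) supermodule_scheme \<Rightarrow> ('a \<Rightarrow> 'a \<Rightarrow> 'b) \<Rightarrow> bool"
where
  "lie_pairing S L P b \<longleftrightarrow> smod_bilinear S L L P b \<and>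
    (\<forall>p q. \<forall>x\<in>part L p. \<forall>y\<in>part L q. b x y \<in> part P (p + q)) \<and>
    (\<forall>p q. \<forall>x\<in>part L p. \<forall>y\<in>part L q. b x y \<oplus>\<^bsub>P\<^esub> sgn_pow P (p * q) (b y x) = \<zero>\<^bsub>P\<^esub>) \<and>
    (\<forall>x\<in>part L 0. b x x = \<zero>\<^bsub>P\<^esub>) \<and>
    (\<forall>p q r. \<forall>x\<in>part L p. \<forall>y\<in>part L q. \<forall>z\<in>part L r.
      jacobiator P L b p q r x y z = \<zero>\<^bsub>P\<^esub>)"

lemma lie_pairingD:
  assumes "lie_pairing S L P b"
  shows "smod_bilinear S L L P b"
    "x \<in> part L p \<Longrightarrow> y \<in> part L q \<Longrightarrow> b x y \<in> part P (p + q)"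
    "x \<in> part L p \<Longrightarrow> y \<in> part L q \<Longrightarrow> b x y \<oplus>\<^bsub>P\<^esub> sgn_pow P (p * q) (b y x) = \<zero>\<^bsub>P\<^esub>"
    "x \<in> part L 0 \<Longrightarrow> b x x = \<zero>\<^bsub>P\<^esub>"
    "x \<in> part L p \<Longrightarrow> y \<in> part L q \<Longrightarrow> z \<in> part L r \<Longrightarrow>
      jacobiator P L b p q r x y z = \<zero>\<^bsub>P\<^esub>"
  using assms unfolding lie_pairing_def by blast+

locale lie_morphism = K: lie_superalgebra S K + L: lie_superalgebra S L
  for S :: "'s superring" and K :: "('s, 'a) lie_superalgebra" and L :: "('s, 'b) lie_superalgebra" +
  fixes f assumes lie_hom: "f \<in> lie_hom S K L"
begin

sublocale smod_morphism S K L f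
  by unfold_locales (rule lie_homD(1)[OF lie_hom])

lemmas hom_bracket = lie_homD(2)[OF lie_hom]

end

lemma lie_morphismI:
  "lie_superalgebra S K \<Longrightarrow> lie_superalgebra S L \<Longrightarrow> f \<in> lie_hom S K L \<Longrightarrow> lie_morphism S K L f"
  by (simp add: lie_morphism_def lie_morphism_axioms_def)

lemma lie_superalgebraI:
  assumes "supermodule S L" "lie_pairing S L L (bracket L)"
  shows "lie_superalgebra S L"
  using assms by (intro lie_superalgebra.intro lie_superalgebra_axioms.intro) (simp_all add: lie_pairingD)

context lie_superalgebra
begin

lemma lie_superalgebra: "lie_superalgebra S L" ..

lemmas bracket_closed = smod_bilinearD(1)[OF bracket_bilinear]

lemma bracket_pairing: "lie_pairing S L L (bracket L)"
  by (simp add: lie_pairing_def bracket_bilinear bracket_degree bracket_antisym bracket_even_self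
      bracket_jacobi)

lemma lie_pairing_cong:
  assumes b: "lie_pairing S L P b" and eq: "\<And>x y. x \<in> carrier L \<Longrightarrow> y \<in> carrier L \<Longrightarrow> b' x y = b x y"
  shows "lie_pairing S L P b'"
proof -
  have "smod_bilinear S L L P b'"
    using lie_pairingD(1)[OF b] unfolding smod_bilinear_def
    by (simp add: eq smult_closed Mg.deg_carrier Mg.sgn_closed Sg.deg_carrier)
  then show ?thesis
    using b unfolding lie_pairing_def by (simp add: eq Mg.deg_carrier bracket_closed)
qed

lemma lie_pairing_image:
  assumes b: "lie_pairing S L P b" and P: "supermodule S P" and Q: "supermodule S Q"
    and h: "h \<in> smod_hom S P Q"
  shows "lie_pairing S L Q (\<lambda>x y. h (b x y))"
proof -
  interpret h: smod_morphism S P Q h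
    using P Q h by (simp add: smod_morphism_def smod_morphism_axioms_def)
  note B = smod_bilinearD[OF lie_pairingD(1)[OF b]]
  note bc = B(1) h.M.Mg.sgn_closed Mg.deg_carrier bracket_closed
  show ?thesis
    unfolding lie_pairing_def
  proof (intro conjI allI ballI)
    show "smod_bilinear S L L Q (\<lambda>x y. h (b x y))"
      unfolding smod_bilinear_def by (auto simp: B h.hom_closed h.hom_add h.hom_smult)
  next
    fix p q x y assume "x \<in> part L p" "y \<in> part L q"
    then show "h (b x y) \<in> part Q (p + q)"
      by (intro h.hom_part lie_pairingD(2)[OF b])
  next
    fix p q x y assume xy: "x \<in> part L p" "y \<in> part L q"
    then show "h (b x y) \<oplus>\<^bsub>Q\<^esub> sgn_pow Q (p * q) (h (b y x)) = \<zero>\<^bsub>Q\<^esub>"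
      using arg_cong[OF lie_pairingD(3)[OF b xy], of h]
      by (simp add: h.hom_add h.hom_sgn h.hom_zero bc)
  next
    fix x assume "x \<in> part L 0"
    then show "h (b x x) = \<zero>\<^bsub>Q\<^esub>"
      by (simp add: lie_pairingD(4)[OF b] h.hom_zero)
  next
    fix p q r x y z assume xyz: "x \<in> part L p" "y \<in> part L q" "z \<in> part L r"
    then show "jacobiator Q L (\<lambda>x y. h (b x y)) p q r x y z = \<zero>\<^bsub>Q\<^esub>"
      using arg_cong[OF lie_pairingD(5)[OF b xyz], of h]
      by (simp add: h.hom_add h.hom_sgn h.hom_zero bc)
  qed
qed

end

lemma (in lie_morphism) lie_pairing_pullback:
  assumes b: "lie_pairing S L P b"
  shows "lie_pairing S K P (\<lambda>x y. b (f x) (f y))"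
proof -
  note B = smod_bilinearD[OF lie_pairingD(1)[OF b]]
  note c = K.Mg.deg_carrier K.Sg.deg_carrier K.bracket_closed
  show ?thesis
    unfolding lie_pairing_def
  proof (intro conjI allI ballI)
    show "smod_bilinear S K K P (\<lambda>x y. b (f x) (f y))"
      unfolding smod_bilinear_def
      by (auto simp: B hom_closed hom_add hom_smult hom_sgn hom_part c K.smult_closed)
  qed (use lie_pairingD[OF b] in \<open>auto simp: hom_bracket hom_part c\<close>)
qed

text \<open>Each condition on a pairing involves at most three elements, so that it can be checked on
  algebras \<open>K i\<close> mapping to \<open>L\<close> if any three elements of \<open>L\<close> come from one of them.  A preimage of a
  homogeneous element can be chosen homogeneous by passing to a component.  This is used for a
  surjection onto \<open>L\<close> and for the canonical maps into a direct limit.\<close>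

lemma lie_pairing_cover:
  assumes L: "supermodule S L"
    and K: "\<And>i. i \<in> I \<Longrightarrow> lie_superalgebra S (K i)"
    and f: "\<And>i. i \<in> I \<Longrightarrow> f i \<in> lie_hom S (K i) L"
    and cover: "\<And>x y z. x \<in> carrier L \<Longrightarrow> y \<in> carrier L \<Longrightarrow> z \<in> carrier L \<Longrightarrow>
      \<exists>i\<in>I. x \<in> f i ` carrier (K i) \<and> y \<in> f i ` carrier (K i) \<and> z \<in> f i ` carrier (K i)"
    and b': "\<And>i. i \<in> I \<Longrightarrow> lie_pairing S (K i) P (b' i)"
    and b: "\<And>i x y. i \<in> I \<Longrightarrow> x \<in> carrier (K i) \<Longrightarrow> y \<in> carrier (K i) \<Longrightarrow> b (f i x) (f i y) = b' i x y"
  shows "lie_pairing S L P b"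
proof -
  interpret L: supermodule S L by fact
  have mor: "smod_morphism S (K i) L (f i)" if "i \<in> I" for i
    using that L lie_superalgebra.axioms(1)[OF K] lie_homD(1)[OF f]
    by (simp add: smod_morphism_def smod_morphism_axioms_def)
  have hlift: "\<exists>c\<in>part (K i) p. x = f i c" if i: "i \<in> I" and x: "x \<in> part L p" "x \<in> f i ` carrier (K i)" for i x p
  proof -
    interpret smod_morphism S "K i" L "f i" by (rule mor) fact
    obtain c where "c \<in> carrier (K i)" "x = f i c" using x(2) by auto
    then show ?thesis
      using hom_comp[of c p] M.Mg.comp_deg[of c p] L.Mg.comp_same[OF x(1)]
      by (intro bexI[of _ "M.Mg.comp p c"]) simp_all
  qed
  have lift3: "\<exists>i\<in>I. \<exists>a\<in>part (K i) p. \<exists>c\<in>part (K i) q. \<exists>d\<in>part (K i) r. x = f i a \<and> y = f i c \<and> z = f i d"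
    if xyz: "x \<in> part L p" "y \<in> part L q" "z \<in> part L r" for x y z p q r
  proof -
    obtain i where "i \<in> I" "x \<in> f i ` carrier (K i)" "y \<in> f i ` carrier (K i)" "z \<in> f i ` carrier (K i)"
      using cover xyz L.Mg.deg_carrier by meson
    then show ?thesis
      using hlift xyz by meson
  qed
  show ?thesis
    unfolding lie_pairing_def
  proof (intro conjI allI ballI)
    show "smod_bilinear S L L P b"
      unfolding smod_bilinear_def
    proof (intro conjI allI ballI)
      fix x y assume "x \<in> carrier L" "y \<in> carrier L"
      then obtain i a c where i: "i \<in> I" and a: "a \<in> carrier (K i)" "x = f i a" and c: "c \<in> carrier (K i)" "y = f i c"
        using cover[of x y y] by auto
      interpret smod_morphism S "K i" L "f i" by (rule mor) fact
      note B = smod_bilinearD[OF lie_pairingD(1)[OF b'[OF i]]]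
      show "b x y \<in> carrier P"
        by (simp add: a c b i B)
      show "b (s \<odot>\<^bsub>L\<^esub> x) y = s \<odot>\<^bsub>P\<^esub> b x y" if "s \<in> carrier S" for s
        using a c b[OF i, of "s \<odot>\<^bsub>K i\<^esub> a" c] b[OF i, of a c] that by (simp add: B hom_smult M.smult_closed)
    next
      fix x x' y assume "x \<in> carrier L" "x' \<in> carrier L" "y \<in> carrier L"
      then obtain i a a' c where i: "i \<in> I" and a: "a \<in> carrier (K i)" "x = f i a"
        "a' \<in> carrier (K i)" "x' = f i a'" and c: "c \<in> carrier (K i)" "y = f i c"
        using cover[of x x' y] by auto
      interpret smod_morphism S "K i" L "f i" by (rule mor) fact
      note B = smod_bilinearD[OF lie_pairingD(1)[OF b'[OF i]]]
      show "b (x \<oplus>\<^bsub>L\<^esub> x') y = b x y \<oplus>\<^bsub>P\<^esub> b x' y"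
        using a c b[OF i, of "a \<oplus>\<^bsub>K i\<^esub> a'" c] b[OF i] by (simp add: B hom_add)
      show "b y (x \<oplus>\<^bsub>L\<^esub> x') = b y x \<oplus>\<^bsub>P\<^esub> b y x'"
        using a c b[OF i, of c "a \<oplus>\<^bsub>K i\<^esub> a'"] b[OF i] by (simp add: B hom_add)
    next
      fix p q s x y assume s: "s \<in> spart S p" and x: "x \<in> part L q" and y: "y \<in> carrier L"
      obtain i where i: "i \<in> I" "x \<in> f i ` carrier (K i)" "y \<in> f i ` carrier (K i)"
        using cover[of x y y] x y L.Mg.deg_carrier by auto
      then obtain a c where a: "a \<in> part (K i) q" "x = f i a" and c: "c \<in> carrier (K i)" "y = f i c"
        using hlift[OF i(1) x] by auto
      interpret smod_morphism S "K i" L "f i" by (rule mor) fact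
      note cl = M.Mg.deg_carrier[OF a(1)] L.Sg.deg_carrier[OF s]
      show "b (sgn_pow L (p * q) (s \<odot>\<^bsub>L\<^esub> x)) y = b x (s \<odot>\<^bsub>L\<^esub> y)"
        using a c b[OF i(1), of "sgn_pow (K i) (p * q) (s \<odot>\<^bsub>K i\<^esub> a)" c] b[OF i(1), of a "s \<odot>\<^bsub>K i\<^esub> c"]
          smod_bilinearD(5)[OF lie_pairingD(1)[OF b'[OF i(1)]] s a(1) c(1)]
        by (simp add: cl hom_smult hom_sgn M.smult_closed M.Mg.sgn_closed)
    qed
  next
    fix p q x y assume "x \<in> part L p" "y \<in> part L q"
    then obtain i a c where i: "i \<in> I" and a: "a \<in> part (K i) p" "x = f i a" and c: "c \<in> part (K i) q" "y = f i c"
      using lift3[of x p y q y q] by auto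
    interpret smod_morphism S "K i" L "f i" by (rule mor) fact
    show "b x y \<in> part P (p + q)" "b x y \<oplus>\<^bsub>P\<^esub> sgn_pow P (p * q) (b y x) = \<zero>\<^bsub>P\<^esub>"
      using a c by (simp_all add: b i M.Mg.deg_carrier lie_pairingD(2,3)[OF b'[OF i]])
  next
    fix x assume "x \<in> part L 0"
    then obtain i a where i: "i \<in> I" and a: "a \<in> part (K i) 0" "x = f i a"
      using lift3[of x 0 x 0 x 0] by auto
    interpret smod_morphism S "K i" L "f i" by (rule mor) fact
    show "b x x = \<zero>\<^bsub>P\<^esub>"
      using a by (simp_all add: b i M.Mg.deg_carrier lie_pairingD(4)[OF b'[OF i]])
  next
    fix p q r x y z assume "x \<in> part L p" "y \<in> part L q" "z \<in> part L r"
    then obtain i a c d where i: "i \<in> I" and a: "a \<in> part (K i) p" "x = f i a"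
      and c: "c \<in> part (K i) q" "y = f i c" and d: "d \<in> part (K i) r" "z = f i d"
      using lift3[of x p y q z r] by auto
    interpret smod_morphism S "K i" L "f i" by (rule mor) fact
    note cl = M.Mg.deg_carrier[OF a(1)] M.Mg.deg_carrier[OF c(1)] M.Mg.deg_carrier[OF d(1)]
    show "jacobiator P L b p q r x y z = \<zero>\<^bsub>P\<^esub>"
      using lie_pairingD(5)[OF b'[OF i] a(1) c(1) d(1)] cl
      by (simp add: a c d b[OF i] lie_superalgebra.bracket_closed[OF K[OF i]] flip: lie_homD(2)[OF f[OF i]])
  qed
qed

subsection \<open>The module uce\<close>

context lie_superalgebra
begin

sublocale TP: tensor_pair S L L ..

sublocale Tm: supermodule S "tensor S L L"
  by (rule TP.supermodule_tensor)

abbreviation "TT \<equiv> tensor S L L"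
abbreviation "tt \<equiv> tensor_elem S L L"

definition uce_gens where
  "uce_gens = {tt x y \<oplus>\<^bsub>TT\<^esub> sgn_pow TT (p * q) (tt y x) | x y p q. x \<in> part L p \<and> y \<in> part L q} \<union>
     {tt x x | x. x \<in> part L 0} \<union>
     {jacobiator TT L tt p q r x y z | x y z p q r.
        x \<in> part L p \<and> y \<in> part L q \<and> z \<in> part L r}"

lemma uce_rel_eq: "uce_rel S L = smod_span S TT uce_gens"
  by (simp add: uce_rel_def uce_gens_def Let_def)

lemma uce_gens_homogeneous: "A \<in> uce_gens \<Longrightarrow> \<exists>p. A \<in> part TT p"
  unfolding uce_gens_def
proof (elim UnE CollectE exE conjE)
  fix x y p q assume A: "A = tt x y \<oplus>\<^bsub>TT\<^esub> sgn_pow TT (p * q) (tt y x)" and xy: "x \<in> part L p" "y \<in> part L q"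
  have 1: "tt y x \<in> part TT (p + q)"
    using TP.t_part[OF xy(2,1)] by (simp add: add.commute)
  show "\<exists>p. A \<in> part TT p"
    unfolding A by (intro exI[of _ "p + q"] Tm.Mg.deg_add Tm.Mg.deg_sgn TP.t_part xy 1)
next
  fix x assume "A = tt x x" "x \<in> part L 0"
  then show "\<exists>p. A \<in> part TT p"
    using TP.t_part by blast
next
  fix x y z p q r
  assume A: "A = jacobiator TT L tt p q r x y z"
    and x: "x \<in> part L p" and y: "y \<in> part L q" and z: "z \<in> part L r"
  have 1: "tt x (bracket L y z) \<in> part TT (p + q + r)"
    using TP.t_part[OF x bracket_degree[OF y z]] by (simp add: add_ac)
  have 2: "tt y (bracket L z x) \<in> part TT (p + q + r)"
    using TP.t_part[OF y bracket_degree[OF z x]] by (simp add: add_ac)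
  have 3: "tt z (bracket L x y) \<in> part TT (p + q + r)"
    using TP.t_part[OF z bracket_degree[OF x y]] by (simp add: add_ac)
  show "\<exists>p. A \<in> part TT p"
    unfolding A by (intro exI[of _ "p + q + r"] Tm.Mg.deg_add Tm.Mg.deg_sgn 1 2 3)
qed

lemma uce_rel_submodule: "submodule (uce_rel S L) S TT"
  unfolding uce_rel_eq
proof (rule Tm.smod_span_submodule)
  show "uce_gens \<subseteq> carrier TT"
  proof
    fix A assume "A \<in> uce_gens"
    then obtain p where "A \<in> part TT p" using uce_gens_homogeneous by blast
    then show "A \<in> carrier TT" by (rule Tm.Mg.deg_carrier)
  qed
qed

lemma uce_gens_rel: "A \<in> uce_gens \<Longrightarrow> A \<in> uce_rel S L"
  unfolding uce_rel_eq using Tm.smod_span_incl by blast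

text \<open>The relations are generated by homogeneous elements, so that their span is graded.\<close>

lemma uce_rel_comp:
  assumes "A \<in> uce_rel S L" shows "Tm.Mg.comp p A \<in> uce_rel S L"
proof -
  note D = Tm.submoduleD[OF uce_rel_submodule]
  let ?K = "{A \<in> uce_rel S L. \<forall>p. Tm.Mg.comp p A \<in> uce_rel S L}"
  have "submodule ?K S TT"
  proof (rule Tm.submoduleI)
    show "\<zero>\<^bsub>TT\<^esub> \<in> ?K"
      using D(2) Tm.Mg.comp_same[OF Tm.Mg.deg_zero] by simp
  next
    fix A B assume "A \<in> ?K" "B \<in> ?K"
    then show "A \<oplus>\<^bsub>TT\<^esub> B \<in> ?K"
      using D(1,3) by (simp add: Tm.Mg.comp_add)
  next
    fix s A assume s: "s \<in> carrier S" and A: "A \<in> ?K"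
    have "s \<odot>\<^bsub>TT\<^esub> A \<in> ?K \<and> s \<in> carrier S"
      using s
    proof (rule Sg.homogeneous_induct)
      fix q s assume s: "s \<in> spart S q"
      have "Tm.Mg.comp p (s \<odot>\<^bsub>TT\<^esub> A) \<in> uce_rel S L" for p
      proof -
        have "Tm.Mg.comp (q + (q + p)) (s \<odot>\<^bsub>TT\<^esub> A) = s \<odot>\<^bsub>TT\<^esub> Tm.Mg.comp (q + p) A"
          using s A D(1) by (intro Tm.comp_smult) auto
        then show ?thesis
          using A D(4) Sg.deg_carrier[OF s] by simp
      qed
      then show "s \<odot>\<^bsub>TT\<^esub> A \<in> ?K \<and> s \<in> carrier S"
        using s A D(4) Sg.deg_carrier by simp
    next
      fix s r assume "s \<odot>\<^bsub>TT\<^esub> A \<in> ?K \<and> s \<in> carrier S" "r \<odot>\<^bsub>TT\<^esub> A \<in> ?K \<and> r \<in> carrier S"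
      then show "(s \<oplus> r) \<odot>\<^bsub>TT\<^esub> A \<in> ?K \<and> s \<oplus> r \<in> carrier S"
        using A D(1,3) by (simp add: Tm.smult_l_distr Tm.Mg.comp_add)
    qed
    then show "s \<odot>\<^bsub>TT\<^esub> A \<in> ?K" by simp
  qed (use D(1) in auto)
  moreover have "uce_gens \<subseteq> ?K"
  proof
    fix A assume A: "A \<in> uce_gens"
    then obtain q where q: "A \<in> part TT q" using uce_gens_homogeneous by blast
    have "Tm.Mg.comp p A \<in> uce_rel S L" for p
    proof (cases "p = q")
      case True
      then show ?thesis
        using q uce_gens_rel[OF A] by (simp add: Tm.Mg.comp_same)
    next
      case False
      then have "p = q + 1"
        using bit_cases[of p] bit_cases[of q] by auto
      then show ?thesis
        using q D(2) by (simp add: Tm.Mg.comp_other)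
    qed
    then show "A \<in> ?K"
      using uce_gens_rel[OF A] by simp
  qed
  ultimately have "uce_rel S L \<subseteq> ?K"
    by (subst uce_rel_eq) (rule Tm.smod_span_least)
  then show ?thesis
    using assms by blast
qed

sublocale UQ: graded_submodule S "tensor S L L" "uce_rel S L"
  by (intro graded_submodule.intro graded_submodule_axioms.intro Tm.supermodule uce_rel_submodule
      uce_rel_comp)

abbreviation "U \<equiv> uce_module S L"
abbreviation "e \<equiv> uce_elem S L"

lemma U_eq: "U = smod_quotient TT (uce_rel S L)"
  by (simp add: uce_module_def)

lemma e_eq: "e x y = uce_rel S L +>\<^bsub>TT\<^esub> tt x y"
  by (simp add: uce_elem_def)

sublocale Um: supermodule S "uce_module S L"
  unfolding U_eq by (rule UQ.supermodule_quotient)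

lemma class_hom: "(\<lambda>A. uce_rel S L +>\<^bsub>TT\<^esub> A) \<in> smod_hom S TT U"
  by (rule smod_homI) (auto simp: U_eq UQ.quotient_carrier UQ.quotient_add UQ.quotient_smult UQ.quotient_part)

lemma uce_module_induct:
  assumes "u \<in> carrier U"
    and pure: "\<And>x y. x \<in> carrier L \<Longrightarrow> y \<in> carrier L \<Longrightarrow> P (e x y)"
    and sum: "\<And>u v. u \<in> carrier U \<Longrightarrow> v \<in> carrier U \<Longrightarrow> P u \<Longrightarrow> P v \<Longrightarrow> P (u \<oplus>\<^bsub>U\<^esub> v)"
  shows "P u"
proof -
  obtain A where A: "A \<in> carrier TT" "u = uce_rel S L +>\<^bsub>TT\<^esub> A"
    using assms(1) by (auto simp: U_eq UQ.quotient_carrier)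
  from A(1) have "P (uce_rel S L +>\<^bsub>TT\<^esub> A)"
  proof (rule TP.tensor_induct)
    fix A B assume "A \<in> carrier TT" "B \<in> carrier TT" "P (uce_rel S L +>\<^bsub>TT\<^esub> A)" "P (uce_rel S L +>\<^bsub>TT\<^esub> B)"
    then show "P (uce_rel S L +>\<^bsub>TT\<^esub> (A \<oplus>\<^bsub>TT\<^esub> B))"
      using sum smod_homD(1,2)[OF class_hom] by simp
  qed (use pure in \<open>simp add: e_eq\<close>)
  then show ?thesis
    by (simp add: A)
qed

text \<open>Pairings are the homomorphisms on \<open>L \<otimes> L\<close> that kill the relations.  The direction from left to
  right shows that \<open>\<langle>x, y\<rangle>\<close> is a pairing, the other one that pairings factor over \<open>uce L\<close>.\<close>

lemma uce_gens_kernel_iff: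
  assumes P: "supermodule S P" and h: "h \<in> smod_hom S TT P"
  shows "(\<forall>A\<in>uce_gens. h A = \<zero>\<^bsub>P\<^esub>) \<longleftrightarrow> lie_pairing S L P (\<lambda>x y. h (tt x y))"
proof -
  interpret h: smod_morphism S TT P h
    using P h Tm.supermodule by (simp add: smod_morphism_def smod_morphism_axioms_def)
  note B = smod_bilinearD[OF TP.t_bilinear]
  note cl = TP.t_closed Tm.Mg.sgn_closed Mg.deg_carrier bracket_closed
  have bil: "smod_bilinear S L L P (\<lambda>x y. h (tt x y))"
    unfolding smod_bilinear_def by (auto simp: B h.hom_closed h.hom_add h.hom_smult)
  have deg: "h (tt x y) \<in> part P (p + q)" if "x \<in> part L p" "y \<in> part L q" for x y p q
    using that by (intro h.hom_part TP.t_part)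
  have anti: "h (tt x y \<oplus>\<^bsub>TT\<^esub> sgn_pow TT (p * q) (tt y x)) = h (tt x y) \<oplus>\<^bsub>P\<^esub> sgn_pow P (p * q) (h (tt y x))"
    if "x \<in> part L p" "y \<in> part L q" for x y p q
    using that by (simp add: h.hom_add h.hom_sgn cl)
  have jac: "h (jacobiator TT L tt p q r x y z) = jacobiator P L (\<lambda>x y. h (tt x y)) p q r x y z"
    if "x \<in> part L p" "y \<in> part L q" "z \<in> part L r" for x y z p q r
    using that by (simp add: h.hom_add h.hom_sgn cl)
  have "(\<forall>A\<in>uce_gens. h A = \<zero>\<^bsub>P\<^esub>) \<longleftrightarrow>
    (\<forall>p q. \<forall>x\<in>part L p. \<forall>y\<in>part L q. h (tt x y \<oplus>\<^bsub>TT\<^esub> sgn_pow TT (p * q) (tt y x)) = \<zero>\<^bsub>P\<^esub>) \<and>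
    (\<forall>x\<in>part L 0. h (tt x x) = \<zero>\<^bsub>P\<^esub>) \<and>
    (\<forall>p q r. \<forall>x\<in>part L p. \<forall>y\<in>part L q. \<forall>z\<in>part L r. h (jacobiator TT L tt p q r x y z) = \<zero>\<^bsub>P\<^esub>)"
    unfolding uce_gens_def by blast
  then show ?thesis
    unfolding lie_pairing_def using bil deg by (simp add: anti jac)
qed

lemma e_pairing: "lie_pairing S L U e"
proof -
  have "uce_rel S L +>\<^bsub>TT\<^esub> A = \<zero>\<^bsub>U\<^esub>" if "A \<in> uce_gens" for A
    using that UQ.class_zero[of A] uce_gens_rel UQ.N_carrier by (simp add: U_eq UQ.quotient_zero)
  then show ?thesis
    using uce_gens_kernel_iff[OF Um.supermodule class_hom] by (simp add: e_eq[abs_def])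
qed

lemma uce_module_lift:
  assumes P: "supermodule S P" and b: "lie_pairing S L P b"
  shows "\<exists>h\<in>smod_hom S U P. \<forall>x\<in>carrier L. \<forall>y\<in>carrier L. h (e x y) = b x y"
proof -
  obtain h where h: "h \<in> smod_hom S TT P" "\<And>x y. x \<in> carrier L \<Longrightarrow> y \<in> carrier L \<Longrightarrow> h (tt x y) = b x y"
    using TP.tensor_lift[OF P lie_pairingD(1)[OF b] lie_pairingD(2)[OF b]] by blast
  interpret h: smod_morphism S TT P h
    using P h(1) Tm.supermodule by (simp add: smod_morphism_def smod_morphism_axioms_def)
  have "lie_pairing S L P (\<lambda>x y. h (tt x y))"
    by (rule lie_pairing_cong[OF b h(2)])
  then have "uce_gens \<subseteq> a_kernel TT P h"
    using uce_gens_kernel_iff[OF P h(1)] uce_gens_rel UQ.N_carrier by (auto simp: h.kernel_eq)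
  then have "uce_rel S L \<subseteq> a_kernel TT P h"
    unfolding uce_rel_eq by (rule Tm.smod_span_least[OF h.kernel_submodule])
  then have "\<exists>g\<in>smod_hom S (smod_quotient TT (uce_rel S L)) P. \<forall>A\<in>carrier TT. g (uce_rel S L +>\<^bsub>TT\<^esub> A) = h A"
    by (intro UQ.quotient_factor[OF P h(1)]) (auto simp: h.kernel_eq)
  then show ?thesis
    using h(2) unfolding U_eq e_eq by (metis TP.t_closed)
qed

end

section \<open>The Lie superalgebra uce\<close>

lemma uce_simps:
  "carrier (uce S L) = carrier (uce_module S L)" "add (uce S L) = add (uce_module S L)"
  "\<zero>\<^bsub>uce S L\<^esub> = \<zero>\<^bsub>uce_module S L\<^esub>" "smult (uce S L) = smult (uce_module S L)"
  "part (uce S L) = part (uce_module S L)" "bracket (uce S L) = uce_bracket S L"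
  by (simp_all add: uce_def supermodule.defs lie_superalgebra.defs)

lemma sgn_pow_uce: "sgn_pow (uce S L) k u = sgn_pow (uce_module S L) k u"
  by (simp add: sgn_pow_def a_inv_def m_inv_def uce_simps)

lemma smod_hom_uce:
  "smod_hom S (uce S L) P = smod_hom S (uce_module S L) P"
  "smod_hom S P (uce S L) = smod_hom S P (uce_module S L)"
  by (simp_all add: smod_hom_def uce_simps)

context lie_superalgebra
begin

lemma smod_hom_eq_on_uce:
  assumes "g \<in> smod_hom S U P" "h \<in> smod_hom S U P" "u \<in> carrier U"
    and "\<And>x y. x \<in> carrier L \<Longrightarrow> y \<in> carrier L \<Longrightarrow> g (e x y) = h (e x y)"
  shows "g u = h u"
  using assms(3) by (rule uce_module_induct) (simp_all add: assms smod_homD(2)[OF assms(1)] smod_homD(2)[OF assms(2)])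

lemma e_closed: "x \<in> carrier L \<Longrightarrow> y \<in> carrier L \<Longrightarrow> e x y \<in> carrier U"
  using smod_bilinearD(1)[OF lie_pairingD(1)[OF e_pairing]] .

text \<open>In this form the universal property identifies the maps defined by a definite description,
  \<open>uce_proj\<close> and \<open>uce_map\<close>.\<close>

lemma extensional_lift:
  assumes P: "supermodule S P" and b: "lie_pairing S L P b"
  shows "\<exists>!h. h \<in> smod_hom S (uce S L) P \<inter> extensional (carrier (uce S L)) \<and>
    (\<forall>x\<in>carrier L. \<forall>y\<in>carrier L. h (e x y) = b x y)"
proof -
  obtain h where h: "h \<in> smod_hom S U P" "\<forall>x\<in>carrier L. \<forall>y\<in>carrier L. h (e x y) = b x y"
    using uce_module_lift[OF P b] by blast
  have "restrict h (carrier U) \<in> smod_hom S U P"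
    by (rule smod_hom_restrict[OF h(1) Um.supermodule])
  then show ?thesis
    unfolding smod_hom_uce uce_simps
    using h(2) by (intro ex1I[of _ "restrict h (carrier U)"])
      (auto simp: e_closed intro!: extensionalityI intro: smod_hom_eq_on_uce)
qed

lemma uce_proj:
  "uce_proj S L \<in> smod_hom S U L" "uce_proj S L \<in> extensional (carrier U)"
  "x \<in> carrier L \<Longrightarrow> y \<in> carrier L \<Longrightarrow> uce_proj S L (e x y) = bracket L x y"
proof -
  have "uce_proj S L \<in> smod_hom S (uce S L) L \<inter> extensional (carrier (uce S L)) \<and>
      (\<forall>x\<in>carrier L. \<forall>y\<in>carrier L. uce_proj S L (e x y) = bracket L x y)"
    unfolding uce_proj_def by (rule theI'[OF extensional_lift[OF supermodule bracket_pairing]])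
  then show "uce_proj S L \<in> smod_hom S U L" "uce_proj S L \<in> extensional (carrier U)"
    "x \<in> carrier L \<Longrightarrow> y \<in> carrier L \<Longrightarrow> uce_proj S L (e x y) = bracket L x y"
    by (simp_all add: smod_hom_uce uce_simps)
qed

abbreviation "\<pi> \<equiv> uce_proj S L"

sublocale pr: smod_morphism S "uce_module S L" L "uce_proj S L"
  by unfold_locales (rule uce_proj(1))

text \<open>\<open>\<langle>\<pi> u, \<pi> v\<rangle>\<close> is bilinear in \<open>u\<close> and \<open>v\<close> and has the prescribed values on generators, and the generators
  determine a biadditive map.\<close>

lemma uce_bracket:
  assumes "u \<in> carrier U" "v \<in> carrier U"
  shows "uce_bracket S L u v = e (\<pi> u) (\<pi> v)"
proof -
  note B = smod_bilinearD[OF lie_pairingD(1)[OF e_pairing]]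
  define b where "b = (\<lambda>u\<in>carrier U. \<lambda>v\<in>carrier U. e (\<pi> u) (\<pi> v))"
  have "uce_bracket S L = b"
    unfolding uce_bracket_def
  proof (rule the_equality)
    have "smod_bilinear S U U U b"
      unfolding smod_bilinear_def
      by (auto simp: b_def B pr.hom_closed pr.hom_add pr.hom_smult pr.hom_sgn pr.hom_part
          Um.Mg.deg_carrier Um.Mg.sgn_closed Um.smult_closed Sg.deg_carrier)
    then show "b \<in> carrier U \<rightarrow>\<^sub>E (carrier U \<rightarrow>\<^sub>E carrier U) \<and> smod_bilinear S U U U b \<and>
      (\<forall>x\<in>carrier L. \<forall>y\<in>carrier L. \<forall>z\<in>carrier L. \<forall>w\<in>carrier L.
        b (e x y) (e z w) = e (bracket L x y) (bracket L z w))"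
      by (auto simp: b_def e_closed uce_proj(3) pr.hom_closed)
  next
    fix b' assume b': "b' \<in> carrier U \<rightarrow>\<^sub>E (carrier U \<rightarrow>\<^sub>E carrier U) \<and> smod_bilinear S U U U b' \<and>
      (\<forall>x\<in>carrier L. \<forall>y\<in>carrier L. \<forall>z\<in>carrier L. \<forall>w\<in>carrier L.
        b' (e x y) (e z w) = e (bracket L x y) (bracket L z w))"
    then have B': "smod_bilinear S U U U b'" by blast
    note B' = smod_bilinearD(2,3)[OF B']
    have "b' u v = e (\<pi> u) (\<pi> v)" if u: "u \<in> carrier U" and v: "v \<in> carrier U" for u v
      using u
    proof (rule uce_module_induct)
      fix x y assume xy: "x \<in> carrier L" "y \<in> carrier L"
      show "b' (e x y) v = e (\<pi> (e x y)) (\<pi> v)"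
        using v
        by (rule uce_module_induct)
          (use b' xy in \<open>simp_all add: e_closed uce_proj(3) B' B pr.hom_add pr.hom_closed bracket_closed\<close>)
    qed (use v in \<open>simp_all add: B' B pr.hom_add pr.hom_closed\<close>)
    moreover have "b' u \<in> extensional (carrier U)" if "u \<in> carrier U" for u
      using b' that by (auto simp: PiE_def Pi_def)
    moreover have "b' \<in> extensional (carrier U)"
      using b' by (auto simp: PiE_def)
    ultimately show "b' = b"
      unfolding b_def by (intro extensionalityI[of _ "carrier U"]) auto
  qed
  then show ?thesis
    by (simp add: b_def assms)
qed

text \<open>The identities of a Lie superalgebra hold in \<open>uce L\<close> because they are relations between the
  \<open>\<langle>x, y\<rangle>\<close>: for the Jacobi identity note that \<open>[u, [v, w]] = \<langle>\<pi> u, [\<pi> v, \<pi> w]\<rangle>\<close>.\<close>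

lemma lie_superalgebra_uce: "lie_superalgebra S (uce S L)"
proof -
  note B = smod_bilinearD[OF lie_pairingD(1)[OF e_pairing]]
  note cl = Um.Mg.deg_carrier pr.hom_part e_closed pr.hom_closed uce_proj(3)
  show ?thesis
  proof (intro lie_superalgebra.intro lie_superalgebra_axioms.intro)
    show "supermodule S (uce S L)"
      by (rule supermodule_cong[OF Um.supermodule]) (simp_all add: uce_simps)
    show "smod_bilinear S (uce S L) (uce S L) (uce S L) (bracket (uce S L))"
      unfolding smod_bilinear_def uce_simps sgn_pow_uce
      by (auto simp: uce_bracket B pr.hom_closed pr.hom_add pr.hom_smult pr.hom_sgn pr.hom_part
          Um.Mg.deg_carrier Um.Mg.sgn_closed Um.smult_closed Sg.deg_carrier)
  qed (simp_all add: uce_simps sgn_pow_uce uce_bracket cl lie_pairingD(2-5)[OF e_pairing])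
qed

lemma uce_proj_lie_hom: "\<pi> \<in> lie_hom S (uce S L) L"
  by (rule lie_homI) (simp_all add: smod_hom_uce uce_proj uce_simps uce_bracket pr.hom_closed)

lemma uce_bracket_eq:
  "u \<in> carrier (uce S L) \<Longrightarrow> v \<in> carrier (uce S L) \<Longrightarrow> bracket (uce S L) u v = e (\<pi> u) (\<pi> v)"
  by (simp add: uce_simps uce_bracket)

lemmas uce_induct = uce_module_induct[folded uce_simps(1,2)]

lemma uce_pairing: "lie_pairing S L (uce S L) e"
  using lie_pairing_image[OF e_pairing Um.supermodule lie_superalgebra.axioms(1)[OF lie_superalgebra_uce], of "\<lambda>x. x"]
  by (simp add: smod_hom_def uce_simps)

text \<open>The kernel of \<open>\<pi>\<close> is central because the bracket of \<open>uce L\<close> only depends on the images in \<open>L\<close>.\<close>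

lemma uce_central_extension:
  assumes "\<pi> ` carrier (uce S L) = carrier L"
  shows "central_extension S (uce S L) L \<pi>"
proof -
  note B = smod_bilinearD(4)[OF lie_pairingD(1)[OF uce_pairing], of \<zero> "\<zero>\<^bsub>L\<^esub>"]
  interpret Ul: lie_superalgebra S "uce S L" by (rule lie_superalgebra_uce)
  have zero: "e \<zero>\<^bsub>L\<^esub> y = \<zero>\<^bsub>uce S L\<^esub>" if "y \<in> carrier L" for y
    using B[of y] that by (simp add: smult_zero_left Ul.smult_zero_left e_closed uce_simps(1))
  show ?thesis
    unfolding central_extension_def
  proof (intro conjI assms uce_proj_lie_hom lie_superalgebra lie_superalgebra_uce)
    interpret lie_morphism S "uce S L" L \<pi>
      using lie_superalgebra_uce lie_superalgebra uce_proj_lie_hom by (rule lie_morphismI)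
    show "a_kernel (uce S L) L \<pi> \<subseteq> lie_centre (uce S L)"
      by (auto simp: kernel_eq lie_centre_def uce_bracket_eq zero hom_closed)
  qed
qed

subsection \<open>Perfect Lie superalgebras\<close>

text \<open>The image of \<open>\<pi>\<close> is the span of the brackets.  So \<open>L\<close> is perfect if and only if \<open>\<pi>\<close> is onto, and in
  this form perfectness passes to direct limits.\<close>

lemma uce_proj_surj:
  assumes "perfect S L"
  shows "\<pi> ` carrier (uce S L) = carrier L"
proof
  show "\<pi> ` carrier (uce S L) \<subseteq> carrier L"
    by (auto simp: uce_simps pr.hom_closed)
  have "submodule (\<pi> ` carrier U) S L"
  proof (rule submoduleI)
    show "\<zero>\<^bsub>L\<^esub> \<in> \<pi> ` carrier U"
      using pr.hom_zero by (metis Um.M.zero_closed imageI)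
  next
    fix x y assume "x \<in> \<pi> ` carrier U" "y \<in> \<pi> ` carrier U"
    then show "x \<oplus>\<^bsub>L\<^esub> y \<in> \<pi> ` carrier U"
      by (auto simp flip: pr.hom_add)
  next
    fix s x assume "s \<in> carrier S" "x \<in> \<pi> ` carrier U"
    then show "s \<odot>\<^bsub>L\<^esub> x \<in> \<pi> ` carrier U"
      by (auto simp: Um.smult_closed simp flip: pr.hom_smult)
  qed (auto simp: pr.hom_closed)
  moreover have "{bracket L x y | x y. x \<in> carrier L \<and> y \<in> carrier L} \<subseteq> \<pi> ` carrier U"
    by (auto simp: e_closed simp flip: uce_proj(3))
  ultimately have "smod_span S L {bracket L x y | x y. x \<in> carrier L \<and> y \<in> carrier L} \<subseteq> \<pi> ` carrier U"
    by (rule smod_span_least)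
  then show "carrier L \<subseteq> \<pi> ` carrier (uce S L)"
    using assms by (simp add: perfect_def uce_simps)
qed

lemma perfectI:
  assumes "\<pi> ` carrier (uce S L) = carrier L"
  shows "perfect S L"
  unfolding perfect_def
proof
  let ?A = "{bracket L x y | x y. x \<in> carrier L \<and> y \<in> carrier L}"
  have A: "?A \<subseteq> carrier L"
    by (auto simp: bracket_closed)
  show "smod_span S L ?A \<subseteq> carrier L"
    by (rule smod_span_least[OF submodule_carrier A])
  note D = submoduleD[OF smod_span_submodule[OF A]]
  have "\<pi> u \<in> smod_span S L ?A" if "u \<in> carrier U" for u
    using that
  proof (rule uce_module_induct)
    fix x y assume "x \<in> carrier L" "y \<in> carrier L"
    then show "\<pi> (e x y) \<in> smod_span S L ?A"
      using smod_span_incl by (force simp: uce_proj(3))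
  qed (simp add: pr.hom_add D(3))
  then have "\<pi> ` carrier U \<subseteq> smod_span S L ?A"
    by blast
  then show "carrier L \<subseteq> smod_span S L ?A"
    using assms by (simp add: uce_simps)
qed

text \<open>For perfect \<open>L\<close> the algebra \<open>uce L\<close> is perfect, even additively generated by brackets, since
  \<open>\<langle>\<pi> v, \<pi> w\<rangle> = [v, w]\<close>.\<close>

lemma perfect_uce_induct:
  assumes "perfect S L" "u \<in> carrier (uce S L)"
    and brackets: "\<And>v w. v \<in> carrier (uce S L) \<Longrightarrow> w \<in> carrier (uce S L) \<Longrightarrow> P (bracket (uce S L) v w)"
    and sum: "\<And>v w. v \<in> carrier (uce S L) \<Longrightarrow> w \<in> carrier (uce S L) \<Longrightarrow> P v \<Longrightarrow> P w \<Longrightarrow> P (v \<oplus>\<^bsub>uce S L\<^esub> w)"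
  shows "P u"
  using assms(2)
proof (rule uce_induct)
  fix x y assume "x \<in> carrier L" "y \<in> carrier L"
  then obtain v w where "v \<in> carrier (uce S L)" "w \<in> carrier (uce S L)" "x = \<pi> v" "y = \<pi> w"
    using uce_proj_surj[OF assms(1)] by blast
  then show "P (e x y)"
    using brackets[of v w] by (simp add: uce_bracket_eq)
qed (rule sum)

end

subsection \<open>Functoriality\<close>

context lie_morphism
begin

abbreviation "fu \<equiv> uce_map S K L f"

lemma uce_map:
  "fu \<in> smod_hom S (uce S K) (uce S L)" "fu \<in> extensional (carrier (uce S K))"
  "x \<in> carrier K \<Longrightarrow> y \<in> carrier K \<Longrightarrow> fu (uce_elem S K x y) = uce_elem S L (f x) (f y)"
proof -
  have "supermodule S (uce S L)"
    using L.lie_superalgebra_uce by (rule lie_superalgebra.axioms)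
  from theI'[OF K.extensional_lift[OF this lie_pairing_pullback[OF L.uce_pairing]]]
  show "fu \<in> smod_hom S (uce S K) (uce S L)" "fu \<in> extensional (carrier (uce S K))"
    "x \<in> carrier K \<Longrightarrow> y \<in> carrier K \<Longrightarrow> fu (uce_elem S K x y) = uce_elem S L (f x) (f y)"
    unfolding uce_map_def[symmetric] by blast+
qed

lemma uce_proj_map:
  assumes "u \<in> carrier (uce S K)"
  shows "uce_proj S L (fu u) = f (uce_proj S K u)"
  using assms
proof (rule K.uce_induct)
  fix u v assume "u \<in> carrier (uce S K)" "v \<in> carrier (uce S K)"
    "uce_proj S L (fu u) = f (uce_proj S K u)" "uce_proj S L (fu v) = f (uce_proj S K v)"
  then show "uce_proj S L (fu (u \<oplus>\<^bsub>uce S K\<^esub> v)) = f (uce_proj S K (u \<oplus>\<^bsub>uce S K\<^esub> v))"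
    using smod_homD(1,2)[OF uce_map(1)]
    by (simp add: uce_simps K.pr.hom_add L.pr.hom_add hom_add K.pr.hom_closed)
qed (simp add: uce_map K.uce_proj L.uce_proj hom_closed hom_bracket)

lemma uce_map_lie_hom: "fu \<in> lie_hom S (uce S K) (uce S L)"
proof (rule lie_homI[OF uce_map(1)])
  fix u v assume "u \<in> carrier (uce S K)" "v \<in> carrier (uce S K)"
  then show "fu (bracket (uce S K) u v) = bracket (uce S L) (fu u) (fu v)"
    using smod_homD(1)[OF uce_map(1)]
    by (simp add: K.uce_bracket_eq L.uce_bracket_eq uce_map(3) uce_proj_map)
      (simp add: uce_simps uce_map(3) K.pr.hom_closed)
qed

lemma uce_map_unique:
  assumes "h \<in> smod_hom S (uce S K) (uce S L)" "u \<in> carrier (uce S K)"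
    and "\<And>x y. x \<in> carrier K \<Longrightarrow> y \<in> carrier K \<Longrightarrow> h (uce_elem S K x y) = uce_elem S L (f x) (f y)"
  shows "h u = fu u"
proof (rule K.smod_hom_eq_on_uce[of h "uce S L" fu])
  show "h \<in> smod_hom S (uce_module S K) (uce S L)" "fu \<in> smod_hom S (uce_module S K) (uce S L)"
    using assms(1) uce_map(1) by (simp_all only: smod_hom_uce)
  show "u \<in> carrier (uce_module S K)"
    using assms(2) by (simp only: uce_simps)
qed (simp add: assms(3) uce_map(3))

end

lemma uce_map_compose:
  assumes K: "lie_superalgebra S K" and L: "lie_superalgebra S L" and M: "lie_superalgebra S M"
    and f: "f \<in> lie_hom S K L" and g: "g \<in> lie_hom S L M" and h: "h \<in> lie_hom S K M"
    and eq: "\<And>x. x \<in> carrier K \<Longrightarrow> h x = g (f x)" and u: "u \<in> carrier (uce S K)"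
  shows "uce_map S K M h u = uce_map S L M g (uce_map S K L f u)"
proof -
  interpret f: lie_morphism S K L f using K L f by (rule lie_morphismI)
  interpret g: lie_morphism S L M g using L M g by (rule lie_morphismI)
  interpret h: lie_morphism S K M h using K M h by (rule lie_morphismI)
  show ?thesis
    by (rule h.uce_map_unique[OF smod_hom_comp[OF f.uce_map(1) g.uce_map(1)] u, symmetric])
      (simp add: f.uce_map g.uce_map eq f.hom_closed)
qed

lemma uce_map_identity:
  assumes K: "lie_superalgebra S K" and f: "f \<in> lie_hom S K K"
    and eq: "\<And>x. x \<in> carrier K \<Longrightarrow> f x = x" and u: "u \<in> carrier (uce S K)"
  shows "uce_map S K K f u = u"
proof -
  interpret f: lie_morphism S K K f using K K f by (rule lie_morphismI)
  show ?thesis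
    by (rule f.uce_map_unique[OF _ u, of "\<lambda>u. u", symmetric]) (simp_all add: eq smod_hom_def)
qed

subsection \<open>The universal central extension of a perfect Lie superalgebra\<close>

text \<open>A kernel element brackets to zero on the left by the definition of the centre.  On the right
  this follows by antisymmetry, which is available for homogeneous elements only; here one uses
  that the kernel contains the components of its elements.\<close>

lemma central_extension_bracket:
  assumes ext: "central_extension S K L f"
    and c: "c \<in> carrier K" "c' \<in> carrier K" "f c = f c'" and d: "d \<in> carrier K" "d' \<in> carrier K" "f d = f d'"
  shows "bracket K c d = bracket K c' d'"
proof -
  interpret lie_morphism S K L f
    using ext by (intro lie_morphismI) (simp_all add: central_extension_def)
  note B = smod_bilinearD[OF K.bracket_bilinear]
  have central: "bracket K x y = \<zero>\<^bsub>K\<^esub>" if "x \<in> a_kernel K L f" "y \<in> carrier K" for x y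
    using that ext by (auto simp: central_extension_def lie_centre_def)
  have ker: "x \<oplus>\<^bsub>K\<^esub> \<ominus>\<^bsub>K\<^esub> y \<in> a_kernel K L f" if "x \<in> carrier K" "y \<in> carrier K" "f x = f y" for x y
    using that by (simp add: kernel_eq hom_add hom_neg hom_closed L.M.r_neg)
  have central': "bracket K y x = \<zero>\<^bsub>K\<^esub>" if x: "x \<in> a_kernel K L f" and y: "y \<in> carrier K" for x y
    using y
  proof (rule K.Mg.homogeneous_induct)
    fix q y assume y: "y \<in> part K q"
    have "bracket K y (K.Mg.comp p x) = \<zero>\<^bsub>K\<^esub>" for p
    proof -
      have xp: "K.Mg.comp p x \<in> a_kernel K L f" "K.Mg.comp p x \<in> part K p"
        using x kernel_comp K.Mg.comp_deg by (auto simp: kernel_eq)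
      then have "sgn_pow K (q * p) (bracket K (K.Mg.comp p x) y) = \<zero>\<^bsub>K\<^esub>"
        using central[OF xp(1) K.Mg.deg_carrier[OF y]] K.M.minus_equality[of "\<zero>\<^bsub>K\<^esub>" "\<zero>\<^bsub>K\<^esub>"]
        by (simp add: sgn_pow_def)
      then show ?thesis
        using K.bracket_antisym[OF y xp(2)] K.bracket_closed y xp(2) K.Mg.deg_carrier by simp
    qed
    then show "bracket K y x = \<zero>\<^bsub>K\<^esub>"
      using B(3)[of y "K.Mg.comp 0 x" "K.Mg.comp 1 x"] K.Mg.comp_sum[of x 0] K.Mg.comp_closed[of x] x
        K.Mg.deg_carrier[OF y] by (simp add: kernel_eq)
  qed (use x in \<open>simp add: B kernel_eq\<close>)
  have "bracket K c d = bracket K (c' \<oplus>\<^bsub>K\<^esub> (c \<oplus>\<^bsub>K\<^esub> \<ominus>\<^bsub>K\<^esub> c')) d"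
    using c by (simp add: K.M.a_ac K.M.r_neg K.M.r_neg1 K.M.r_neg2)
  also have "\<dots> = bracket K c' d"
    using c d central[OF ker[OF c]] by (simp add: B)
  also have "\<dots> = bracket K c' (d' \<oplus>\<^bsub>K\<^esub> (d \<oplus>\<^bsub>K\<^esub> \<ominus>\<^bsub>K\<^esub> d'))"
    using d by (simp add: K.M.a_ac K.M.r_neg K.M.r_neg1 K.M.r_neg2)
  also have "\<dots> = bracket K c' d'"
    using c d central'[OF ker[OF d]] by (simp add: B)
  finally show ?thesis .
qed

context lie_superalgebra
begin

text \<open>The bracket of \<open>K\<close>, computed on preimages, is a pairing on \<open>L\<close> and induces \<open>g\<close>.  Another lift \<open>g'\<close>
  satisfies \<open>[g' v, g' w] = [g v, g w]\<close> since \<open>g' v\<close> and \<open>g v\<close> have the same image in \<open>L\<close>; so both agree on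
  brackets, which generate \<open>uce L\<close>.\<close>

theorem uce_universal_central_extension:
  assumes perf: "perfect S L"
  shows "universal_central_extension TYPE('k) S (uce S L) L \<pi>"
  unfolding universal_central_extension_def
proof (intro conjI allI impI)
  show "central_extension S (uce S L) L \<pi>"
    by (rule uce_central_extension[OF uce_proj_surj[OF perf]])
next
  fix K :: "('s, 'k) lie_superalgebra" and f
  assume ext: "central_extension S K L f"
  interpret f: lie_morphism S K L f
    using ext by (intro lie_morphismI) (simp_all add: central_extension_def)
  interpret Ul: lie_superalgebra S "uce S L" by (rule lie_superalgebra_uce)
  have surj: "f ` carrier K = carrier L"
    using ext by (simp add: central_extension_def)
  define k where "k = inv_into (carrier K) f"
  have k: "k x \<in> carrier K" "f (k x) = x" if "x \<in> carrier L" for x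
    using that surj by (auto simp: k_def inv_into_into f_inv_into_f)
  define b where "b = (\<lambda>x y. bracket K (k x) (k y))"
  have b: "b (f c) (f d) = bracket K c d" if "c \<in> carrier K" "d \<in> carrier K" for c d
    unfolding b_def using that k by (intro central_extension_bracket[OF ext]) (auto simp: f.hom_closed)
  have "lie_pairing S L K b"
    by (rule lie_pairing_cover[of S L "{()}" "\<lambda>_. K" "\<lambda>_. f" _ "\<lambda>_. bracket K"])
      (use supermodule f.K.lie_superalgebra f.lie_hom surj b f.K.bracket_pairing in auto)
  then obtain g where g: "g \<in> smod_hom S (uce S L) K" "g \<in> extensional (carrier (uce S L))"
      "\<And>x y. x \<in> carrier L \<Longrightarrow> y \<in> carrier L \<Longrightarrow> g (e x y) = b x y"
    using extensional_lift[OF f.K.supermodule] by blast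
  note gD = smod_homD[OF g(1)]
  have fg: "f (g u) = \<pi> u" if "u \<in> carrier (uce S L)" for u
    using that
    by (rule uce_induct)
      (simp_all add: g(3) b_def k f.hom_bracket f.hom_add gD(1,2) uce_proj(3) pr.hom_add[folded uce_simps(1,2)])
  have g_lie: "g \<in> lie_hom S (uce S L) K"
  proof (rule lie_homI[OF g(1)])
    fix u v assume uv: "u \<in> carrier (uce S L)" "v \<in> carrier (uce S L)"
    then show "g (bracket (uce S L) u v) = bracket K (g u) (g v)"
      using b[of "g u" "g v"] by (simp add: uce_bracket_eq g(3) pr.hom_closed[folded uce_simps(1)] gD(1) fg)
  qed
  show "\<exists>!g. g \<in> lie_hom S (uce S L) K \<inter> extensional (carrier (uce S L)) \<and>
    (\<forall>x\<in>carrier (uce S L). \<pi> x = f (g x))"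
  proof (rule ex1I)
    show "g \<in> lie_hom S (uce S L) K \<inter> extensional (carrier (uce S L)) \<and>
      (\<forall>x\<in>carrier (uce S L). \<pi> x = f (g x))"
      using g_lie g(2) fg by simp
  next
    fix g' assume g': "g' \<in> lie_hom S (uce S L) K \<inter> extensional (carrier (uce S L)) \<and>
      (\<forall>x\<in>carrier (uce S L). \<pi> x = f (g' x))"
    then have g'_lie: "g' \<in> lie_hom S (uce S L) K" by simp
    note g'D = smod_homD[OF lie_homD(1)[OF g'_lie]]
    have "g' u = g u" if "u \<in> carrier (uce S L)" for u
    proof (rule perfect_uce_induct[OF perf that])
      fix v w assume vw: "v \<in> carrier (uce S L)" "w \<in> carrier (uce S L)"
      have "bracket K (g' v) (g' w) = bracket K (g v) (g w)"
        using vw g' fg gD(1) g'D(1) by (intro central_extension_bracket[OF ext]) auto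
      then show "g' (bracket (uce S L) v w) = g (bracket (uce S L) v w)"
        using vw by (simp add: lie_homD(2)[OF g_lie] lie_homD(2)[OF g'_lie])
    qed (simp add: gD(2) g'D(2))
    then show "g' = g"
      using g' g(2) by (intro extensionalityI[of _ "carrier (uce S L)"]) auto
  qed
qed

end

section \<open>Direct limits\<close>

lemma ex1_eq: "\<exists>!x. P x \<Longrightarrow> P a \<Longrightarrow> P b \<Longrightarrow> a = b"
  by blast

locale smod_system =
  fixes S :: "'s superring" and I :: "'i set" and leq :: "'i \<Rightarrow> 'i \<Rightarrow> bool"
    and L :: "'i \<Rightarrow> ('s, 'a, 'm) supermodule_scheme" and f :: "'i \<Rightarrow> 'i \<Rightarrow> 'a \<Rightarrow> 'a"
  assumes directed: "directed_index I leq"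
    and module: "i \<in> I \<Longrightarrow> supermodule S (L i)"
    and trans_hom: "i \<in> I \<Longrightarrow> j \<in> I \<Longrightarrow> leq i j \<Longrightarrow> f j i \<in> smod_hom S (L i) (L j)"
    and trans_id: "i \<in> I \<Longrightarrow> x \<in> carrier (L i) \<Longrightarrow> f i i x = x"
    and trans_comp: "i \<in> I \<Longrightarrow> j \<in> I \<Longrightarrow> k \<in> I \<Longrightarrow> leq i j \<Longrightarrow> leq j k \<Longrightarrow> x \<in> carrier (L i) \<Longrightarrow>
      f k i x = f k j (f j i x)"
begin

lemma leq_refl: "i \<in> I \<Longrightarrow> leq i i"
  and leq_trans: "i \<in> I \<Longrightarrow> j \<in> I \<Longrightarrow> k \<in> I \<Longrightarrow> leq i j \<Longrightarrow> leq j k \<Longrightarrow> leq i k"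
  and upper_bound: "i \<in> I \<Longrightarrow> j \<in> I \<Longrightarrow> \<exists>k\<in>I. leq i k \<and> leq j k"
  and I_nonempty: "I \<noteq> {}"
  using directed unfolding directed_index_def by blast+

lemma upper_bound3:
  assumes "i \<in> I" "j \<in> I" "k \<in> I" shows "\<exists>l\<in>I. leq i l \<and> leq j l \<and> leq k l"
proof -
  obtain m where m: "m \<in> I" "leq i m" "leq j m"
    using upper_bound assms by blast
  obtain l where "l \<in> I" "leq m l" "leq k l"
    using upper_bound assms m by blast
  then show ?thesis
    using m assms leq_trans by blast
qed

lemma superring: "comm_superring S"
proof -
  obtain i where "i \<in> I" using I_nonempty by blast
  then interpret supermodule S "L i" by (rule module)
  show ?thesis ..
qed

lemma trans_morphism: "i \<in> I \<Longrightarrow> j \<in> I \<Longrightarrow> leq i j \<Longrightarrow> smod_morphism S (L i) (L j) (f j i)"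
  by (simp add: smod_morphism_def smod_morphism_axioms_def module trans_hom)

lemmas trans_closed = smod_homD(1)[OF trans_hom]

end

text \<open>
  A direct limit is recognised by two properties: every element comes from some \<open>L i\<close>, and an
  element of \<open>L i\<close> that vanishes in the limit already vanishes in some later \<open>L j\<close>.  They do not
  mention any target, so that they give the universal property for targets of every type.
\<close>

locale smod_limit = smod_system S I leq L f + M: supermodule S M
  for S :: "'s superring" and I :: "'i set" and leq :: "'i \<Rightarrow> 'i \<Rightarrow> bool"
    and L :: "'i \<Rightarrow> ('s, 'a, 'm) supermodule_scheme" and f :: "'i \<Rightarrow> 'i \<Rightarrow> 'a \<Rightarrow> 'a"
    and M :: "('s, 'b, 'n) supermodule_scheme" +
  fixes \<phi> :: "'i \<Rightarrow> 'a \<Rightarrow> 'b"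
  assumes can_hom: "i \<in> I \<Longrightarrow> \<phi> i \<in> smod_hom S (L i) M"
    and can_trans: "i \<in> I \<Longrightarrow> j \<in> I \<Longrightarrow> leq i j \<Longrightarrow> x \<in> carrier (L i) \<Longrightarrow> \<phi> j (f j i x) = \<phi> i x"
    and cover: "y \<in> carrier M \<Longrightarrow> \<exists>i\<in>I. y \<in> \<phi> i ` carrier (L i)"
    and vanish: "i \<in> I \<Longrightarrow> x \<in> carrier (L i) \<Longrightarrow> \<phi> i x = \<zero>\<^bsub>M\<^esub> \<Longrightarrow>
      \<exists>j\<in>I. leq i j \<and> f j i x = \<zero>\<^bsub>L j\<^esub>"
begin

lemma can_morphism: "i \<in> I \<Longrightarrow> smod_morphism S (L i) M (\<phi> i)"
  by (simp add: smod_morphism_def smod_morphism_axioms_def module can_hom M.supermodule)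

lemmas can_closed = smod_homD(1)[OF can_hom]

lemma image_mono: "i \<in> I \<Longrightarrow> j \<in> I \<Longrightarrow> leq i j \<Longrightarrow> \<phi> i ` carrier (L i) \<subseteq> \<phi> j ` carrier (L j)"
  by (auto simp: trans_closed simp flip: can_trans)

lemma cover3:
  assumes "x \<in> carrier M" "y \<in> carrier M" "z \<in> carrier M"
  shows "\<exists>i\<in>I. x \<in> \<phi> i ` carrier (L i) \<and> y \<in> \<phi> i ` carrier (L i) \<and> z \<in> \<phi> i ` carrier (L i)"
proof -
  obtain i j k where ijk: "i \<in> I" "j \<in> I" "k \<in> I"
    and xyz: "x \<in> \<phi> i ` carrier (L i)" "y \<in> \<phi> j ` carrier (L j)" "z \<in> \<phi> k ` carrier (L k)"
    using cover assms by meson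
  obtain l where "l \<in> I" "leq i l" "leq j l" "leq k l"
    using upper_bound3 ijk by blast
  then show ?thesis
    using image_mono[of i l] image_mono[of j l] image_mono[of k l] ijk xyz by blast
qed

lemma cover2:
  assumes "x \<in> carrier M" "y \<in> carrier M"
  obtains i a b where "i \<in> I" "a \<in> carrier (L i)" "b \<in> carrier (L i)" "x = \<phi> i a" "y = \<phi> i b"
  using cover3[OF assms(1) assms] by blast

lemma eventually_eq:
  assumes i: "i \<in> I" and xy: "x \<in> carrier (L i)" "y \<in> carrier (L i)" and eq: "\<phi> i x = \<phi> i y"
  shows "\<exists>j\<in>I. leq i j \<and> f j i x = f j i y"
proof -
  interpret p: smod_morphism S "L i" M "\<phi> i" using i by (rule can_morphism)
  have "\<phi> i (x \<oplus>\<^bsub>L i\<^esub> \<ominus>\<^bsub>L i\<^esub> y) = \<zero>\<^bsub>M\<^esub>"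
    using xy eq by (simp add: p.hom_add p.hom_neg p.hom_closed M.M.r_neg)
  then obtain j where j: "j \<in> I" "leq i j" "f j i (x \<oplus>\<^bsub>L i\<^esub> \<ominus>\<^bsub>L i\<^esub> y) = \<zero>\<^bsub>L j\<^esub>"
    using vanish[OF i, of "x \<oplus>\<^bsub>L i\<^esub> \<ominus>\<^bsub>L i\<^esub> y"] xy by auto
  interpret t: smod_morphism S "L i" "L j" "f j i" using i j(1,2) by (rule trans_morphism)
  have "f j i x \<oplus>\<^bsub>L j\<^esub> \<ominus>\<^bsub>L j\<^esub> f j i y = \<zero>\<^bsub>L j\<^esub>"
    using j(3) xy by (simp add: t.hom_add t.hom_neg)
  then have "f j i x = f j i y"
    using xy by (metis t.N.M.a_inv_closed t.N.M.minus_equality t.N.M.minus_minus t.hom_closed)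
  with j show ?thesis by blast
qed

lemma eventually_eq2:
  assumes ij: "i \<in> I" "j \<in> I" and xy: "x \<in> carrier (L i)" "y \<in> carrier (L j)" and eq: "\<phi> i x = \<phi> j y"
  shows "\<exists>k\<in>I. leq i k \<and> leq j k \<and> f k i x = f k j y"
proof -
  obtain l where l: "l \<in> I" "leq i l" "leq j l"
    using upper_bound ij by blast
  have "\<phi> l (f l i x) = \<phi> l (f l j y)"
    using ij l xy eq by (simp add: can_trans)
  then obtain k where k: "k \<in> I" "leq l k" "f k l (f l i x) = f k l (f l j y)"
    using eventually_eq[OF l(1), of "f l i x" "f l j y"] ij l xy by (auto simp: trans_closed)
  show ?thesis
  proof (intro bexI[OF _ k(1)] conjI)
    show "leq i k" "leq j k"
      using leq_trans ij l k by blast+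
    show "f k i x = f k j y"
      using k(3) trans_comp[OF ij(1) l(1) k(1) l(2) k(2) xy(1)]
        trans_comp[OF ij(2) l(1) k(1) l(3) k(2) xy(2)] by simp
  qed
qed

lemma induced_unique:
  assumes "smod_induced S I L M \<phi> N g h" "smod_induced S I L M \<phi> N g h'"
  shows "h = h'"
proof (rule extensionalityI[of _ "carrier M"])
  fix x assume "x \<in> carrier M"
  then obtain i a where "i \<in> I" "a \<in> carrier (L i)" "x = \<phi> i a"
    using cover by blast
  then show "h x = h' x"
    using assms by (simp add: smod_induced_def)
qed (use assms in \<open>auto simp: smod_induced_def\<close>)

lemma induced_exists:
  assumes "smod_cocone S I leq L f N g"
  shows "\<exists>h. smod_induced S I L M \<phi> N g h"
proof -
  have N: "supermodule S N" and gh: "\<And>i. i \<in> I \<Longrightarrow> g i \<in> smod_hom S (L i) N"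
    and gt: "\<And>i j x. i \<in> I \<Longrightarrow> j \<in> I \<Longrightarrow> leq i j \<Longrightarrow> x \<in> carrier (L i) \<Longrightarrow> g j (f j i x) = g i x"
    using assms by (auto simp: smod_cocone_def)
  have well: "g i x = g j y"
    if "i \<in> I" "j \<in> I" "x \<in> carrier (L i)" "y \<in> carrier (L j)" "\<phi> i x = \<phi> j y" for i j x y
    using eventually_eq2[OF that] gt[of i _ x] gt[of j _ y] that by metis
  have "\<exists>z. \<forall>i\<in>I. \<forall>a\<in>carrier (L i). x = \<phi> i a \<longrightarrow> z = g i a" if "x \<in> carrier M" for x
    using cover[OF that] well by blast
  then obtain h0 where h0: "\<And>x i a. x \<in> carrier M \<Longrightarrow> i \<in> I \<Longrightarrow> a \<in> carrier (L i) \<Longrightarrow> x = \<phi> i a \<Longrightarrow> h0 x = g i a"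
    by metis
  define h where "h = restrict h0 (carrier M)"
  have h: "h (\<phi> i a) = g i a" if "i \<in> I" "a \<in> carrier (L i)" for i a
    using h0 that by (simp add: h_def can_closed)
  have "h \<in> smod_hom S M N"
  proof (rule smod_homI)
    fix x assume x: "x \<in> carrier M"
    then obtain i a where i: "i \<in> I" "a \<in> carrier (L i)" "x = \<phi> i a"
      using cover by blast
    interpret i: supermodule S "L i" using i(1) by (rule module)
    show "h x \<in> carrier N"
      using i h smod_homD(1)[OF gh] by simp
    show "h (s \<odot>\<^bsub>M\<^esub> x) = s \<odot>\<^bsub>N\<^esub> h x" if "s \<in> carrier S" for s
      using i that h[of i "s \<odot>\<^bsub>L i\<^esub> a"] h[of i a] smod_homD(3)[OF can_hom] smod_homD(3)[OF gh]
      by (simp add: i.smult_closed)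
  next
    fix x y assume "x \<in> carrier M" "y \<in> carrier M"
    then obtain i a b where i: "i \<in> I" "a \<in> carrier (L i)" "b \<in> carrier (L i)" "x = \<phi> i a" "y = \<phi> i b"
      by (rule cover2)
    interpret i: supermodule S "L i" using i(1) by (rule module)
    show "h (x \<oplus>\<^bsub>M\<^esub> y) = h x \<oplus>\<^bsub>N\<^esub> h y"
      using i h[of i "a \<oplus>\<^bsub>L i\<^esub> b"] h[of i] smod_homD(2)[OF can_hom] smod_homD(2)[OF gh] by simp
  next
    fix x p assume x: "x \<in> part M p"
    then obtain i a where i: "i \<in> I" "a \<in> carrier (L i)" "x = \<phi> i a"
      using cover M.Mg.deg_carrier by blast
    interpret p: smod_morphism S "L i" M "\<phi> i" using i(1) by (rule can_morphism)
    have "x = \<phi> i (p.M.Mg.comp p a)"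
      using i x by (simp add: p.hom_comp M.Mg.comp_same)
    then have "h x = g i (p.M.Mg.comp p a)"
      using h i by (simp add: p.M.Mg.comp_closed)
    then show "h x \<in> part N p"
      using i smod_homD(4)[OF gh] by (simp add: p.M.Mg.comp_deg)
  qed
  then have "smod_induced S I L M \<phi> N g h"
    by (auto simp: smod_induced_def h) (simp add: h_def)
  then show ?thesis
    by blast
qed

lemma induced_ex1:
  "smod_cocone S I leq L f N g \<Longrightarrow> \<exists>!h. smod_induced S I L M \<phi> N g h"
  using induced_exists induced_unique by blast

end

subsection \<open>The standard construction\<close>

context smod_system
begin

text \<open>The class of \<open>(i, x)\<close> in the disjoint union of the \<open>L i\<close> modulo agreement at a later index.\<close>

definition germ :: "'i \<Rightarrow> 'a \<Rightarrow> ('i \<times> 'a) set" where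
  "germ i x = {(j, y). j \<in> I \<and> y \<in> carrier (L j) \<and> (\<exists>k\<in>I. leq i k \<and> leq j k \<and> f k i x = f k j y)}"

lemma germ_trans:
  assumes ij: "i \<in> I" "j \<in> I" "leq i j" and x: "x \<in> carrier (L i)"
  shows "germ j (f j i x) = germ i x"
proof (intro equalityI subsetI)
  fix z assume "z \<in> germ j (f j i x)"
  then obtain k l y where z: "z = (l, y)" "l \<in> I" "y \<in> carrier (L l)"
    and k: "k \<in> I" "leq j k" "leq l k" "f k j (f j i x) = f k l y"
    by (auto simp: germ_def)
  then have "leq i k" "f k i x = f k l y"
    using ij x leq_trans[of i j k] trans_comp[of i j k x] by auto
  with z k show "z \<in> germ i x"
    by (auto simp: germ_def)
next
  fix z assume "z \<in> germ i x"
  then obtain k l y where z: "z = (l, y)" "l \<in> I" "y \<in> carrier (L l)"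
    and k: "k \<in> I" "leq i k" "leq l k" "f k i x = f k l y"
    by (auto simp: germ_def)
  obtain m where m: "m \<in> I" "leq k m" "leq j m"
    using upper_bound k ij by blast
  have "f m j (f j i x) = f m k (f k i x)"
    using trans_comp[of i j m x] trans_comp[of i k m x] ij k m x by simp
  also have "\<dots> = f m l y"
    using k z m by (simp add: trans_comp[of l k m])
  finally show "z \<in> germ j (f j i x)"
    using z m leq_trans[of l k m] k by (auto simp: germ_def)
qed

lemma germ_eqD:
  assumes "i \<in> I" "j \<in> I" "x \<in> carrier (L i)" "y \<in> carrier (L j)" "germ i x = germ j y"
  shows "\<exists>k\<in>I. leq i k \<and> leq j k \<and> f k i x = f k j y"
proof -
  have "(j, y) \<in> germ j y"
    unfolding germ_def using assms(2,4) leq_refl by blast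
  then show ?thesis
    unfolding assms(5)[symmetric] by (simp add: germ_def)
qed

text \<open>If the operations \<open>b i\<close> are compatible with the transition maps, then all members of the union
  agree.  Addition, the scalar action (with a dummy second argument) and the bracket are of this
  form.\<close>

definition germ_op :: "('i \<Rightarrow> 'a \<Rightarrow> 'a \<Rightarrow> 'a) \<Rightarrow> ('i \<times> 'a) set \<Rightarrow> ('i \<times> 'a) set \<Rightarrow> ('i \<times> 'a) set" where
  "germ_op b A B = \<Union>{germ i (b i x y) | i x y.
    i \<in> I \<and> x \<in> carrier (L i) \<and> y \<in> carrier (L i) \<and> A = germ i x \<and> B = germ i y}"

text \<open>The two pairs of arguments first agree in the first entry at some index \<open>k\<close>, then in both at a
  later index \<open>l\<close>.\<close>

lemma germ_op_eq:
  assumes closed: "\<And>i x y. i \<in> I \<Longrightarrow> x \<in> carrier (L i) \<Longrightarrow> y \<in> carrier (L i) \<Longrightarrow> b i x y \<in> carrier (L i)"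
    and compat: "\<And>i j x y. i \<in> I \<Longrightarrow> j \<in> I \<Longrightarrow> leq i j \<Longrightarrow> x \<in> carrier (L i) \<Longrightarrow> y \<in> carrier (L i) \<Longrightarrow>
      f j i (b i x y) = b j (f j i x) (f j i y)"
    and i: "i \<in> I" and xy: "x \<in> carrier (L i)" "y \<in> carrier (L i)"
  shows "germ_op b (germ i x) (germ i y) = germ i (b i x y)"
proof -
  have "germ j (b j x' y') = germ i (b i x y)"
    if j: "j \<in> I" and xy': "x' \<in> carrier (L j)" "y' \<in> carrier (L j)"
      and eq: "germ i x = germ j x'" "germ i y = germ j y'" for j x' y'
  proof -
    obtain k where k: "k \<in> I" "leq i k" "leq j k" "f k i x = f k j x'"
      using germ_eqD[OF i j xy(1) xy'(1) eq(1)] by blast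
    have "germ k (f k i y) = germ k (f k j y')"
      using k i j xy xy' eq by (simp add: germ_trans)
    then obtain l where l: "l \<in> I" "leq k l" "f l k (f k i y) = f l k (f k j y')"
      using germ_eqD[OF k(1) k(1), of "f k i y" "f k j y'"] k i j xy xy' by (auto simp: trans_closed)
    have il: "leq i l" "leq j l"
      using leq_trans k l i j by blast+
    have "f l i x = f l j x'" "f l i y = f l j y'"
      using k l i j xy xy' by (simp_all add: trans_comp[of _ k l])
    then have "f l i (b i x y) = f l j (b j x' y')"
      using compat il i j l xy xy' by simp
    then show ?thesis
      using germ_trans[OF i l(1) il(1) closed[OF i xy]] germ_trans[OF j l(1) il(2) closed[OF j xy']] by simp
  qed
  then show ?thesis
    unfolding germ_op_def using i xy by blast
qed

definition germs :: "('s, ('i \<times> 'a) set) supermodule" where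
  "germs = \<lparr>carrier = (\<Union>i\<in>I. germ i ` carrier (L i)), monoid.mult = undefined, one = undefined,
     ring.zero = (\<Union>i\<in>I. germ i \<zero>\<^bsub>L i\<^esub>), ring.add = germ_op (\<lambda>i x y. x \<oplus>\<^bsub>L i\<^esub> y),
     smult = (\<lambda>s A. germ_op (\<lambda>i x y. s \<odot>\<^bsub>L i\<^esub> x) A A),
     part = (\<lambda>p. \<Union>i\<in>I. germ i ` part (L i) p)\<rparr>"

lemma germs_carrier: "A \<in> carrier germs \<longleftrightarrow> (\<exists>i\<in>I. \<exists>x\<in>carrier (L i). A = germ i x)"
  by (auto simp: germs_def)

lemma germs_part: "A \<in> part germs p \<longleftrightarrow> (\<exists>i\<in>I. \<exists>x\<in>part (L i) p. A = germ i x)"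
  by (auto simp: germs_def)

lemma germs_add:
  assumes "i \<in> I" "x \<in> carrier (L i)" "y \<in> carrier (L i)"
  shows "germ i x \<oplus>\<^bsub>germs\<^esub> germ i y = germ i (x \<oplus>\<^bsub>L i\<^esub> y)"
proof -
  have "x \<oplus>\<^bsub>L i\<^esub> y \<in> carrier (L i)" if "i \<in> I" "x \<in> carrier (L i)" "y \<in> carrier (L i)" for i x y
  proof -
    interpret supermodule S "L i" using that(1) by (rule module)
    show ?thesis using that by simp
  qed
  then have "germ_op (\<lambda>i x y. x \<oplus>\<^bsub>L i\<^esub> y) (germ i x) (germ i y) = germ i (x \<oplus>\<^bsub>L i\<^esub> y)"
    using assms by (intro germ_op_eq) (simp_all add: smod_homD(2)[OF trans_hom])
  then show ?thesis
    by (simp add: germs_def)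
qed

lemma germs_smult:
  assumes "i \<in> I" "x \<in> carrier (L i)" "s \<in> carrier S"
  shows "s \<odot>\<^bsub>germs\<^esub> germ i x = germ i (s \<odot>\<^bsub>L i\<^esub> x)"
proof -
  have "germ_op (\<lambda>i x y. s \<odot>\<^bsub>L i\<^esub> x) (germ i x) (germ i x) = germ i (s \<odot>\<^bsub>L i\<^esub> x)"
    using assms
    by (intro germ_op_eq) (simp_all add: smod_homD(3)[OF trans_hom] supermodule.smult_closed[OF module])
  then show ?thesis
    by (simp add: germs_def)
qed

lemma germs_zero: assumes i: "i \<in> I" shows "germ i \<zero>\<^bsub>L i\<^esub> = \<zero>\<^bsub>germs\<^esub>"
proof -
  have "germ i \<zero>\<^bsub>L i\<^esub> = germ j \<zero>\<^bsub>L j\<^esub>" if ij: "i \<in> I" "j \<in> I" for i j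
  proof -
    obtain k where k: "k \<in> I" "leq i k" "leq j k"
      using upper_bound ij by blast
    interpret i: smod_morphism S "L i" "L k" "f k i" using ij(1) k(1,2) by (rule trans_morphism)
    interpret j: smod_morphism S "L j" "L k" "f k j" using ij(2) k(1,3) by (rule trans_morphism)
    show ?thesis
      using germ_trans[OF ij(1) k(1,2), of "\<zero>\<^bsub>L i\<^esub>"] germ_trans[OF ij(2) k(1,3), of "\<zero>\<^bsub>L j\<^esub>"]
      by (simp add: i.hom_zero j.hom_zero)
  qed
  then have "(\<Union>j\<in>I. germ j \<zero>\<^bsub>L j\<^esub>) = (\<Union>j\<in>I. germ i \<zero>\<^bsub>L i\<^esub>)"
    using i by (intro SUP_cong) blast+
  also have "\<dots> = germ i \<zero>\<^bsub>L i\<^esub>"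
    using i by blast
  finally show ?thesis
    by (simp add: germs_def)
qed

text \<open>If an even and an odd element have the same germ, then they agree at a later index, where they
  are zero since the grading is direct there.\<close>

lemma supermodule_germs: "supermodule S germs"
proof (rule supermodule_cover[of S I L germs germ])
  show "carrier germs = (\<Union>i\<in>I. germ i ` carrier (L i))" "part germs p = (\<Union>i\<in>I. germ i ` part (L i) p)" for p
    by (simp_all add: germs_def)
next
  fix i j assume ij: "i \<in> I" "j \<in> I"
  obtain k where k: "k \<in> I" "leq i k" "leq j k"
    using upper_bound ij by blast
  have "germ l ` carrier (L l) \<subseteq> germ k ` carrier (L k) \<and> (\<forall>p. germ l ` part (L l) p \<subseteq> germ k ` part (L k) p)"
    if l: "l \<in> I" "leq l k" for l
  proof -
    interpret t: smod_morphism S "L l" "L k" "f k l" using l(1) k(1) l(2) by (rule trans_morphism)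
    have "germ l x = germ k (f k l x)" if "x \<in> carrier (L l)" for x
      using l k that by (simp add: germ_trans)
    then show ?thesis
      using t.hom_closed t.hom_part t.M.Mg.deg_carrier unfolding image_subset_iff by (metis imageI)
  qed
  with ij k show "\<exists>k\<in>I. \<forall>l\<in>{i, j}. germ l ` carrier (L l) \<subseteq> germ k ` carrier (L k) \<and>
      (\<forall>p. germ l ` part (L l) p \<subseteq> germ k ` part (L k) p)"
    by (intro bexI[OF _ k(1)]) auto
next
  fix i x y assume i: "i \<in> I" and x: "x \<in> part (L i) 0" and y: "y \<in> part (L i) 1" and eq: "germ i x = germ i y"
  interpret supermodule S "L i" using i by (rule module)
  obtain k where k: "k \<in> I" "leq i k" "f k i x = f k i y"
    using germ_eqD[OF i i Mg.deg_carrier[OF x] Mg.deg_carrier[OF y] eq] by blast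
  interpret k: smod_morphism S "L i" "L k" "f k i" using i k(1,2) by (rule trans_morphism)
  have "f k i x = \<zero>\<^bsub>L k\<^esub>"
    using k.hom_part[OF x] k.hom_part[OF y] k(3) k.N.Mg.deg_disjoint[of _ 0] by simp
  then show "germ i x = \<zero>\<^bsub>germs\<^esub>"
    using germ_trans[OF i k(1,2) Mg.deg_carrier[OF x]] germs_zero[OF k(1)] by simp
qed (simp_all add: superring I_nonempty module germs_add germs_smult germs_zero)

lemma germ_hom: "i \<in> I \<Longrightarrow> germ i \<in> smod_hom S (L i) germs"
  by (rule smod_homI) (auto simp: germs_carrier germs_part germs_add germs_smult)

lemma germs_limit: "smod_limit S I leq L f germs germ"
proof (intro smod_limit.intro smod_limit_axioms.intro smod_system_axioms supermodule_germs germ_hom)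
  fix i x assume i: "i \<in> I" and x: "x \<in> carrier (L i)" and z: "germ i x = \<zero>\<^bsub>germs\<^esub>"
  interpret supermodule S "L i" using i by (rule module)
  obtain k where k: "k \<in> I" "leq i k" "f k i x = f k i \<zero>\<^bsub>L i\<^esub>"
    using germ_eqD[OF i i x M.zero_closed] z germs_zero[OF i] by auto
  interpret k: smod_morphism S "L i" "L k" "f k i" using i k(1,2) by (rule trans_morphism)
  show "\<exists>j\<in>I. leq i j \<and> f j i x = \<zero>\<^bsub>L j\<^esub>"
    using k k.hom_zero by auto
qed (auto simp: germ_trans germs_carrier)

text \<open>Surjectivity is pulled back along the round trip \<open>M \<rightarrow> germs \<rightarrow> M\<close>, and vanishing is detected by
  \<open>M \<rightarrow> germs\<close>.\<close>

lemma smod_limitI: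
  assumes co: "smod_cocone S I leq L f M \<phi>"
    and h: "h \<in> smod_hom S M germs" "\<And>i x. i \<in> I \<Longrightarrow> x \<in> carrier (L i) \<Longrightarrow> h (\<phi> i x) = germ i x"
    and k: "\<And>i x. i \<in> I \<Longrightarrow> x \<in> carrier (L i) \<Longrightarrow> k (germ i x) = \<phi> i x"
    and kh: "\<And>x. x \<in> carrier M \<Longrightarrow> k (h x) = x"
  shows "smod_limit S I leq L f M \<phi>"
proof -
  have M: "supermodule S M"
    using co by (simp add: smod_cocone_def)
  interpret G: smod_limit S I leq L f germs germ by (rule germs_limit)
  interpret h: smod_morphism S M germs h
    using M h(1) supermodule_germs by (simp add: smod_morphism_def smod_morphism_axioms_def)
  show ?thesis
  proof (intro smod_limit.intro smod_limit_axioms.intro smod_system_axioms M)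
    fix x assume x: "x \<in> carrier M"
    then obtain i a where "i \<in> I" "a \<in> carrier (L i)" "h x = germ i a"
      using h.hom_closed germs_carrier by blast
    then show "\<exists>i\<in>I. x \<in> \<phi> i ` carrier (L i)"
      using kh[OF x] k by (metis imageI)
  next
    fix i x assume "i \<in> I" "x \<in> carrier (L i)" "\<phi> i x = \<zero>\<^bsub>M\<^esub>"
    then show "\<exists>j\<in>I. leq i j \<and> f j i x = \<zero>\<^bsub>L j\<^esub>"
      using G.vanish h(2) h.hom_zero by metis
  qed (use co in \<open>auto simp: smod_cocone_def\<close>)
qed

end

lemma (in smod_limit) cocone: "smod_cocone S I leq L f M \<phi>"
  by (auto simp: smod_cocone_def M.supermodule can_hom can_trans)

text \<open>The universal property for the type of the germs gives a map from \<open>M\<close> to them, the germs map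
  back to \<open>M\<close> by their own universal property, and the uniqueness part for the type of \<open>M\<close> makes the
  round trip the identity.\<close>

lemma smod_direct_limit_imp_limit:
  fixes I :: "'i set" and L :: "'i \<Rightarrow> ('s, 'a, 'm) supermodule_scheme" and M :: "('s, 'b) supermodule"
  assumes sys: "smod_system S I leq L f" and lim: "smod_direct_limit S I leq L f M \<phi>"
  shows "smod_limit S I leq L f M \<phi>"
proof -
  interpret smod_system S I leq L f by fact
  interpret G: smod_limit S I leq L f germs germ by (rule germs_limit)
  have co: "smod_cocone S I leq L f M \<phi>"
    and uni1: "\<And>(N :: ('s, ('i \<times> 'a) set) supermodule) g. smod_cocone S I leq L f N g \<Longrightarrow> \<exists>!h. smod_induced S I L M \<phi> N g h"
    and uni2: "\<And>(N :: ('s, 'b) supermodule) g. smod_cocone S I leq L f N g \<Longrightarrow> \<exists>!h. smod_induced S I L M \<phi> N g h"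
    using lim by (simp_all add: smod_direct_limit_def smod_universal_cocone_def)
  have M: "supermodule S M"
    using co by (simp add: smod_cocone_def)
  interpret M: supermodule S M by fact
  obtain h where h: "smod_induced S I L M \<phi> germs germ h"
    using uni1[OF G.cocone] by blast
  obtain k where k: "smod_induced S I L germs germ M \<phi> k"
    using G.induced_exists[OF co] by blast
  have hh: "h \<in> smod_hom S M germs" and kh: "k \<in> smod_hom S germs M"
    and hc: "\<And>i x. i \<in> I \<Longrightarrow> x \<in> carrier (L i) \<Longrightarrow> h (\<phi> i x) = germ i x"
    and kc: "\<And>i x. i \<in> I \<Longrightarrow> x \<in> carrier (L i) \<Longrightarrow> k (germ i x) = \<phi> i x"
    using h k by (auto simp: smod_induced_def)
  have can: "\<phi> i x \<in> carrier M" if "i \<in> I" "x \<in> carrier (L i)" for i x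
    using co that by (auto simp: smod_cocone_def dest: smod_homD(1))
  have "restrict (\<lambda>x. k (h x)) (carrier M) = restrict (\<lambda>x. x) (carrier M)"
  proof (rule ex1_eq[OF uni2[OF co]])
    show "smod_induced S I L M \<phi> M \<phi> (restrict (\<lambda>x. k (h x)) (carrier M))"
      by (simp add: smod_induced_def smod_hom_restrict[OF smod_hom_comp[OF hh kh] M] hc kc can)
    have "(\<lambda>x. x) \<in> smod_hom S M M"
      by (simp add: smod_hom_def)
    then show "smod_induced S I L M \<phi> M \<phi> (restrict (\<lambda>x. x) (carrier M))"
      using smod_hom_restrict[OF _ M] by (simp add: smod_induced_def can)
  qed
  then have "k (h x) = x" if "x \<in> carrier M" for x
    using that by (metis restrict_apply')
  then show ?thesis
    using smod_limitI[OF co hh hc kc] by blast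
qed

subsection \<open>Direct limits of Lie superalgebras\<close>

locale lie_system =
  fixes S :: "'s superring" and I :: "'i set" and leq :: "'i \<Rightarrow> 'i \<Rightarrow> bool"
    and L :: "'i \<Rightarrow> ('s, 'a) lie_superalgebra" and f :: "'i \<Rightarrow> 'i \<Rightarrow> 'a \<Rightarrow> 'a"
  assumes directed: "directed_index I leq"
    and system: "lie_directed_system S I leq L f"
begin

lemma lie: "i \<in> I \<Longrightarrow> lie_superalgebra S (L i)"
  using system by (simp add: lie_directed_system_def)

lemma trans_lie_hom: "i \<in> I \<Longrightarrow> j \<in> I \<Longrightarrow> leq i j \<Longrightarrow> f j i \<in> lie_hom S (L i) (L j)"
  using system by (simp add: lie_directed_system_def)

sublocale smod_system S I leq L f
  by (rule smod_system.intro)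
    (use directed system in \<open>auto simp: lie_directed_system_def intro: lie_homD(1) lie_superalgebra.axioms\<close>)

definition lie_germs :: "('s, ('i \<times> 'a) set) lie_superalgebra" where
  "lie_germs = supermodule.extend germs (lie_superalgebra.fields (germ_op (\<lambda>i. bracket (L i))))"

lemma lie_germs_simps:
  "carrier lie_germs = carrier germs" "add lie_germs = add germs" "\<zero>\<^bsub>lie_germs\<^esub> = \<zero>\<^bsub>germs\<^esub>"
  "smult lie_germs = smult germs" "part lie_germs = part germs"
  "bracket lie_germs = germ_op (\<lambda>i. bracket (L i))"
  by (simp_all add: lie_germs_def supermodule.defs lie_superalgebra.defs)

lemma lie_germs_bracket:
  assumes "i \<in> I" "x \<in> carrier (L i)" "y \<in> carrier (L i)"
  shows "bracket lie_germs (germ i x) (germ i y) = germ i (bracket (L i) x y)"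
  unfolding lie_germs_simps
  by (rule germ_op_eq)
    (use assms in \<open>auto simp: lie_superalgebra.bracket_closed[OF lie] lie_homD(2)[OF trans_lie_hom]\<close>)

lemma smod_hom_lie_germs:
  "smod_hom S lie_germs P = smod_hom S germs P" "smod_hom S P lie_germs = smod_hom S P germs"
  by (simp_all add: smod_hom_def lie_germs_simps)

lemma lie_germs_limit: "smod_limit S I leq L f lie_germs germ"
proof -
  interpret G: smod_limit S I leq L f germs germ by (rule germs_limit)
  show ?thesis
    by (intro smod_limit.intro smod_limit_axioms.intro smod_system_axioms supermodule_cong[OF supermodule_germs])
      (use G.can_hom G.can_trans G.cover G.vanish in \<open>auto simp: lie_germs_simps smod_hom_lie_germs\<close>)
qed

lemma lie_superalgebra_germs: "lie_superalgebra S lie_germs"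
proof -
  interpret G: smod_limit S I leq L f lie_germs germ by (rule lie_germs_limit)
  have hom: "germ i \<in> lie_hom S (L i) lie_germs" if "i \<in> I" for i
    using that by (intro lie_homI G.can_hom) (simp_all add: lie_germs_bracket)
  have "lie_pairing S lie_germs lie_germs (bracket lie_germs)"
  proof (rule lie_pairing_cover[OF G.M.supermodule lie hom G.cover3])
    show "lie_pairing S (L i) lie_germs (\<lambda>x y. germ i (bracket (L i) x y))" if i: "i \<in> I" for i
    proof -
      interpret lie_superalgebra S "L i" using i by (rule lie)
      show ?thesis
        using i by (intro lie_pairing_image[OF bracket_pairing] supermodule G.M.supermodule G.can_hom)
    qed
  qed (simp_all add: lie_germs_bracket)
  then show ?thesis
    by (rule lie_superalgebraI[OF G.M.supermodule])
qed

end

locale lie_limit = lie_system S I leq L f + smod_limit S I leq L f M \<phi>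
  for S :: "'s superring" and I :: "'i set" and leq :: "'i \<Rightarrow> 'i \<Rightarrow> bool"
    and L :: "'i \<Rightarrow> ('s, 'a) lie_superalgebra" and f :: "'i \<Rightarrow> 'i \<Rightarrow> 'a \<Rightarrow> 'a"
    and M :: "('s, 'b) lie_superalgebra" and \<phi> :: "'i \<Rightarrow> 'a \<Rightarrow> 'b" +
  assumes limit_lie: "lie_superalgebra S M"
    and can_lie_hom: "i \<in> I \<Longrightarrow> \<phi> i \<in> lie_hom S (L i) M"
begin

lemma lie_cocone: "lie_cocone S I leq L f M \<phi>"
  by (auto simp: lie_cocone_def limit_lie can_lie_hom can_trans)

lemma lie_induced_ex1:
  assumes co: "lie_cocone S I leq L f N g"
  shows "\<exists>!h. lie_induced S I L M \<phi> N g h"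
proof -
  have g: "\<And>i. i \<in> I \<Longrightarrow> g i \<in> lie_hom S (L i) N"
    using co by (simp add: lie_cocone_def)
  have "smod_cocone S I leq L f N g"
    using co by (auto simp: lie_cocone_def smod_cocone_def dest: lie_homD(1) intro: lie_superalgebra.axioms)
  then obtain h where h: "smod_induced S I L M \<phi> N g h" "\<And>h'. smod_induced S I L M \<phi> N g h' \<Longrightarrow> h' = h"
    using induced_ex1 by metis
  have hc: "\<And>i x. i \<in> I \<Longrightarrow> x \<in> carrier (L i) \<Longrightarrow> h (\<phi> i x) = g i x"
    and hh: "h \<in> smod_hom S M N" "h \<in> extensional (carrier M)"
    using h(1) by (auto simp: smod_induced_def)
  have "h \<in> lie_hom S M N"
  proof (rule lie_homI[OF hh(1)])
    fix x y assume "x \<in> carrier M" "y \<in> carrier M"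
    then obtain i a b where i: "i \<in> I" "a \<in> carrier (L i)" "b \<in> carrier (L i)" "x = \<phi> i a" "y = \<phi> i b"
      by (rule cover2)
    then show "h (bracket M x y) = bracket N (h x) (h y)"
      using hc[of i "bracket (L i) a b"] hc[of i] lie_homD(2)[OF can_lie_hom] lie_homD(2)[OF g]
        lie_superalgebra.bracket_closed[OF lie] by simp
  qed
  then have "lie_induced S I L M \<phi> N g h"
    using hc hh by (simp add: lie_induced_def)
  moreover have "h' = h" if "lie_induced S I L M \<phi> N g h'" for h'
    using that by (intro h(2)) (auto simp: lie_induced_def smod_induced_def dest: lie_homD(1))
  ultimately show ?thesis
    by blast
qed

end

lemma (in lie_system) germs_lie_limit: "lie_limit S I leq L f lie_germs germ"
proof -
  interpret G: smod_limit S I leq L f lie_germs germ by (rule lie_germs_limit)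
  show ?thesis
    by (intro lie_limit.intro lie_limit_axioms.intro lie_system_axioms lie_germs_limit
        lie_superalgebra_germs lie_homI G.can_hom) (simp_all add: lie_germs_bracket)
qed

lemma (in lie_system) lie_direct_limit_imp_limit:
  fixes M :: "('s, 'b) lie_superalgebra"
  assumes lim: "lie_direct_limit S I leq L f M \<phi>"
  shows "lie_limit S I leq L f M \<phi>"
proof -
  interpret G: lie_limit S I leq L f lie_germs germ by (rule germs_lie_limit)
  have co: "lie_cocone S I leq L f M \<phi>"
    and uni1: "\<And>(N :: ('s, ('i \<times> 'a) set) lie_superalgebra) g. lie_cocone S I leq L f N g \<Longrightarrow> \<exists>!h. lie_induced S I L M \<phi> N g h"
    and uni2: "\<And>(N :: ('s, 'b) lie_superalgebra) g. lie_cocone S I leq L f N g \<Longrightarrow> \<exists>!h. lie_induced S I L M \<phi> N g h"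
    using lim by (simp_all add: lie_direct_limit_def lie_universal_cocone_def)
  have lieM: "lie_superalgebra S M" and can_lie: "\<And>i. i \<in> I \<Longrightarrow> \<phi> i \<in> lie_hom S (L i) M"
    using co by (simp_all add: lie_cocone_def)
  then interpret M: lie_superalgebra S M by simp
  obtain h where h: "lie_induced S I L M \<phi> lie_germs germ h"
    using uni1[OF G.lie_cocone] by blast
  obtain k where k: "lie_induced S I L lie_germs germ M \<phi> k"
    using G.lie_induced_ex1[OF co] by blast
  have hh: "h \<in> lie_hom S M lie_germs" and kh: "k \<in> lie_hom S lie_germs M"
    and hc: "\<And>i x. i \<in> I \<Longrightarrow> x \<in> carrier (L i) \<Longrightarrow> h (\<phi> i x) = germ i x"
    and kc: "\<And>i x. i \<in> I \<Longrightarrow> x \<in> carrier (L i) \<Longrightarrow> k (germ i x) = \<phi> i x"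
    using h k by (auto simp: lie_induced_def)
  have can: "\<phi> i x \<in> carrier M" if "i \<in> I" "x \<in> carrier (L i)" for i x
    using smod_homD(1)[OF lie_homD(1)[OF can_lie]] that by blast
  have restr: "restrict g (carrier M) \<in> lie_hom S M M" if g: "g \<in> lie_hom S M M" for g
    using smod_hom_restrict[OF lie_homD(1)[OF g] M.supermodule]
    by (intro lie_homI) (simp_all add: lie_homD(2)[OF g] M.bracket_closed)
  have "restrict (\<lambda>x. k (h x)) (carrier M) = restrict (\<lambda>x. x) (carrier M)"
  proof (rule ex1_eq[OF uni2[OF co]])
    show "lie_induced S I L M \<phi> M \<phi> (restrict (\<lambda>x. k (h x)) (carrier M))"
      by (simp add: lie_induced_def restr[OF lie_hom_comp[OF hh kh]] hc kc can)
    have "(\<lambda>x. x) \<in> lie_hom S M M"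
      by (simp add: lie_hom_def smod_hom_def)
    then show "lie_induced S I L M \<phi> M \<phi> (restrict (\<lambda>x. x) (carrier M))"
      using restr by (simp add: lie_induced_def can)
  qed
  then have khx: "k (h x) = x" if "x \<in> carrier M" for x
    using that by (metis restrict_apply')
  have "smod_limit S I leq L f M \<phi>"
  proof (rule smod_limitI[of M \<phi> h k])
    show "smod_cocone S I leq L f M \<phi>"
      using co by (auto simp: lie_cocone_def smod_cocone_def M.supermodule dest: lie_homD(1))
    show "h \<in> smod_hom S M germs"
      using lie_homD(1)[OF hh] by (simp add: smod_hom_lie_germs)
  qed (use hc kc khx in auto)
  then show ?thesis
    by (intro lie_limit.intro lie_limit_axioms.intro lie_system_axioms lieM can_lie)
qed

section \<open>Isomorphisms\<close>

lemma smod_iso_comp: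
  "h \<in> smod_iso S K L \<Longrightarrow> g \<in> smod_iso S L M \<Longrightarrow> g \<circ> h \<in> smod_iso S K M"
  by (auto simp: smod_iso_def comp_def intro: smod_hom_comp bij_betw_trans[unfolded comp_def])

text \<open>The inverse of a bijective homomorphism preserves degrees: \<open>h\<close> commutes with taking components,
  so that a preimage of a homogeneous element is homogeneous.\<close>

lemma lie_iso_inverse:
  assumes K: "lie_superalgebra S K" and L: "lie_superalgebra S L" and h: "h \<in> lie_iso S K L"
  obtains k where "k \<in> lie_hom S L K" "\<And>x. x \<in> carrier K \<Longrightarrow> k (h x) = x"
    "\<And>y. y \<in> carrier L \<Longrightarrow> h (k y) = y"
proof -
  have bij: "bij_betw h (carrier K) (carrier L)" and hom: "h \<in> lie_hom S K L"
    using h by (auto simp: lie_iso_def)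
  interpret lie_morphism S K L h using K L hom by (rule lie_morphismI)
  define k where "k = inv_into (carrier K) h"
  have kh: "k (h x) = x" if "x \<in> carrier K" for x
    using bij that by (simp add: k_def bij_betw_def)
  have hk: "h (k y) = y" and kc: "k y \<in> carrier K" if "y \<in> carrier L" for y
    using bij that by (auto simp: k_def bij_betw_def f_inv_into_f inv_into_into)
  have "k \<in> smod_hom S L K"
  proof (rule smod_homI)
    fix x y assume "x \<in> carrier L" "y \<in> carrier L"
    then show "k (x \<oplus>\<^bsub>L\<^esub> y) = k x \<oplus>\<^bsub>K\<^esub> k y"
      using kh[of "k x \<oplus>\<^bsub>K\<^esub> k y"] by (simp add: hom_add hk kc)
  next
    fix s x assume "s \<in> carrier S" "x \<in> carrier L"
    then show "k (s \<odot>\<^bsub>L\<^esub> x) = s \<odot>\<^bsub>K\<^esub> k x"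
      using kh[of "s \<odot>\<^bsub>K\<^esub> k x"] by (simp add: hom_smult hk kc K.smult_closed)
  next
    fix y p assume y: "y \<in> part L p"
    then have yc: "y \<in> carrier L" by (rule L.Mg.deg_carrier)
    have "h (K.Mg.comp p (k y)) = y"
      using y yc by (simp add: hom_comp kc hk L.Mg.comp_same)
    then have "k y = K.Mg.comp p (k y)"
      using kh[of "K.Mg.comp p (k y)"] kc[OF yc] by (simp add: K.Mg.comp_closed)
    then show "k y \<in> part K p"
      using K.Mg.comp_deg[OF kc[OF yc], of p] by simp
  qed (rule kc)
  then have "k \<in> lie_hom S L K"
  proof (rule lie_homI)
    fix x y assume "x \<in> carrier L" "y \<in> carrier L"
    then show "k (bracket L x y) = bracket K (k x) (k y)"
      using kh[of "bracket K (k x) (k y)"] by (simp add: hom_bracket hk kc K.bracket_closed)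
  qed
  then show thesis
    using that kh hk by blast
qed

lemma universal_central_extension_iso:
  fixes S :: "'s superring"
  assumes uni: "universal_central_extension TYPE('k) S K L f"
    and K': "lie_superalgebra S K'" and h: "h \<in> lie_iso S K' K"
    and f': "f' \<in> lie_hom S K' L" "\<And>x. x \<in> carrier K' \<Longrightarrow> f' x = f (h x)"
  shows "universal_central_extension TYPE('k) S K' L f'"
proof -
  have ext: "central_extension S K L f"
    using uni by (simp add: universal_central_extension_def)
  then have K: "lie_superalgebra S K" and L: "lie_superalgebra S L" and f: "f \<in> lie_hom S K L"
    and surj: "f ` carrier K = carrier L" and ker: "a_kernel K L f \<subseteq> lie_centre K"
    by (auto simp: central_extension_def)
  obtain k where k: "k \<in> lie_hom S K K'" and kh: "\<And>x. x \<in> carrier K' \<Longrightarrow> k (h x) = x"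
    and hk: "\<And>y. y \<in> carrier K \<Longrightarrow> h (k y) = y"
    using lie_iso_inverse[OF K' K h] by blast
  have hhom: "h \<in> lie_hom S K' K"
    using h by (simp add: lie_iso_def)
  interpret h: lie_morphism S K' K h using K' K hhom by (rule lie_morphismI)
  interpret k: lie_morphism S K K' k using K K' k by (rule lie_morphismI)
  interpret f: lie_morphism S K L f using K L f by (rule lie_morphismI)
  interpret f': lie_morphism S K' L f' using K' L f'(1) by (rule lie_morphismI)
  show ?thesis
    unfolding universal_central_extension_def
  proof (intro conjI allI impI)
    have "f' ` carrier K' = carrier L"
    proof -
      have "f' ` carrier K' = f ` h ` carrier K'"
        by (auto simp: f'(2) image_iff)
      also have "h ` carrier K' = carrier K"
        using h by (simp add: lie_iso_def bij_betw_def)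
      finally show ?thesis by (simp add: surj)
    qed
    moreover have "a_kernel K' L f' \<subseteq> lie_centre K'"
    proof
      fix x assume "x \<in> a_kernel K' L f'"
      then have x: "x \<in> carrier K'" "f (h x) = \<zero>\<^bsub>L\<^esub>"
        using f'(2)[of x] by (simp_all add: f'.kernel_eq)
      then have "h x \<in> lie_centre K"
        using ker by (auto simp: f.kernel_eq h.hom_closed)
      then have "bracket K' x y = \<zero>\<^bsub>K'\<^esub>" if "y \<in> carrier K'" for y
        using that x(1) kh[of "bracket K' x y"] k.hom_zero
        by (simp add: h.K.bracket_closed h.hom_bracket lie_centre_def h.hom_closed)
      then show "x \<in> lie_centre K'"
        using x by (simp add: lie_centre_def)
    qed
    ultimately show "central_extension S K' L f'"
      using K' L f'(1) by (simp add: central_extension_def)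
  next
    fix X :: "('s, 'k) lie_superalgebra" and f'' assume ext'': "central_extension S X L f''"
    then obtain g where g: "g \<in> lie_hom S K X \<inter> extensional (carrier K)" "\<forall>x\<in>carrier K. f x = f'' (g x)"
      and uniq: "\<And>g'. g' \<in> lie_hom S K X \<inter> extensional (carrier K) \<Longrightarrow> \<forall>x\<in>carrier K. f x = f'' (g' x) \<Longrightarrow> g' = g"
      using uni unfolding universal_central_extension_def by metis
    have restr: "restrict a (carrier A) \<in> lie_hom S A B"
      if A: "lie_superalgebra S A" and a: "a \<in> lie_hom S A B" for a A B
      using smod_hom_restrict[OF lie_homD(1)[OF a] lie_superalgebra.axioms(1)[OF A]]
      by (intro lie_homI) (simp_all add: lie_homD(2)[OF a] lie_superalgebra.bracket_closed[OF A])
    show "\<exists>!g. g \<in> lie_hom S K' X \<inter> extensional (carrier K') \<and> (\<forall>x\<in>carrier K'. f' x = f'' (g x))"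
    proof (rule ex1I)
      show "restrict (\<lambda>x. g (h x)) (carrier K') \<in> lie_hom S K' X \<inter> extensional (carrier K') \<and>
        (\<forall>x\<in>carrier K'. f' x = f'' (restrict (\<lambda>x. g (h x)) (carrier K') x))"
        using restr[OF K' lie_hom_comp[OF hhom, of g X]] g by (simp add: f'(2) h.hom_closed)
    next
      fix g' assume g': "g' \<in> lie_hom S K' X \<inter> extensional (carrier K') \<and> (\<forall>x\<in>carrier K'. f' x = f'' (g' x))"
      have "restrict (\<lambda>y. g' (k y)) (carrier K) = g"
      proof (rule uniq)
        show "restrict (\<lambda>y. g' (k y)) (carrier K) \<in> lie_hom S K X \<inter> extensional (carrier K)"
          using restr[OF K lie_hom_comp[OF k, of g' X]] g' by simp
        have "f'' (g' (k y)) = f y" if "y \<in> carrier K" for y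
          using g' f'(2)[of "k y"] that by (simp add: k.hom_closed hk)
        then show "\<forall>x\<in>carrier K. f x = f'' (restrict (\<lambda>y. g' (k y)) (carrier K) x)"
          by simp
      qed
      then have "g' (k (h x)) = g (h x)" if "x \<in> carrier K'" for x
        using that by (metis h.hom_closed restrict_apply')
      then show "g' = restrict (\<lambda>x. g (h x)) (carrier K')"
        using g' by (intro extensionalityI[of _ "carrier K'"]) (auto simp: kh)
    qed
  qed
qed

section \<open>Second homology\<close>

context lie_superalgebra
begin

lemma uce_proj_morphism: "lie_morphism S (uce S L) L \<pi>"
  using lie_superalgebra_uce lie_superalgebra uce_proj_lie_hom by (rule lie_morphismI)

lemma H2_simps:
  "carrier (H2 S L) = {u \<in> carrier (uce S L). \<pi> u = \<zero>\<^bsub>L\<^esub>}"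
  "add (H2 S L) = add (uce S L)" "\<zero>\<^bsub>H2 S L\<^esub> = \<zero>\<^bsub>uce S L\<^esub>" "smult (H2 S L) = smult (uce S L)"
  "part (H2 S L) p = {u \<in> part (uce S L) p. \<pi> u = \<zero>\<^bsub>L\<^esub>}"
proof -
  interpret p: lie_morphism S "uce S L" L \<pi> by (rule uce_proj_morphism)
  show "carrier (H2 S L) = {u \<in> carrier (uce S L). \<pi> u = \<zero>\<^bsub>L\<^esub>}"
    "add (H2 S L) = add (uce S L)" "\<zero>\<^bsub>H2 S L\<^esub> = \<zero>\<^bsub>uce S L\<^esub>" "smult (H2 S L) = smult (uce S L)"
    "part (H2 S L) p = {u \<in> part (uce S L) p. \<pi> u = \<zero>\<^bsub>L\<^esub>}"
    by (auto simp: H2_def smod_restrict_def p.kernel_eq p.K.Mg.deg_carrier)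
qed

lemma supermodule_H2: "supermodule S (H2 S L)"
proof -
  interpret p: lie_morphism S "uce S L" L \<pi> by (rule uce_proj_morphism)
  show ?thesis
    unfolding H2_def by (rule graded_submodule.supermodule_restrict[OF p.kernel_graded])
qed

end

section \<open>The uce functor commutes with direct limits\<close>

lemma (in lie_system) uce_system:
  "lie_system S I leq (\<lambda>i. uce S (L i)) (\<lambda>j i. uce_map S (L i) (L j) (f j i))"
proof (rule lie_system.intro[OF directed], unfold lie_directed_system_def, intro conjI ballI impI)
  fix i assume i: "i \<in> I"
  show "lie_superalgebra S (uce S (L i))"
    using lie[OF i] by (rule lie_superalgebra.lie_superalgebra_uce)
  show "uce_map S (L i) (L i) (f i i) u = u" if "u \<in> carrier (uce S (L i))" for u
    using lie[OF i] trans_lie_hom[OF i i leq_refl[OF i]] trans_id[OF i] that by (rule uce_map_identity)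
next
  fix i j assume ij: "i \<in> I" "j \<in> I" "leq i j"
  show "uce_map S (L i) (L j) (f j i) \<in> lie_hom S (uce S (L i)) (uce S (L j))"
    using ij by (intro lie_morphism.uce_map_lie_hom lie_morphismI lie trans_lie_hom)
  fix k u assume k: "k \<in> I" "leq j k" and u: "u \<in> carrier (uce S (L i))"
  have "leq i k"
    using leq_trans ij k by blast
  then show "uce_map S (L i) (L k) (f k i) u = uce_map S (L j) (L k) (f k j) (uce_map S (L i) (L j) (f j i) u)"
    using ij k u by (intro uce_map_compose lie trans_lie_hom trans_comp)
qed

lemma (in lie_system) H2_system:
  "smod_system S I leq (\<lambda>i. H2 S (L i)) (\<lambda>j i. uce_map S (L i) (L j) (f j i))"
proof -
  interpret U: lie_system S I leq "\<lambda>i. uce S (L i)" "\<lambda>j i. uce_map S (L i) (L j) (f j i)"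
    by (rule uce_system)
  note H = lie_superalgebra.H2_simps[OF lie]
  show ?thesis
  proof (rule smod_system.intro[OF directed])
    fix i j assume ij: "i \<in> I" "j \<in> I" "leq i j"
    interpret m: lie_morphism S "L i" "L j" "f j i"
      using ij by (intro lie_morphismI lie trans_lie_hom)
    have zero: "uce_proj S (L j) (m.fu u) = \<zero>\<^bsub>L j\<^esub>"
      if "u \<in> carrier (uce S (L i))" "uce_proj S (L i) u = \<zero>\<^bsub>L i\<^esub>" for u
      using that by (simp add: m.uce_proj_map m.hom_zero)
    interpret u: smod_morphism S "uce S (L i)" "uce S (L j)" m.fu
      using ij by (rule U.trans_morphism)
    show "m.fu \<in> smod_hom S (H2 S (L i)) (H2 S (L j))"
      using ij by (intro smod_homI) (auto simp: H zero u.hom_closed u.hom_add u.hom_smult u.hom_part u.M.Mg.deg_carrier)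
  qed (simp_all add: lie_superalgebra.supermodule_H2[OF lie] H U.trans_id U.trans_comp[symmetric])
qed

locale uce_limit = L: lie_limit S I leq L f limL \<phi>L +
    U: lie_limit S I leq "\<lambda>i. uce S (L i)" "\<lambda>j i. uce_map S (L i) (L j) (f j i)" limU \<phi>U
  for S :: "'s superring" and I :: "'i set" and leq :: "'i \<Rightarrow> 'i \<Rightarrow> bool"
    and L :: "'i \<Rightarrow> ('s, 'a) lie_superalgebra" and f :: "'i \<Rightarrow> 'i \<Rightarrow> 'a \<Rightarrow> 'a"
    and limL :: "('s, 'l) lie_superalgebra" and \<phi>L :: "'i \<Rightarrow> 'a \<Rightarrow> 'l"
    and limU :: "('s, 'u) lie_superalgebra" and \<phi>U :: "'i \<Rightarrow> 'a uce \<Rightarrow> 'u"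
begin

abbreviation "cmap i \<equiv> uce_map S (L i) limL (\<phi>L i)"
abbreviation "proj i \<equiv> uce_proj S (L i)"
abbreviation "tmap j i \<equiv> uce_map S (L i) (L j) (f j i)"

lemma can_morphism: "i \<in> I \<Longrightarrow> lie_morphism S (L i) limL (\<phi>L i)"
  by (intro lie_morphismI L.lie L.limit_lie L.can_lie_hom)

lemma trans_lie_morphism: "i \<in> I \<Longrightarrow> j \<in> I \<Longrightarrow> leq i j \<Longrightarrow> lie_morphism S (L i) (L j) (f j i)"
  by (intro lie_morphismI L.lie L.trans_lie_hom)

lemma proj_trans:
  "i \<in> I \<Longrightarrow> j \<in> I \<Longrightarrow> leq i j \<Longrightarrow> u \<in> carrier (uce S (L i)) \<Longrightarrow> proj j (tmap j i u) = f j i (proj i u)"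
  by (rule lie_morphism.uce_proj_map[OF trans_lie_morphism])

lemma proj_can:
  "i \<in> I \<Longrightarrow> u \<in> carrier (uce S (L i)) \<Longrightarrow> uce_proj S limL (cmap i u) = \<phi>L i (proj i u)"
  by (rule lie_morphism.uce_proj_map[OF can_morphism])

lemma proj_hom: "i \<in> I \<Longrightarrow> proj i \<in> lie_hom S (uce S (L i)) (L i)"
  by (rule lie_superalgebra.uce_proj_lie_hom[OF L.lie])

lemma proj_closed: "i \<in> I \<Longrightarrow> u \<in> carrier (uce S (L i)) \<Longrightarrow> proj i u \<in> carrier (L i)"
  by (rule smod_homD(1)[OF lie_homD(1)[OF proj_hom]])

lemma cmap_cocone:
  "lie_cocone S I leq (\<lambda>i. uce S (L i)) tmap (uce S limL) cmap"
  unfolding lie_cocone_def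
proof (intro conjI ballI impI)
  show "lie_superalgebra S (uce S limL)"
    using L.limit_lie by (rule lie_superalgebra.lie_superalgebra_uce)
  show "cmap i \<in> lie_hom S (uce S (L i)) (uce S limL)" if "i \<in> I" for i
    using that by (rule lie_morphism.uce_map_lie_hom[OF can_morphism])
  show "cmap j (tmap j i u) = cmap i u"
    if "i \<in> I" "j \<in> I" "leq i j" "u \<in> carrier (uce S (L i))" for i j u
    using that L.can_trans
    by (intro uce_map_compose[symmetric] L.lie L.limit_lie L.trans_lie_hom L.can_lie_hom) auto
qed

lemma proj_cocone:
  "lie_cocone S I leq (\<lambda>i. uce S (L i)) tmap limL (\<lambda>i u. \<phi>L i (proj i u))"
  unfolding lie_cocone_def
proof (intro conjI ballI impI L.limit_lie)
  show "(\<lambda>u. \<phi>L i (proj i u)) \<in> lie_hom S (uce S (L i)) limL" if "i \<in> I" for i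
    using that by (intro lie_hom_comp[OF proj_hom L.can_lie_hom])
qed (simp add: proj_trans proj_closed L.can_trans)

text \<open>This pairing induces the inverse of \<open>\<phi>\<close>.  It is well defined: if two pairs have the same images
  in the limit, then they already agree at a common later index.\<close>

lemma limit_pairing:
  obtains b where "lie_pairing S limL limU b"
    "\<And>i x y. i \<in> I \<Longrightarrow> x \<in> carrier (L i) \<Longrightarrow> y \<in> carrier (L i) \<Longrightarrow>
      b (\<phi>L i x) (\<phi>L i y) = \<phi>U i (uce_elem S (L i) x y)"
proof -
  have shift: "\<phi>U j (uce_elem S (L j) (f j i x) (f j i y)) = \<phi>U i (uce_elem S (L i) x y)"
    if "i \<in> I" "j \<in> I" "leq i j" "x \<in> carrier (L i)" "y \<in> carrier (L i)" for i j x y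
  proof -
    interpret m: lie_morphism S "L i" "L j" "f j i" using that by (intro trans_lie_morphism)
    show ?thesis
      using U.can_trans[OF that(1-3), of "uce_elem S (L i) x y"] that
      by (simp add: m.uce_map(3) m.K.e_closed uce_simps(1))
  qed
  have well: "\<phi>U i (uce_elem S (L i) x y) = \<phi>U j (uce_elem S (L j) x' y')"
    if i: "i \<in> I" "x \<in> carrier (L i)" "y \<in> carrier (L i)" and j: "j \<in> I" "x' \<in> carrier (L j)" "y' \<in> carrier (L j)"
      and eq: "\<phi>L i x = \<phi>L j x'" "\<phi>L i y = \<phi>L j y'" for i j x y x' y'
  proof -
    obtain k where k: "k \<in> I" "leq i k" "leq j k" "f k i x = f k j x'"
      using L.eventually_eq2[OF i(1) j(1) i(2) j(2) eq(1)] by blast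
    have "\<phi>L k (f k i y) = \<phi>L k (f k j y')"
      using i j k eq by (simp add: L.can_trans)
    then obtain l where l: "l \<in> I" "leq k l" "f l k (f k i y) = f l k (f k j y')"
      using L.eventually_eq[OF k(1), of "f k i y" "f k j y'"] i j k by (auto simp: L.trans_closed)
    have il: "leq i l" "leq j l"
      using L.leq_trans i j k l by blast+
    have "f l i x = f l j x'" "f l i y = f l j y'"
      using k l i j by (simp_all add: L.trans_comp[of _ k l])
    then show ?thesis
      using shift[OF i(1) l(1) il(1) i(2,3)] shift[OF j(1) l(1) il(2) j(2,3)] by simp
  qed
  have "\<exists>z. \<forall>i\<in>I. \<forall>x\<in>carrier (L i). \<forall>y\<in>carrier (L i). a = \<phi>L i x \<longrightarrow> c = \<phi>L i y \<longrightarrow>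
      z = \<phi>U i (uce_elem S (L i) x y)" for a c
  proof (cases "\<exists>i\<in>I. \<exists>x\<in>carrier (L i). \<exists>y\<in>carrier (L i). a = \<phi>L i x \<and> c = \<phi>L i y")
    case True
    then obtain i x y where "i \<in> I" "x \<in> carrier (L i)" "y \<in> carrier (L i)" "a = \<phi>L i x" "c = \<phi>L i y"
      by blast
    then show ?thesis
      using well[of i x y] by (intro exI[of _ "\<phi>U i (uce_elem S (L i) x y)"]) auto
  qed blast
  then obtain b where b: "\<And>i x y. i \<in> I \<Longrightarrow> x \<in> carrier (L i) \<Longrightarrow> y \<in> carrier (L i) \<Longrightarrow>
      b (\<phi>L i x) (\<phi>L i y) = \<phi>U i (uce_elem S (L i) x y)"
    by metis
  have "lie_pairing S limL limU b"
  proof (rule lie_pairing_cover[OF L.M.supermodule L.lie L.can_lie_hom L.cover3])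
    show "lie_pairing S (L i) limU (\<lambda>x y. \<phi>U i (uce_elem S (L i) x y))" if i: "i \<in> I" for i
    proof -
      interpret lie_superalgebra S "L i" using i by (rule L.lie)
      show ?thesis
        using i by (intro lie_pairing_image[OF uce_pairing] U.module U.M.supermodule U.can_hom)
    qed
  qed (simp_all add: b)
  then show thesis
    using that b by blast
qed

text \<open>Both composites of \<open>\<phi>\<close> with the map induced by \<open>limit_pairing\<close> fix the elements \<open>\<phi>U \<langle>x, y\<rangle>\<close> and
  \<open>\<langle>\<phi>L x, \<phi>L y\<rangle>\<close>, respectively.\<close>

theorem uce_limit_iso:
  assumes "lie_induced S I (\<lambda>i. uce S (L i)) limU \<phi>U (uce S limL) cmap \<phi>"
  shows "\<phi> \<in> lie_iso S limU (uce S limL)"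
proof -
  interpret M: lie_superalgebra S limL by (rule L.limit_lie)
  have hom: "\<phi> \<in> lie_hom S limU (uce S limL)"
    and \<phi>: "\<And>i u. i \<in> I \<Longrightarrow> u \<in> carrier (uce S (L i)) \<Longrightarrow> \<phi> (\<phi>U i u) = cmap i u"
    using assms by (auto simp: lie_induced_def)
  interpret \<phi>: lie_morphism S limU "uce S limL" \<phi>
    using U.limit_lie M.lie_superalgebra_uce hom by (rule lie_morphismI)
  obtain b where b: "lie_pairing S limL limU b" "\<And>i x y. i \<in> I \<Longrightarrow> x \<in> carrier (L i) \<Longrightarrow> y \<in> carrier (L i) \<Longrightarrow>
      b (\<phi>L i x) (\<phi>L i y) = \<phi>U i (uce_elem S (L i) x y)"
    using limit_pairing by blast
  obtain \<psi> where \<psi>: "\<psi> \<in> smod_hom S (uce S limL) limU"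
      "\<And>x y. x \<in> carrier limL \<Longrightarrow> y \<in> carrier limL \<Longrightarrow> \<psi> (uce_elem S limL x y) = b x y"
    using M.uce_module_lift[OF U.M.supermodule b(1)] by (auto simp: smod_hom_uce)
  have \<psi>\<phi>: "\<psi> (\<phi> z) = z" if z0: "z \<in> carrier limU" for z
  proof -
    obtain i u where i: "i \<in> I" and u: "u \<in> carrier (uce S (L i))" and z: "z = \<phi>U i u"
      using U.cover[OF z0] by blast
    interpret m: lie_morphism S "L i" limL "\<phi>L i" using i by (rule can_morphism)
    from u have "\<psi> (\<phi> (\<phi>U i u)) = \<phi>U i u"
    proof (rule m.K.uce_induct)
      fix x y assume xy: "x \<in> carrier (L i)" "y \<in> carrier (L i)"
      then show "\<psi> (\<phi> (\<phi>U i (uce_elem S (L i) x y))) = \<phi>U i (uce_elem S (L i) x y)"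
        using i by (simp add: \<phi> m.K.e_closed uce_simps(1) m.uce_map(3) \<psi>(2) m.hom_closed b(2))
    next
      fix v w assume "v \<in> carrier (uce S (L i))" "w \<in> carrier (uce S (L i))"
        "\<psi> (\<phi> (\<phi>U i v)) = \<phi>U i v" "\<psi> (\<phi> (\<phi>U i w)) = \<phi>U i w"
      then show "\<psi> (\<phi> (\<phi>U i (v \<oplus>\<^bsub>uce S (L i)\<^esub> w))) = \<phi>U i (v \<oplus>\<^bsub>uce S (L i)\<^esub> w)"
        using smod_homD(2)[OF U.can_hom[OF i]] smod_homD(1)[OF U.can_hom[OF i]]
        by (simp add: \<phi>.hom_add \<phi>.hom_closed smod_homD(2)[OF \<psi>(1)])
    qed
    then show ?thesis
      by (simp add: z)
  qed
  have \<phi>\<psi>: "\<phi> (\<psi> v) = v" if "v \<in> carrier (uce S limL)" for v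
    using that
  proof (rule M.uce_induct)
    fix x y assume "x \<in> carrier limL" "y \<in> carrier limL"
    then obtain i a c where i: "i \<in> I" and ac: "a \<in> carrier (L i)" "c \<in> carrier (L i)" "x = \<phi>L i a" "y = \<phi>L i c"
      by (rule L.cover2)
    interpret m: lie_morphism S "L i" limL "\<phi>L i" using i by (rule can_morphism)
    show "\<phi> (\<psi> (uce_elem S limL x y)) = uce_elem S limL x y"
      using i ac by (simp add: \<psi>(2) m.hom_closed b(2) \<phi> m.K.e_closed uce_simps(1) m.uce_map(3))
  qed (simp add: smod_homD(1,2)[OF \<psi>(1)] \<phi>.hom_add)
  have "bij_betw \<phi> (carrier limU) (carrier (uce S limL))"
    by (rule bij_betw_byWitness[of _ \<psi>]) (use \<psi>\<phi> \<phi>\<psi> \<phi>.hom_closed smod_homD(1)[OF \<psi>(1)] in auto)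
  then show ?thesis
    using hom by (simp add: lie_iso_def)
qed

text \<open>An element of the limit comes from some \<open>L i\<close>, where it is of the form \<open>\<pi> u\<close>.\<close>

lemma perfect_limit:
  assumes "\<And>i. i \<in> I \<Longrightarrow> perfect S (L i)"
  shows "perfect S limL"
proof -
  interpret M: lie_superalgebra S limL by (rule L.limit_lie)
  show ?thesis
  proof (intro M.perfectI equalityI subsetI)
    fix x assume "x \<in> carrier limL"
    then obtain i a where i: "i \<in> I" "a \<in> carrier (L i)" "x = \<phi>L i a"
      using L.cover by blast
    then obtain u where "u \<in> carrier (uce S (L i))" "a = proj i u"
      using lie_superalgebra.uce_proj_surj[OF L.lie assms] by blast
    then show "x \<in> uce_proj S limL ` carrier (uce S limL)"
      using i lie_homD(1)[OF lie_morphism.uce_map_lie_hom[OF can_morphism[OF i(1)]]]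
      by (auto simp: smod_homD(1) simp flip: proj_can)
  qed (auto simp: uce_simps M.pr.hom_closed)
qed

lemma induced_proj_eq:
  assumes \<phi>: "lie_induced S I (\<lambda>i. uce S (L i)) limU \<phi>U (uce S limL) cmap \<phi>"
    and u: "lie_induced S I (\<lambda>i. uce S (L i)) limU \<phi>U limL (\<lambda>i x. \<phi>L i (proj i x)) u"
    and z: "z \<in> carrier limU"
  shows "u z = uce_proj S limL (\<phi> z)"
proof -
  obtain i w where "i \<in> I" "w \<in> carrier (uce S (L i))" "z = \<phi>U i w"
    using U.cover z by blast
  then show ?thesis
    using \<phi> u by (simp add: lie_induced_def proj_can)
qed

lemma H2_cocone: "smod_cocone S I leq (\<lambda>i. H2 S (L i)) tmap limU \<phi>U"
proof -
  note H = lie_superalgebra.H2_simps[OF L.lie]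
  have "\<phi>U i \<in> smod_hom S (H2 S (L i)) limU" if "i \<in> I" for i
    using that by (intro smod_homI) (auto simp: H smod_homD[OF U.can_hom])
  then show ?thesis
    by (auto simp: smod_cocone_def U.M.supermodule H U.can_trans)
qed

text \<open>Taking kernels commutes with direct limits.  For surjectivity, an element of the kernel of \<open>u\<close> comes
  from some \<open>uce (L i)\<close>, and its image in \<open>L i\<close> vanishes at a later index \<open>j\<close>, so that there it lies in
  \<open>H2 (L j)\<close>.  Injectivity holds since \<open>H2 (L j)\<close> is contained in \<open>uce (L j)\<close>.\<close>

lemma H2_limit_iso:
  assumes H: "smod_limit S I leq (\<lambda>i. H2 S (L i)) tmap limH \<phi>H"
    and u: "lie_induced S I (\<lambda>i. uce S (L i)) limU \<phi>U limL (\<lambda>i x. \<phi>L i (proj i x)) u"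
    and \<iota>: "smod_induced S I (\<lambda>i. H2 S (L i)) limH \<phi>H limU \<phi>U \<iota>"
  shows "\<iota> \<in> smod_iso S limH (smod_restrict limU (a_kernel limU limL u))"
proof -
  interpret H: smod_limit S I leq "\<lambda>i. H2 S (L i)" tmap limH \<phi>H by (rule H)
  note H2 = lie_superalgebra.H2_simps[OF L.lie]
  have u_hom: "u \<in> lie_hom S limU limL"
    and uc: "\<And>i w. i \<in> I \<Longrightarrow> w \<in> carrier (uce S (L i)) \<Longrightarrow> u (\<phi>U i w) = \<phi>L i (proj i w)"
    using u by (auto simp: lie_induced_def)
  have \<iota>_hom: "\<iota> \<in> smod_hom S limH limU"
    and \<iota>c: "\<And>i w. i \<in> I \<Longrightarrow> w \<in> carrier (H2 S (L i)) \<Longrightarrow> \<iota> (\<phi>H i w) = \<phi>U i w"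
    using \<iota> by (auto simp: smod_induced_def)
  interpret u: lie_morphism S limU limL u
    using U.limit_lie L.limit_lie u_hom by (rule lie_morphismI)
  interpret \<iota>: smod_morphism S limH limU \<iota>
    using H.M.supermodule U.M.supermodule \<iota>_hom by (simp add: smod_morphism_def smod_morphism_axioms_def)
  have can_zero: "\<phi>L i \<zero>\<^bsub>L i\<^esub> = \<zero>\<^bsub>limL\<^esub>" if "i \<in> I" for i
    using smod_morphism.hom_zero[OF L.can_morphism[OF that]] .
  have into: "u (\<iota> z) = \<zero>\<^bsub>limL\<^esub>" if z: "z \<in> carrier limH" for z
  proof -
    obtain i w where "i \<in> I" "w \<in> carrier (H2 S (L i))" "z = \<phi>H i w"
      using H.cover z by blast
    then show ?thesis
      by (simp add: \<iota>c H2 uc can_zero)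
  qed
  have onto: "\<exists>z\<in>carrier limH. y = \<iota> z" if y: "y \<in> carrier limU" "u y = \<zero>\<^bsub>limL\<^esub>" for y
  proof -
    obtain i w where i: "i \<in> I" and w: "w \<in> carrier (uce S (L i))" "y = \<phi>U i w"
      using U.cover y by blast
    then have "\<phi>L i (proj i w) = \<zero>\<^bsub>limL\<^esub>"
      using y uc by simp
    then obtain j where j: "j \<in> I" "leq i j" "f j i (proj i w) = \<zero>\<^bsub>L j\<^esub>"
      using L.vanish[OF i proj_closed[OF i w(1)]] by blast
    have w': "tmap j i w \<in> carrier (H2 S (L j))"
      using i j w by (simp add: H2 proj_trans U.trans_closed)
    then have "\<iota> (\<phi>H j (tmap j i w)) = y"
      using i j w by (simp add: \<iota>c U.can_trans)
    then show ?thesis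
      using H.can_closed[OF j(1) w'] by blast
  qed
  have inj: "inj_on \<iota> (carrier limH)"
  proof (rule \<iota>.injI)
    fix z assume z: "z \<in> carrier limH" "\<iota> z = \<zero>\<^bsub>limU\<^esub>"
    then obtain i w where i: "i \<in> I" and w: "w \<in> carrier (H2 S (L i))" "z = \<phi>H i w"
      using H.cover by blast
    then have "\<phi>U i w = \<zero>\<^bsub>limU\<^esub>" "w \<in> carrier (uce S (L i))"
      using z by (simp_all add: \<iota>c H2)
    then obtain j where j: "j \<in> I" "leq i j" "tmap j i w = \<zero>\<^bsub>uce S (L j)\<^esub>"
      using U.vanish[OF i] by blast
    then have "z = \<phi>H j \<zero>\<^bsub>H2 S (L j)\<^esub>"
      using H.can_trans[OF i j(1,2) w(1)] w(2) by (simp add: H2)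
    then show "z = \<zero>\<^bsub>limH\<^esub>"
      using smod_morphism.hom_zero[OF H.can_morphism[OF j(1)]] by simp
  qed
  have carr: "carrier (smod_restrict limU (a_kernel limU limL u)) = {y \<in> carrier limU. u y = \<zero>\<^bsub>limL\<^esub>}"
    by (simp add: smod_restrict_def u.kernel_eq)
  have "bij_betw \<iota> (carrier limH) (carrier (smod_restrict limU (a_kernel limU limL u)))"
    unfolding bij_betw_def carr using inj into onto \<iota>.hom_closed by auto
  moreover have "\<iota> \<in> smod_hom S limH (smod_restrict limU (a_kernel limU limL u))"
    by (rule smod_homI)
      (auto simp: smod_restrict_def u.kernel_eq into \<iota>.hom_closed \<iota>.hom_add \<iota>.hom_smult \<iota>.hom_part H.M.Mg.deg_carrier)
  ultimately show ?thesis
    by (simp add: smod_iso_def)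
qed

end

lemma lie_iso_kernel:
  assumes K: "lie_superalgebra S K" and K': "lie_superalgebra S K'" and L: "lie_superalgebra S L"
    and h: "h \<in> lie_iso S K K'" and f: "f \<in> lie_hom S K L" and f': "f' \<in> lie_hom S K' L"
    and eq: "\<And>x. x \<in> carrier K \<Longrightarrow> f x = f' (h x)"
  shows "h \<in> smod_iso S (smod_restrict K (a_kernel K L f)) (smod_restrict K' (a_kernel K' L f'))"
proof -
  interpret f: lie_morphism S K L f using K L f by (rule lie_morphismI)
  interpret f': lie_morphism S K' L f' using K' L f' by (rule lie_morphismI)
  have bij: "bij_betw h (carrier K) (carrier K')" and hom: "h \<in> smod_hom S K K'"
    using h by (auto simp: lie_iso_def dest: lie_homD(1))
  have "h \<in> smod_hom S (smod_restrict K (a_kernel K L f)) (smod_restrict K' (a_kernel K' L f'))"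
    by (rule smod_homI)
      (auto simp: smod_restrict_def f.kernel_eq f'.kernel_eq smod_homD[OF hom] eq)
  moreover have "bij_betw h {x \<in> carrier K. f x = \<zero>\<^bsub>L\<^esub>} {y \<in> carrier K'. f' y = \<zero>\<^bsub>L\<^esub>}"
  proof (rule bij_betw_subset[OF bij])
    show "{x \<in> carrier K. f x = \<zero>\<^bsub>L\<^esub>} \<subseteq> carrier K" by blast
    have "h ` carrier K = carrier K'"
      using bij by (simp add: bij_betw_def)
    then show "h ` {x \<in> carrier K. f x = \<zero>\<^bsub>L\<^esub>} = {y \<in> carrier K'. f' y = \<zero>\<^bsub>L\<^esub>}"
      using eq by (auto simp: image_iff set_eq_iff) metis+
  qed
  ultimately show ?thesis
    by (simp add: smod_iso_def smod_restrict_def f.kernel_eq f'.kernel_eq)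
qed

theorem theorem1p6:
  fixes S :: "'s superring"
    and I :: "'i set" and leq :: "'i \<Rightarrow> 'i \<Rightarrow> bool"
    and L :: "'i \<Rightarrow> ('s, 'a) lie_superalgebra" and f :: "'i \<Rightarrow> 'i \<Rightarrow> 'a \<Rightarrow> 'a"
    and limL :: "('s, 'l) lie_superalgebra" and \<phi>L :: "'i \<Rightarrow> 'a \<Rightarrow> 'l"
    and limU :: "('s, 'u) lie_superalgebra" and \<phi>U :: "'i \<Rightarrow> 'a uce \<Rightarrow> 'u"
    and limH :: "('s, 'h) supermodule" and \<phi>H :: "'i \<Rightarrow> 'a uce \<Rightarrow> 'h"
  assumes "comm_superring S"
    and "directed_index I leq"
    and "lie_directed_system S I leq L f"
    and "\<And>i. i \<in> I \<Longrightarrow> perfect S (L i)"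
    and "lie_direct_limit S I leq L f limL \<phi>L"
    and "lie_direct_limit S I leq
           (\<lambda>i. uce S (L i)) (\<lambda>j i. uce_map S (L i) (L j) (f j i)) limU \<phi>U"
    and "smod_direct_limit S I leq
           (\<lambda>i. H2 S (L i)) (\<lambda>j i. uce_map S (L i) (L j) (f j i)) limH \<phi>H"
  shows "(\<exists>!\<phi>. lie_induced S I (\<lambda>i. uce S (L i)) limU \<phi>U
                 (uce S limL) (\<lambda>i. uce_map S (L i) limL (\<phi>L i)) \<phi>) \<and>
         (\<exists>!u. lie_induced S I (\<lambda>i. uce S (L i)) limU \<phi>U
                 limL (\<lambda>i x. \<phi>L i (uce_proj S (L i) x)) u) \<and>
         (\<exists>!\<iota>. smod_induced S I (\<lambda>i. H2 S (L i)) limH \<phi>H limU \<phi>U \<iota>) \<and>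
         (\<forall>\<phi> u \<iota>.
            lie_induced S I (\<lambda>i. uce S (L i)) limU \<phi>U
              (uce S limL) (\<lambda>i. uce_map S (L i) limL (\<phi>L i)) \<phi> \<longrightarrow>
            lie_induced S I (\<lambda>i. uce S (L i)) limU \<phi>U
              limL (\<lambda>i x. \<phi>L i (uce_proj S (L i) x)) u \<longrightarrow>
            smod_induced S I (\<lambda>i. H2 S (L i)) limH \<phi>H limU \<phi>U \<iota> \<longrightarrow>
              \<phi> \<in> lie_iso S limU (uce S limL) \<and>
              universal_central_extension TYPE('k) S limU limL u \<and>
              \<iota> \<in> smod_iso S limH (smod_restrict limU (a_kernel limU limL u)) \<and>
              \<phi> \<in> smod_iso S (smod_restrict limU (a_kernel limU limL u)) (H2 S limL) \<and>
              \<phi> \<circ> \<iota> \<in> smod_iso S limH (H2 S limL))"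
proof -
  interpret L: lie_system S I leq L f
    using assms(2,3) by (rule lie_system.intro)
  interpret U: lie_system S I leq "\<lambda>i. uce S (L i)" "\<lambda>j i. uce_map S (L i) (L j) (f j i)"
    by (rule L.uce_system)
  interpret uce_limit S I leq L f limL \<phi>L limU \<phi>U
    by (intro uce_limit.intro L.lie_direct_limit_imp_limit U.lie_direct_limit_imp_limit assms)
  interpret H: smod_limit S I leq "\<lambda>i. H2 S (L i)" tmap limH \<phi>H
    by (rule smod_direct_limit_imp_limit[OF L.H2_system assms(7)])
  interpret M: lie_superalgebra S limL by (rule L.limit_lie)
  have main: "\<phi> \<in> lie_iso S limU (uce S limL) \<and>
      universal_central_extension TYPE('k) S limU limL u \<and>
      \<iota> \<in> smod_iso S limH (smod_restrict limU (a_kernel limU limL u)) \<and>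
      \<phi> \<in> smod_iso S (smod_restrict limU (a_kernel limU limL u)) (H2 S limL) \<and>
      \<phi> \<circ> \<iota> \<in> smod_iso S limH (H2 S limL)"
    if \<phi>: "lie_induced S I (\<lambda>i. uce S (L i)) limU \<phi>U (uce S limL) cmap \<phi>"
      and u: "lie_induced S I (\<lambda>i. uce S (L i)) limU \<phi>U limL (\<lambda>i x. \<phi>L i (proj i x)) u"
      and \<iota>: "smod_induced S I (\<lambda>i. H2 S (L i)) limH \<phi>H limU \<phi>U \<iota>" for \<phi> u \<iota>
  proof -
    have iso: "\<phi> \<in> lie_iso S limU (uce S limL)"
      using \<phi> by (rule uce_limit_iso)
    have u_hom: "u \<in> lie_hom S limU limL"
      using u by (simp add: lie_induced_def)
    note eq = induced_proj_eq[OF \<phi> u]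
    have "universal_central_extension TYPE('k) S (uce S limL) limL (uce_proj S limL)"
      by (rule M.uce_universal_central_extension[OF perfect_limit[OF assms(4)]])
    then have uni: "universal_central_extension TYPE('k) S limU limL u"
      using U.limit_lie iso u_hom eq by (rule universal_central_extension_iso)
    have ker: "\<phi> \<in> smod_iso S (smod_restrict limU (a_kernel limU limL u)) (H2 S limL)"
      unfolding H2_def
      using U.limit_lie M.lie_superalgebra_uce L.limit_lie iso u_hom M.uce_proj_lie_hom eq
      by (rule lie_iso_kernel)
    have "\<iota> \<in> smod_iso S limH (smod_restrict limU (a_kernel limU limL u))"
      using H.smod_limit_axioms u \<iota> by (rule H2_limit_iso)
    then show ?thesis
      using iso uni ker smod_iso_comp by blast
  qed
  show ?thesis
    using U.lie_induced_ex1[OF cmap_cocone] U.lie_induced_ex1[OF proj_cocone]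
      H.induced_ex1[OF H2_cocone] main by blast
qed

end
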